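(* Let $n\ge 2$ be an integer, $k,c_b>0$, $\rho_0>0$, and let $\lambda_{1,0},\dots,\lambda_{n,0}$ be real numbers with $\lambda_{1,0}=\cdots=\lambda_{J,0}<\lambda_{J+1,0}\le\cdots\le\lambda_{n,0}$ for some integer $1\le J\le n$. Consider the system $$\lambda_i'=-\lambda_i^2+\frac{k}{n}(\rho-c_b)\ (i=1,\dots,n),\qquad \rho'=-\rho\lambda,\quad \lambda=\sum_{i=1}^n\lambda_i,\qquad \rho(0)=\rho_0,\ \lambda_i(0)=\lambda_{i,0}.$$ Suppose the maximal interval of existence of its solution is $[0,t_B)$ with $0<t_B<\infty$. Then $1\le J\le \frac n2$, and $$t_B\ \ge\ \frac{1}{\omega}\arctan\Big(\frac{\lambda_{1,0}}{\omega}\Big)+\frac{\pi}{2\omega},\qquad \omega:=\sqrt{kc_b/n}.$$ Moreover $\lim_{t\to t_B^-}\lambda_i(t)=-\infty$ for $1\le i\le J$, $\lim_{t\to t_B^-}\lambda_i(t)=+\infty$ for $J<i\le n$, $\lim_{t\to t_B^-}\rho(t)=+\infty$, and there exist constants $0\le q\le p$ such that $$\lim_{t\to t_B^-}\lambda_1(t)\,e^{\int_0^t(\lambda_1(s)+\lambda_n(s))\,ds}=-p,\qquad \lim_{t\to t_B^-}\lambda_n(t)\,e^{\int_0^t(\lambda_1(s)+\lambda_n(s))\,ds}=q.$$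
   Context: This is the restricted Euler–Poisson (REP) system; $'$ denotes the time derivative, and solutions are real-valued, continuously differentiable functions of $t\in[0,t_B)$. *)

theory Defs
  imports "HOL-Analysis.Analysis"
begin

definition REP_solution ::
  "nat \<Rightarrow> real \<Rightarrow> real \<Rightarrow> real \<Rightarrow> (nat \<Rightarrow> real) \<Rightarrow> real
    \<Rightarrow> (nat \<Rightarrow> real \<Rightarrow> real) \<Rightarrow> (real \<Rightarrow> real) \<Rightarrow> bool" where
  "REP_solution n k cb rho0 lam0 T lam rho \<longleftrightarrow>
     0 < T \<and>
     rho 0 = rho0 \<and> (\<forall>i\<in>{1..n}. lam i 0 = lam0 i) \<and>
     (\<forall>t\<in>{0..<T}.
        (\<forall>i\<in>{1..n}. (lam i has_real_derivative
            (- (lam i t)\<^sup>2 + k / real n * (rho t - cb))) (at t within {0..<T})) \<and>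
        (rho has_real_derivative (- rho t * (\<Sum>i=1..n. lam i t))) (at t within {0..<T}))"

end

theory Submission
  imports Defs "HOL-Probability.Discrete_Topology"
begin

text \<open>
  Write \<open>h = (k/n) (\<rho> - c\<^sub>b)\<close> and \<open>\<omega>\<^sup>2 = k c\<^sub>b / n\<close>. Since \<open>h \<ge> - \<omega>\<^sup>2\<close>, the function \<open>arctan (\<lambda>/\<omega>) + \<omega> t\<close> is nondecreasing
  along every solution of \<open>\<lambda>' = - \<lambda>\<^sup>2 + h\<close>. So \<open>\<lambda>\<^sub>1\<close> is either bounded below, in which case all unknowns are
  bounded and the solution extends, or tends to \<open>- \<infinity>\<close>; in the latter case the monotonicity gives the
  lower bound for the lifespan, and \<open>U = exp (\<integral> \<lambda>\<^sub>1) \<longlongrightarrow> 0\<close>.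

  The linearisation \<open>U'' = h U\<close> has the second solution \<open>w = U s\<close> with \<open>s = \<integral> U\<^bsup>-2\<^esup>\<close>, and every \<open>\<lambda>\<^sub>i\<close> is the
  logarithmic derivative of \<open>U + (\<lambda>\<^sub>i(0) - \<lambda>\<^sub>1(0)) w\<close>. With \<open>Q = U w\<close> and \<open>v = - \<lambda>\<^sub>1 Q\<close>, all asserted limits reduce to the
  convergence of \<open>v\<close>, the limit \<open>\<alpha>\<close> being in \<open>[1/2, 1]\<close> because \<open>Q \<longlongrightarrow> 0\<close> and \<open>Q' = 1 - 2 v\<close>; then
  \<open>p = (\<lambda>\<^sub>n(0) - \<lambda>\<^sub>1(0)) \<alpha>\<close> and \<open>q = (\<lambda>\<^sub>n(0) - \<lambda>\<^sub>1(0)) (1 - \<alpha>)\<close>. In the time \<open>\<tau> = ln s\<close>, with \<open>\<Phi> = (k/n) \<rho> Q\<^sup>2\<close>,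
  the pair \<open>(v, \<Phi>)\<close> obeys up to integrable errors the autonomous planar system
  \<open>v' = v (1 - v) - \<Phi>\<close>, \<open>\<Phi>' = \<Phi> ((n - 4) v - (n - J - 2))\<close>. For \<open>2 J > n\<close>, and for \<open>2 J = n > 4\<close>, it has no
  solution compatible with \<open>Q \<longlongrightarrow> 0\<close>; for \<open>J \<le> 2\<close> the function \<open>\<Phi>\<close> converges; for \<open>3 \<le> J < n/2\<close> the system is a damped
  oscillator, and its energy is a Lyapunov function.
\<close>

subsection \<open>Local existence\<close>

text \<open>The existence theorem below is stated for Banach spaces and is applied to
  \<open>nat discrete \<Rightarrow>\<^sub>C real\<close>, so the class \<open>banach\<close> has to
  be known for this type.\<close>

instance bcontfun :: (metric_space, banach) banach ..

text \<open>The integral operator preserves the curves in the closed ball because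
  \<open>M * d \<le> r\<close>, and it contracts the supremum distance because
  \<open>L * d < 1\<close>. The time \<open>d\<close> depends only on \<open>r\<close>,
  \<open>M\<close> and \<open>L\<close>, not on \<open>x0\<close> or \<open>t0\<close>; the
  continuation of solutions rests on this.\<close>

lemma picard_lindelof:
  fixes f :: "'a::banach \<Rightarrow> 'a"
  assumes "0 \<le> r" and d: "0 < d" "M * d \<le> r" "L * d < 1"
    and lip: "L-lipschitz_on (cball x0 r) f"
    and M: "\<And>x. x \<in> cball x0 r \<Longrightarrow> norm (f x) \<le> M"
  obtains x where "x t0 = x0"
    and "\<And>t. t \<in> {t0..t0+d} \<Longrightarrow> (x has_vector_derivative f (x t)) (at t within {t0..t0+d})"
    and "\<And>t. t \<in> {t0..t0+d} \<Longrightarrow> x t \<in> cball x0 r"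
proof -
  \<comment> \<open>Clamping time to \<open>{t0..t0+d}\<close> turns curves on the interval into
    bounded continuous functions on the whole line, which form a complete space.\<close>
  define c where "c t = max t0 (min (t0+d) t)" for t :: real
  have c: "c t \<in> {t0..t0+d}" for t using d by (auto simp: c_def)
  have c_id: "c t = t" if "t \<in> {t0..t0+d}" for t using that by (auto simp: c_def)
  have c_cont: "continuous_on S c" for S unfolding c_def by (intro continuous_intros)
  define S where "S = PiC (UNIV::real set) (\<lambda>_. cball x0 r)"
  define I where "I g t = x0 + integral {t0..c t} (\<lambda>s. f (g s))" for g :: "real \<Rightarrow> 'a" and t
  have S: "g \<in> S \<longleftrightarrow> (\<forall>t. apply_bcontfun g t \<in> cball x0 r)" for g
    by (simp add: S_def mem_PiC_iff Pi_iff)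
  have L0: "0 \<le> L" using lip by (rule lipschitz_on_nonneg)
  have M0: "0 \<le> M" using M[of x0] \<open>0 \<le> r\<close> by (smt (verit) centre_in_cball norm_ge_zero)
  have contf: "continuous_on A (\<lambda>s. f (apply_bcontfun g s))" if "g \<in> S" for g A
    by (rule continuous_on_compose2[OF lipschitz_on_continuous_on[OF lip]]) (use that in \<open>auto simp: S\<close>)
  have intg: "(\<lambda>s. f (apply_bcontfun g s)) integrable_on {a..b}" if "g \<in> S" for g a b
    by (rule integrable_continuous_real[OF contf[OF that]])
  have bnd: "norm (I g t - x0) \<le> r" if g: "g \<in> S" for g t
  proof -
    have "norm (integral {t0..c t} (\<lambda>s. f (g s))) \<le> M * (c t - t0)"
      by (rule integral_bound) (use c[of t] contf[OF g] M g in \<open>auto simp: S\<close>)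
    also have "\<dots> \<le> M * d" using c[of t] M0 by (intro mult_left_mono) auto
    finally show ?thesis using d by (simp add: I_def)
  qed
  have contI: "continuous_on UNIV (I g)" if g: "g \<in> S" for g
  proof -
    have "continuous_on {t0..t0+d} (\<lambda>t. integral {t0..t} (\<lambda>s. f (g s)))"
      by (rule indefinite_integral_continuous_1[OF intg[OF g]])
    then show ?thesis unfolding I_def
      by (intro continuous_intros continuous_on_compose2[OF _ c_cont]) (use c in auto)
  qed
  have bc: "I g \<in> bcontfun" if g: "g \<in> S" for g
  proof (rule bcontfun_normI[OF contI[OF g]])
    show "norm (I (apply_bcontfun g) t) \<le> norm x0 + r" for t
      using bnd[OF g, of t] by (smt (verit) norm_triangle_sub)
  qed
  define T where "T g = Bcontfun (I (apply_bcontfun g))" for g :: "real \<Rightarrow>\<^sub>C 'a"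
  have T: "apply_bcontfun (T g) = I g" if "g \<in> S" for g
    using bc[OF that] by (simp add: T_def Bcontfun_inverse)
  have "\<exists>!g\<in>S. T g = g"
  proof (rule Banach_fix)
    show "complete S" unfolding S_def complete_eq_closed by (intro closed_PiC) auto
    have "const_bcontfun x0 \<in> S" using \<open>0 \<le> r\<close> by (simp add: S)
    then show "S \<noteq> {}" by auto
    show "0 \<le> L * d" "L * d < 1" using L0 d by auto
    show "T ` S \<subseteq> S" using bnd by (auto simp: S T dist_norm norm_minus_commute)
    show "dist (T g) (T h) \<le> L * d * dist g h" if g: "g \<in> S" "h \<in> S" for g h
    proof (rule dist_bound)
      fix t
      have "dist (T g t) (T h t) = norm (integral {t0..c t} (\<lambda>s. f (g s) - f (h s)))"
        using g by (simp add: T I_def dist_norm integral_diff intg)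
      also have "\<dots> \<le> (L * dist g h) * (c t - t0)"
      proof (rule integral_bound)
        show "t0 \<le> c t" using c[of t] by auto
        show "continuous_on {t0..c t} (\<lambda>s. f (g s) - f (h s))"
          by (intro continuous_intros contf g)
        show "norm (f (g s) - f (h s)) \<le> L * dist g h" if "s \<in> {t0..c t}" for s
        proof -
          have "dist (f (g s)) (f (h s)) \<le> L * dist (g s) (h s)"
            by (rule lipschitz_onD[OF lip]) (use g in \<open>auto simp: S\<close>)
          also have "\<dots> \<le> L * dist g h" by (intro mult_left_mono dist_bounded L0)
          finally show ?thesis by (simp add: dist_norm)
        qed
      qed
      also have "\<dots> \<le> (L * dist g h) * d" using c[of t] L0 by (intro mult_left_mono) auto
      finally show "dist (T g t) (T h t) \<le> L * d * dist g h" by (simp add: mult_ac)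
    qed
  qed
  then obtain g where g: "g \<in> S" "T g = g" by blast
  have fix_eq: "apply_bcontfun g t = I g t" for t using T[OF g(1)] g(2) by simp
  show thesis
  proof
    show "apply_bcontfun g t \<in> cball x0 r" for t using g(1) by (simp add: S)
    show "apply_bcontfun g t0 = x0" using fix_eq[of t0] d by (simp add: I_def c_def)
    fix t assume t: "t \<in> {t0..t0+d}"
    have "((\<lambda>u. x0 + integral {t0..u} (\<lambda>s. f (g s))) has_vector_derivative f (g t)) (at t within {t0..t0+d})"
      using integral_has_vector_derivative[OF contf[OF g(1)] t] by (auto intro!: derivative_eq_intros)
    then show "(apply_bcontfun g has_vector_derivative f (g t)) (at t within {t0..t0+d})"
    proof (rule has_vector_derivative_transform[OF t, rotated])
      show "apply_bcontfun g u = x0 + integral {t0..u} (\<lambda>s. f (g s))" if "u \<in> {t0..t0+d}" for u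
        using fix_eq[of u] by (simp add: I_def c_id[OF that])
    qed
  qed
qed


text \<open>Uniformity is the point: one \<open>d\<close> serves all data of size at most
  \<open>R\<close> and all initial times, so a solution that stays bounded can be restarted
  arbitrarily close to its end.\<close>

lemma REP_local_existence:
  fixes k cb R :: real and n :: nat
  obtains d where "0 < d"
    and "\<And>r1 l1 t1. \<lbrakk>\<bar>r1\<bar> \<le> R; \<And>i. i \<in> {1..n} \<Longrightarrow> \<bar>l1 i\<bar> \<le> R\<rbrakk> \<Longrightarrow>
      \<exists>lam rho. rho t1 = r1 \<and> (\<forall>i\<in>{1..n}. lam i t1 = l1 i) \<and>
       (\<forall>t\<in>{t1..t1+d}.
          (\<forall>i\<in>{1..n}. (lam i has_real_derivative
            (- (lam i t)\<^sup>2 + k / real n * (rho t - cb))) (at t within {t1..t1+d})) \<and>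
          (rho has_real_derivative (- rho t * (\<Sum>i=1..n. lam i t))) (at t within {t1..t1+d}))"
proof -
  \<comment> \<open>The number \<open>n\<close> of equations is a term and not a type, so the
    unknowns are packed into one sequence: entry 0 is \<rho>, entries 1 to \<open>n\<close> are the
    \<open>\<lambda>\<^sub>i\<close>, and later entries have velocity 0.\<close>
  define F where "F x i = (if i = 0 then - x 0 * (\<Sum>j=1..n. x j)
      else if i \<le> n then - (x i)\<^sup>2 + k / real n * (x 0 - cb) else 0)" for x :: "nat \<Rightarrow> real" and i
  \<comment> \<open>\<open>P\<close> bounds every entry in the unit ball around data of size
    \<open>R\<close>; \<open>M\<close> and \<open>L\<close> are then a bound and a Lipschitz
    constant of \<open>F\<close> in the supremum norm.\<close>
  define P where "P = \<bar>R\<bar> + 1"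
  have P: "0 < P" by (simp add: P_def)
  define M where "M = P * (n * P) + P\<^sup>2 + \<bar>k / n\<bar> * (P + \<bar>cb\<bar>)"
  define L where "L = 2 * n * P + 2 * P + \<bar>k / n\<bar>"
  have M': "0 \<le> P * (n * P)" "0 \<le> \<bar>k / n\<bar> * (P + \<bar>cb\<bar>)" "0 < P\<^sup>2" using P by auto
  then have M: "0 < M" unfolding M_def by linarith
  have L': "0 \<le> 2 * n * P" using P by auto
  then have L: "0 < L" unfolding L_def using P by (smt (verit) abs_ge_zero)
  have F_bound: "\<bar>F x i\<bar> \<le> M" if x: "\<And>i. \<bar>x i\<bar> \<le> P" for x i
  proof -
    have "\<bar>\<Sum>j=1..n. x j\<bar> \<le> n * P"
      using sum_norm_bound[of "{1..n}" x P] x by simp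
    then have "\<bar>- x 0 * (\<Sum>j=1..n. x j)\<bar> \<le> P * (n * P)"
      unfolding abs_mult abs_minus_cancel using x P by (intro mult_mono) auto
    moreover have "\<bar>(x i)\<^sup>2\<bar> \<le> P\<^sup>2" using x[of i] by (simp add: abs_le_square_iff[symmetric])
    moreover have "\<bar>k / n * (x 0 - cb)\<bar> \<le> \<bar>k / n\<bar> * (P + \<bar>cb\<bar>)"
      unfolding abs_mult using x[of 0] by (intro mult_left_mono) auto
    ultimately show ?thesis using M M' unfolding F_def M_def by (smt (verit))
  qed
  have F_lip: "\<bar>F x i - F y i\<bar> \<le> L * e"
    if x: "\<And>i. \<bar>x i\<bar> \<le> P" and y: "\<And>i. \<bar>y i\<bar> \<le> P" and e: "\<And>i. \<bar>x i - y i\<bar> \<le> e" for x y i e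
  proof -
    have e0: "0 \<le> e" using e[of 0] by simp
    have "\<bar>\<Sum>j=1..n. x j\<bar> \<le> n * P"
      using sum_norm_bound[of "{1..n}" x P] x by simp
    moreover have "\<bar>(\<Sum>j=1..n. x j) - (\<Sum>j=1..n. y j)\<bar> \<le> n * e"
      using sum_norm_bound[of "{1..n}" "\<lambda>j. x j - y j" e] e by (simp add: sum_subtractf)
    ultimately have "\<bar>(x 0 - y 0) * (\<Sum>j=1..n. x j)\<bar> \<le> e * (n * P)"
       "\<bar>y 0 * ((\<Sum>j=1..n. x j) - (\<Sum>j=1..n. y j))\<bar> \<le> P * (n * e)"
      unfolding abs_mult using e[of 0] y[of 0] e0 P by (auto intro!: mult_mono)
    then have "\<bar>- x 0 * (\<Sum>j=1..n. x j) - - y 0 * (\<Sum>j=1..n. y j)\<bar> \<le> 2 * n * P * e"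
      by (simp add: algebra_simps abs_if split: if_splits)
    moreover have "\<bar>(x i - y i) * (x i + y i)\<bar> \<le> e * (2 * P)"
      unfolding abs_mult using e[of i] x[of i] y[of i] e0 by (intro mult_mono) auto
    then have "\<bar>- (x i)\<^sup>2 - - (y i)\<^sup>2\<bar> \<le> 2 * P * e"
      by (simp add: algebra_simps power2_eq_square abs_minus_commute)
    moreover have "\<bar>k / n * (x 0 - cb) - k / n * (y 0 - cb)\<bar> \<le> \<bar>k / n\<bar> * e"
      using mult_left_mono[OF e[of 0], of "\<bar>k / n\<bar>"]
      unfolding right_diff_distrib[symmetric] abs_mult by simp
    moreover have "0 \<le> 2 * n * P * e" "0 \<le> 2 * P * e" "0 \<le> \<bar>k / n\<bar> * e" "0 \<le> L * e"
      using e0 P L by auto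
    moreover have "L * e = 2 * n * P * e + 2 * P * e + \<bar>k / n\<bar> * e"
      by (simp add: L_def algebra_simps)
    ultimately show ?thesis unfolding F_def by (auto split: if_splits)
  qed
  \<comment> \<open>All functions on \<open>nat discrete\<close> are continuous, so the bounded
    continuous ones form the Banach space of bounded sequences.\<close>
  define seq where "seq x i = apply_bcontfun x (discrete i)" for x :: "nat discrete \<Rightarrow>\<^sub>C real" and i
  define of_seq where "of_seq x = Bcontfun (\<lambda>j. x (of_discrete j))" for x :: "nat \<Rightarrow> real"
  have seq_of_seq: "seq (of_seq x) = x" if "\<And>i. \<bar>x i\<bar> \<le> b" for x b
  proof -
    have "(\<lambda>j. x (of_discrete j)) \<in> bcontfun"
      by (rule bcontfun_normI[of _ b])
        (use that in \<open>auto simp: continuous_on_open_vimage open_discrete\<close>)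
    then show ?thesis
      by (auto simp: seq_def of_seq_def Bcontfun_inverse discrete_inverse)
  qed
  have apply_seq: "apply_bcontfun x j = seq x (of_discrete j)" for x j
    by (simp add: seq_def of_discrete_inverse)
  define f where "f x = of_seq (F (seq x))" for x
  define d where "d = min (1 / M) (1 / (2 * L))"
  have d: "0 < d" "M * d \<le> 1" "L * d < 1"
  proof -
    show "0 < d" using M L by (simp add: d_def)
    have "M * d \<le> M * (1 / M)" using M by (intro mult_left_mono) (auto simp: d_def)
    then show "M * d \<le> 1" using M by simp
    have "L * d \<le> L * (1 / (2 * L))" using L by (intro mult_left_mono) (auto simp: d_def)
    then show "L * d < 1" using L by simp
  qed
  show thesis
  proof (rule that[OF d(1)])
    fix r1 :: real and l1 :: "nat \<Rightarrow> real" and t1 :: real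
    assume r1: "\<bar>r1\<bar> \<le> R" and l1: "\<And>i. i \<in> {1..n} \<Longrightarrow> \<bar>l1 i\<bar> \<le> R"
    define x0' where "x0' i = (if i = 0 then r1 else if i \<le> n then l1 i else 0)" for i
    have x0'b: "\<bar>x0' i\<bar> \<le> \<bar>R\<bar>" for i using r1 l1[of i] by (auto simp: x0'_def)
    define x0 where "x0 = of_seq x0'"
    have x0: "seq x0 = x0'"
      unfolding x0_def by (rule seq_of_seq[OF x0'b])
    have seq_dist: "\<bar>seq x i - seq y i\<bar> \<le> dist x y" for x y i
      using dist_bounded[of x "discrete i" y] by (simp add: dist_real_def seq_def)
    have ball: "\<bar>seq x i\<bar> \<le> P" if "x \<in> cball x0 1" for x i
    proof -
      have "\<bar>seq x0 i - seq x i\<bar> \<le> 1"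
        using seq_dist[of x0 i x] that by simp
      then show ?thesis using x0'b[of i] unfolding x0 P_def by linarith
    qed
    have f: "seq (f x) = F (seq x)" if "x \<in> cball x0 1" for x
      unfolding f_def by (rule seq_of_seq[OF F_bound[OF ball[OF that]]])
    have fM: "norm (f x) \<le> M" if "x \<in> cball x0 1" for x
      by (rule norm_bound) (use F_bound[OF ball[OF that]] in \<open>simp add: apply_seq f[OF that]\<close>)
    have fL: "L-lipschitz_on (cball x0 1) f"
    proof (rule lipschitz_onI)
      fix x y assume xy: "x \<in> cball x0 1" "y \<in> cball x0 1"
      show "dist (f x) (f y) \<le> L * dist x y"
      proof (rule dist_bound)
        show "dist (f x j) (f y j) \<le> L * dist x y" for j
          using F_lip[of "seq x" "seq y" "dist x y" "of_discrete j", OF ball[OF xy(1)] ball[OF xy(2)] seq_dist]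
          unfolding apply_seq f[OF xy(1)] f[OF xy(2)] dist_real_def .
      qed
    qed (use L in auto)
    obtain x where x: "x t1 = x0"
        "\<And>t. t \<in> {t1..t1+d} \<Longrightarrow> (x has_vector_derivative f (x t)) (at t within {t1..t1+d})"
        "\<And>t. t \<in> {t1..t1+d} \<Longrightarrow> x t \<in> cball x0 1"
    proof (rule picard_lindelof[where r = 1 and M = M and L = L and d = d and f = f and ?x0.0 = x0 and ?t0.0 = t1])
      show "norm (f x) \<le> M" if "x \<in> cball x0 1" for x by (rule fM[OF that])
    qed (use d fL in auto)
    have bl: "bounded_linear (\<lambda>x. seq x i)" for i
      unfolding seq_def by (rule bounded_linear_intro[of _ 1]) (use norm_bounded[where 'b = real] in auto)
    have D: "((\<lambda>t. seq (x t) i) has_real_derivative F (seq (x t)) i) (at t within {t1..t1+d})"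
      if t: "t \<in> {t1..t1+d}" for t i
      using bounded_linear.has_vector_derivative[OF bl x(2)[OF t], of i] f[OF x(3)[OF t]]
      by (simp add: has_real_derivative_iff_has_vector_derivative)
    show "\<exists>lam rho. rho t1 = r1 \<and> (\<forall>i\<in>{1..n}. lam i t1 = l1 i) \<and>
       (\<forall>t\<in>{t1..t1+d}.
          (\<forall>i\<in>{1..n}. (lam i has_real_derivative
            (- (lam i t)\<^sup>2 + k / real n * (rho t - cb))) (at t within {t1..t1+d})) \<and>
          (rho has_real_derivative (- rho t * (\<Sum>i=1..n. lam i t))) (at t within {t1..t1+d}))"
    proof (intro exI[of _ "\<lambda>i t. seq (x t) i"] exI[of _ "\<lambda>t. seq (x t) 0"]
        conjI ballI)
      show "seq (x t1) 0 = r1" by (simp add: x x0 x0'_def)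
      show "seq (x t1) i = l1 i" if "i \<in> {1..n}" for i
        using that by (auto simp: x x0 x0'_def)
    next
      fix t i assume "t \<in> {t1..t1+d}" "i \<in> {1..n}"
      then show "((\<lambda>t. seq (x t) i) has_real_derivative - (seq (x t) i)\<^sup>2 +
          k / real n * (seq (x t) 0 - cb)) (at t within {t1..t1+d})"
        using D[of t i] by (auto simp: F_def)
    next
      fix t assume "t \<in> {t1..t1+d}"
      then show "((\<lambda>t. seq (x t) 0) has_real_derivative
          - seq (x t) 0 * (\<Sum>i = 1..n. seq (x t) i)) (at t within {t1..t1+d})"
        using D[of t 0] by (simp add: F_def)
    qed
  qed
qed

text \<open>The filter at \<open>t\<close> within the union is the supremum of the filters within
  the two pieces. For \<open>t\<close> off \<open>b\<close>, the filter of the piece across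
  \<open>b\<close> is \<open>bot\<close>; only at \<open>t = b\<close> do both pieces
  contribute.\<close>

lemma has_real_derivative_glue:
  fixes f g :: "real \<Rightarrow> real"
  assumes ab: "a \<le> b" "b < c" and eq: "f b = g b"
    and f: "t \<le> b \<Longrightarrow> (f has_real_derivative D) (at t within {a..b})"
    and g: "b \<le> t \<Longrightarrow> (g has_real_derivative D) (at t within {b..<c})"
  shows "((\<lambda>x. if x \<le> b then f x else g x) has_real_derivative D) (at t within {a..<c})"
    (is "(?h has_real_derivative D) _")
proof -
  have un: "{a..<c} = {a..b} \<union> {b..<c}" using ab by auto
  have "(?h has_real_derivative D) (at t within {a..b})"
  proof (cases "t \<le> b")
    case True
    have "eventually (\<lambda>x. ?h x = f x) (at t within {a..b})"
      by (auto simp: eventually_at_filter)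
    with f[OF True] True show ?thesis
      by (subst has_field_derivative_cong_eventually[where g = f]) auto
  next
    case False
    then have "at t within {a..b} = bot" by (simp add: at_within_eq_bot_iff)
    then show ?thesis by (simp add: has_field_derivative_iff)
  qed
  moreover have "(?h has_real_derivative D) (at t within {b..<c})"
  proof (cases "b \<le> t")
    case True
    have "eventually (\<lambda>x. ?h x = g x) (at t within {b..<c})"
      using eq by (auto simp: eventually_at_filter intro!: always_eventually)
    with g[OF True] True eq show ?thesis
      by (subst has_field_derivative_cong_eventually[where g = g]) auto
  next
    case False
    then have "at t within {b..<c} = bot" using ab by (simp add: at_within_eq_bot_iff)
    then show ?thesis by (simp add: has_field_derivative_iff)
  qed
  ultimately show ?thesis
    unfolding has_field_derivative_iff unfolding un at_within_union by (rule filterlim_sup)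
qed

text \<open>A restart shortly before \<open>T\<close> leads past \<open>T\<close>, because the
  length \<open>d\<close> of local solutions does not shrink as the restart time approaches
  \<open>T\<close>. The old solution up to \<open>t1\<close> is glued to the new one.\<close>

lemma bounded_REP_solution_extends:
  assumes sol: "REP_solution n k cb rho0 lam0 T lam rho"
    and rho_bd: "\<And>t. t \<in> {0..<T} \<Longrightarrow> \<bar>rho t\<bar> \<le> R"
    and lam_bd: "\<And>t i. t \<in> {0..<T} \<Longrightarrow> i \<in> {1..n} \<Longrightarrow> \<bar>lam i t\<bar> \<le> R"
  shows "\<exists>T'>T. \<exists>lam' rho'. REP_solution n k cb rho0 lam0 T' lam' rho'"
proof -
  obtain d where d: "0 < d" and ex: "\<And>r1 l1 t1. \<lbrakk>\<bar>r1\<bar> \<le> R; \<And>i. i \<in> {1..n} \<Longrightarrow> \<bar>l1 i\<bar> \<le> R\<rbrakk> \<Longrightarrow>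
      \<exists>lam rho. rho t1 = r1 \<and> (\<forall>i\<in>{1..n}. lam i t1 = l1 i) \<and>
       (\<forall>t\<in>{t1..t1+d}.
          (\<forall>i\<in>{1..n}. (lam i has_real_derivative
            (- (lam i t)\<^sup>2 + k / real n * (rho t - cb))) (at t within {t1..t1+d})) \<and>
          (rho has_real_derivative (- rho t * (\<Sum>i=1..n. lam i t))) (at t within {t1..t1+d}))"
    by (rule REP_local_existence[of R n k cb]) blast
  have T: "0 < T" using sol by (simp add: REP_solution_def)
  \<comment> \<open>Within \<open>d / 2\<close> of \<open>T\<close>, so that the restarted solution
    reaches beyond \<open>T\<close>; the maximum covers \<open>T < d / 2\<close>, where the restart
    is at time 0.\<close>
  define t1 where "t1 = max 0 (T - d / 2)"
  have t1: "0 \<le> t1" "t1 < T" "T < t1 + d" using T d by (auto simp: t1_def)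
  obtain lam1 rho1 where rho1: "rho1 t1 = rho t1" and lam1: "\<And>i. i \<in> {1..n} \<Longrightarrow> lam1 i t1 = lam i t1"
    and D1: "\<And>t i. t \<in> {t1..t1+d} \<Longrightarrow> i \<in> {1..n} \<Longrightarrow> (lam1 i has_real_derivative
            (- (lam1 i t)\<^sup>2 + k / real n * (rho1 t - cb))) (at t within {t1..t1+d})"
     "\<And>t. t \<in> {t1..t1+d} \<Longrightarrow> (rho1 has_real_derivative (- rho1 t * (\<Sum>i=1..n. lam1 i t)))
          (at t within {t1..t1+d})"
  proof -
    have "\<bar>rho t1\<bar> \<le> R" "\<And>i. i \<in> {1..n} \<Longrightarrow> \<bar>lam i t1\<bar> \<le> R"
      using rho_bd lam_bd t1 by auto
    from ex[of "rho t1" "\<lambda>i. lam i t1" t1, OF this] show thesis using that by blast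
  qed
  have D0: "\<And>t i. t \<in> {0..<T} \<Longrightarrow> i \<in> {1..n} \<Longrightarrow> (lam i has_real_derivative
            (- (lam i t)\<^sup>2 + k / real n * (rho t - cb))) (at t within {0..<T})"
     "\<And>t. t \<in> {0..<T} \<Longrightarrow> (rho has_real_derivative (- rho t * (\<Sum>i=1..n. lam i t)))
          (at t within {0..<T})"
    using sol by (auto simp: REP_solution_def)
  define lam' where "lam' i t = (if t \<le> t1 then lam i t else lam1 i t)" for i t
  define rho' where "rho' t = (if t \<le> t1 then rho t else rho1 t)" for t
  have right: "lam' i t = lam1 i t" if "t1 \<le> t" "i \<in> {1..n}" for i t
    using that lam1 by (auto simp: lam'_def)
  have right_rho: "rho' t = rho1 t" if "t1 \<le> t" for t
    using that rho1 by (auto simp: rho'_def)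
  have "REP_solution n k cb rho0 lam0 (t1 + d) lam' rho'"
    unfolding REP_solution_def
  proof (intro conjI ballI)
    show "0 < t1 + d" using t1 d by simp
    show "rho' 0 = rho0" "\<And>i. i \<in> {1..n} \<Longrightarrow> lam' i 0 = lam0 i"
      using sol t1 by (auto simp: REP_solution_def rho'_def lam'_def)
  next
    fix t i assume t: "t \<in> {0..<t1+d}" and i: "i \<in> {1..n}"
    have "((\<lambda>t. if t \<le> t1 then lam i t else lam1 i t) has_real_derivative
        - (lam' i t)\<^sup>2 + k / real n * (rho' t - cb)) (at t within {0..<t1+d})"
    proof (rule has_real_derivative_glue)
      show "(lam i has_real_derivative - (lam' i t)\<^sup>2 + k / real n * (rho' t - cb)) (at t within {0..t1})"
        if "t \<le> t1"
        using that t t1 D0(1)[of t i] i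
        by (auto simp: lam'_def rho'_def intro: has_field_derivative_subset)
      show "(lam1 i has_real_derivative - (lam' i t)\<^sup>2 + k / real n * (rho' t - cb)) (at t within {t1..<t1+d})"
        if "t1 \<le> t"
        using that t t1 D1(1)[of t i] i right_rho[OF that] right[OF that i]
        by (auto intro: has_field_derivative_subset)
    qed (use t1 d lam1[OF i] in auto)
    then show "(lam' i has_real_derivative - (lam' i t)\<^sup>2 + k / real n * (rho' t - cb)) (at t within {0..<t1+d})"
      unfolding lam'_def[of i, abs_def] .
  next
    fix t assume t: "t \<in> {0..<t1+d}"
    show "(rho' has_real_derivative - rho' t * (\<Sum>i=1..n. lam' i t)) (at t within {0..<t1+d})"
      unfolding rho'_def[abs_def]
    proof (rule has_real_derivative_glue)
      show "(rho has_real_derivative - (if t \<le> t1 then rho t else rho1 t) * (\<Sum>i=1..n. lam' i t))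
          (at t within {0..t1})"
        if "t \<le> t1"
        using that t t1 D0(2)[of t]
        by (auto simp: lam'_def intro: has_field_derivative_subset)
      show "(rho1 has_real_derivative - (if t \<le> t1 then rho t else rho1 t) * (\<Sum>i=1..n. lam' i t))
          (at t within {t1..<t1+d})"
        if "t1 \<le> t"
        using that t t1 D1(2)[of t] right_rho[OF that] right[OF that]
        by (auto simp: rho'_def intro: has_field_derivative_subset)
    qed (use t1 d rho1 in auto)
  qed
  then show ?thesis using t1 by blast
qed

subsection \<open>Asymptotics at the end of an interval\<close>

text \<open>Here \<open>f\<close> is nondecreasing on a left neighbourhood of \<open>T\<close>, and
  its limit, if it is bounded above, is its supremum there. Most estimates below are phrased as
  monotonicity of a suitable combination of functions and pass through these three facts.\<close>

lemma nonneg_deriv_at_left: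
  fixes f f' :: "real \<Rightarrow> real"
  assumes "eventually (\<lambda>t. (f has_real_derivative f' t) (at t) \<and> 0 \<le> f' t) (at_left T)"
  shows "\<exists>c. eventually (\<lambda>t. c \<le> f t) (at_left T)"
    and "eventually (\<lambda>t. f t \<le> b) (at_left T) \<Longrightarrow> \<exists>l. (f \<longlongrightarrow> l) (at_left T)"
    and "(f \<longlongrightarrow> l) (at_left T) \<Longrightarrow> eventually (\<lambda>t. f t \<le> l) (at_left T)"
proof -
  obtain t0 where t0: "t0 < T" "\<And>t. t0 < t \<Longrightarrow> t < T \<Longrightarrow> (f has_real_derivative f' t) (at t) \<and> 0 \<le> f' t"
    using assms by (auto simp: eventually_at_left_field)
  have mono: "f x \<le> f y" if "t0 < x" "x \<le> y" "y < T" for x y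
    by (rule DERIV_nonneg_imp_nondecreasing[OF that(2)]) (use t0(2) that in \<open>meson less_le_trans le_less_trans\<close>)
  define t1 where "t1 = (t0 + T) / 2"
  have t1: "t0 < t1" "t1 < T" using t0 by (auto simp: t1_def)
  show "\<exists>c. eventually (\<lambda>t. c \<le> f t) (at_left T)"
    using mono t1 by (intro exI[of _ "f t1"]) (auto simp: eventually_at_left_field intro!: exI[of _ t1])
  show "eventually (\<lambda>t. f t \<le> l) (at_left T)" if lim: "(f \<longlongrightarrow> l) (at_left T)" for l
    unfolding eventually_at_left_field
  proof (intro exI[of _ t0] conjI allI impI t0(1))
    fix x assume x: "t0 < x" "x < T"
    have "eventually (\<lambda>t. f x \<le> f t) (at_left T)"
      using mono x by (auto simp: eventually_at_left_field intro!: exI[of _ x])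
    then show "f x \<le> l" by (rule tendsto_lowerbound[OF lim]) simp
  qed
  show "\<exists>l. (f \<longlongrightarrow> l) (at_left T)" if bound: "eventually (\<lambda>t. f t \<le> b) (at_left T)"
  proof -
    obtain t2 where t2: "t2 < T" "\<And>t. t2 < t \<Longrightarrow> t < T \<Longrightarrow> f t \<le> b"
      using bound by (auto simp: eventually_at_left_field)
    define A where "A = f ` {max t0 t2<..<T}"
    have ne: "A \<noteq> {}" using t2(1) t0(1) unfolding A_def by auto
    have bdd: "bdd_above A" using t2 by (auto simp: A_def intro!: bdd_aboveI[of _ b])
    have "(f \<longlongrightarrow> Sup A) (at_left T)"
    proof (rule order_tendstoI)
      fix y assume "y < Sup A"
      then obtain x where x: "max t0 t2 < x" "x < T" "y < f x"
        using less_cSup_iff[OF ne bdd] by (auto simp: A_def)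
      then show "eventually (\<lambda>t. y < f t) (at_left T)"
        unfolding eventually_at_left_field by (intro exI[of _ x]) (auto intro: less_le_trans[OF x(3) mono])
    next
      fix y assume "Sup A < y"
      then have "f t < y" if "max t0 t2 < t" "t < T" for t
        using cSup_upper[OF _ bdd, of "f t"] that by (force simp: A_def)
      then show "eventually (\<lambda>t. f t < y) (at_left T)"
        unfolding eventually_at_left_field using t0(1) t2(1) by (intro exI[of _ "max t0 t2"]) auto
    qed
    then show ?thesis by blast
  qed
qed

text \<open>The difference \<open>f - c * \<tau>\<close> is nondecreasing near \<open>T\<close>,
  hence bounded below. In applications \<tau> is a new time that runs to infinity.\<close>

lemma filterlim_at_top_of_deriv_ge:
  fixes f f' \<tau> \<tau>' :: "real \<Rightarrow> real"
  assumes f: "eventually (\<lambda>t. (f has_real_derivative f' t) (at t)) (at_left T)"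
    and \<tau>: "eventually (\<lambda>t. (\<tau> has_real_derivative \<tau>' t) (at t)) (at_left T)"
    and ge: "eventually (\<lambda>t. c * \<tau>' t \<le> f' t) (at_left T)" and c: "0 < c"
    and lim: "filterlim \<tau> at_top (at_left T)"
  shows "filterlim f at_top (at_left T)"
proof -
  have "eventually (\<lambda>t. ((\<lambda>t. f t - c * \<tau> t) has_real_derivative f' t - c * \<tau>' t) (at t)
      \<and> 0 \<le> f' t - c * \<tau>' t) (at_left T)"
    using f \<tau> ge by eventually_elim (auto intro!: derivative_eq_intros)
  from nonneg_deriv_at_left(1)[OF this]
  obtain d where d: "eventually (\<lambda>t. d \<le> f t - c * \<tau> t) (at_left T)" by blast
  have "filterlim (\<lambda>t. d + c * \<tau> t) at_top (at_left T)"
    by (intro filterlim_tendsto_add_at_top[OF tendsto_const]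
        filterlim_tendsto_pos_mult_at_top[OF tendsto_const c lim])
  then show ?thesis
    by (rule filterlim_at_top_mono) (use d in \<open>auto elim: eventually_mono\<close>)
qed

text \<open>The graph can cross the level \<open>c\<close> only upwards, so once above
  \<open>c\<close> it cannot come back.\<close>

lemma eventually_one_side:
  fixes f f' :: "real \<Rightarrow> real"
  assumes "eventually (\<lambda>t. (f has_real_derivative f' t) (at t)) (at_left T)"
    and "eventually (\<lambda>t. f t = c \<longrightarrow> 0 < f' t) (at_left T)"
  shows "eventually (\<lambda>t. c \<le> f t) (at_left T) \<or> eventually (\<lambda>t. f t \<le> c) (at_left T)"
proof -
  obtain t0 where t0: "t0 < T" "\<And>t. t0 < t \<Longrightarrow> t < T \<Longrightarrow> (f has_real_derivative f' t) (at t)"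
      "\<And>t. t0 < t \<Longrightarrow> t < T \<Longrightarrow> f t = c \<Longrightarrow> 0 < f' t"
    using eventually_conj[OF assms] by (auto simp: eventually_at_left_field)
  have cont: "isCont f t" if "t0 < t" "t < T" for t
    using t0(2)[OF that] by (rule DERIV_isCont)
  show ?thesis
  proof (cases "\<exists>t1. t0 < t1 \<and> t1 < T \<and> c < f t1")
    case False
    then have "eventually (\<lambda>t. f t \<le> c) (at_left T)" using t0(1)
      unfolding eventually_at_left_field by (meson not_less)
    then show ?thesis ..
  next
    case True
    then obtain t1 where t1: "t0 < t1" "t1 < T" "c < f t1" by blast
    have "c \<le> f t2" if t2: "t1 < t2" "t2 < T" for t2
    proof (rule ccontr)
      assume "\<not> c \<le> f t2"
      then have lt: "f t2 < c" by simp
      \<comment> \<open>The least point of \<open>A\<close> is the first return to the level; there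
        \<open>f = c\<close>, and the positive derivative puts points just before it into
        \<open>A\<close> as well.\<close>
      define A where "A = {t1..t2} \<inter> f -` {..c}"
      have "continuous_on {t1..t2} f"
        using cont t1 t2 by (intro continuous_at_imp_continuous_on) auto
      then have "closed A" unfolding A_def by (rule continuous_closed_preimage) auto
      moreover have "bounded A" unfolding A_def by (intro bounded_Int) simp
      ultimately have "compact A" by (simp add: compact_eq_bounded_closed)
      moreover have "t2 \<in> A" using lt t2 by (auto simp: A_def)
      ultimately obtain u where u: "u \<in> A" "\<And>x. x \<in> A \<Longrightarrow> u \<le> x"
        using compact_attains_inf[of A] by blast
      have ut: "t1 < u" "u \<le> t2" using u(1) t1 by (auto simp: A_def order_less_le)
      have fu: "f u = c"
      proof (rule ccontr)
        assume "f u \<noteq> c"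
        then have "f u < c" using u(1) by (auto simp: A_def)
        then obtain x where "t1 \<le> x" "x \<le> u" "f x = c"
          using IVT2[of f u c t1] t1 ut t2 cont by force
        then show False using u(2)[of x] \<open>f u \<noteq> c\<close> ut by (auto simp: A_def)
      qed
      have "0 < f' u" by (rule t0(3)) (use ut t1 t2 fu in auto)
      then obtain e where e: "0 < e" "\<And>h. 0 < h \<Longrightarrow> h < e \<Longrightarrow> f (u - h) < f u"
        using DERIV_pos_inc_left[OF t0(2)[of u]] ut t1 t2 by auto
      define h where "h = min (e / 2) ((u - t1) / 2)"
      have h: "0 < h" "h < e" "t1 < u - h" using e ut by (auto simp: h_def min_def field_simps)
      then have "u - h \<in> A" using e(2)[of h] fu ut by (auto simp: A_def)
      then show False using u(2)[of "u - h"] h by simp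
    qed
    then show ?thesis using t1 by (auto simp: eventually_at_left_field intro!: exI[of _ t1])
  qed
qed

lemma eventually_one_side':
  fixes f f' :: "real \<Rightarrow> real"
  assumes "eventually (\<lambda>t. (f has_real_derivative f' t) (at t)) (at_left T)"
    and "eventually (\<lambda>t. f t = c \<longrightarrow> f' t < 0) (at_left T)"
  shows "eventually (\<lambda>t. c \<le> f t) (at_left T) \<or> eventually (\<lambda>t. f t \<le> c) (at_left T)"
proof -
  have "eventually (\<lambda>t. ((\<lambda>t. - f t) has_real_derivative - f' t) (at t)) (at_left T)"
    using assms(1) by eventually_elim (auto intro!: derivative_eq_intros)
  then show ?thesis
    using eventually_one_side[of "\<lambda>t. - f t" "\<lambda>t. - f' t" T "-c"] assms(2) by auto
qed

text \<open>If the lower and upper limits differed, \<open>sides\<close> would supply a level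
  strictly between them on one side of which \<open>f\<close> eventually stays, which is absurd. The
  limit is the supremum of the eventual lower bounds.\<close>

lemma convergent_of_one_sided:
  fixes f :: "real \<Rightarrow> real"
  assumes lb: "eventually (\<lambda>t. a \<le> f t) F" and ub: "eventually (\<lambda>t. f t \<le> b) F" and "F \<noteq> bot"
    and sides: "\<And>p q. p < q \<Longrightarrow> \<exists>c. p < c \<and> c < q \<and>
      (eventually (\<lambda>t. c \<le> f t) F \<or> eventually (\<lambda>t. f t \<le> c) F)"
  shows "\<exists>l. (f \<longlongrightarrow> l) F"
proof -
  define A where "A = {c. eventually (\<lambda>t. c \<le> f t) F}"
  have "c \<le> b" if "c \<in> A" for c
  proof -
    have "eventually (\<lambda>t. c \<le> b) F"
      using that[unfolded A_def mem_Collect_eq] ub by eventually_elim auto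
    then show ?thesis using \<open>F \<noteq> bot\<close> by simp
  qed
  then have bdd: "bdd_above A" by (auto simp: bdd_above_def)
  have ne: "A \<noteq> {}" using lb by (auto simp: A_def)
  have "(f \<longlongrightarrow> Sup A) F"
  proof (rule order_tendstoI)
    fix y assume "y < Sup A"
    then obtain c where c: "c \<in> A" "y < c" using less_cSup_iff[OF ne bdd] by auto
    from c(1)[unfolded A_def mem_Collect_eq] show "eventually (\<lambda>t. y < f t) F"
      by eventually_elim (use c in auto)
  next
    fix y assume "Sup A < y"
    then obtain c where c: "Sup A < c" "c < y"
        "eventually (\<lambda>t. c \<le> f t) F \<or> eventually (\<lambda>t. f t \<le> c) F"
      using sides by blast
    then have "c \<notin> A" using cSup_upper[OF _ bdd, of c] by auto
    then have "eventually (\<lambda>t. f t \<le> c) F" using c(3) by (auto simp: A_def)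
    then show "eventually (\<lambda>t. f t < y) F" by eventually_elim (use c in auto)
  qed
  then show ?thesis by blast
qed

text \<open>In the time variable \<open>\<tau> = \<integral> dt/Q\<close> the equation is the logistic equation with a harvesting
  term that converges.\<close>

lemma logistic_convergent:
  fixes v F Q \<tau> :: "real \<Rightarrow> real"
  assumes Q: "eventually (\<lambda>t. 0 < Q t) (at_left T)"
    and v: "eventually (\<lambda>t. (v has_real_derivative (v t * (1 - v t) - F t) / Q t) (at t)) (at_left T)"
    and \<tau>: "eventually (\<lambda>t. (\<tau> has_real_derivative 1 / Q t) (at t)) (at_left T)"
    and \<tau>_lim: "filterlim \<tau> at_top (at_left T)"
    and F: "(F \<longlongrightarrow> L) (at_left T)"
    and lb: "eventually (\<lambda>t. a \<le> v t) (at_left T)" and ub: "eventually (\<lambda>t. v t \<le> b) (at_left T)"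
  shows "\<exists>l. (v \<longlongrightarrow> l) (at_left T) \<and> l * (1 - l) = L"
proof -
  have "\<exists>l. (v \<longlongrightarrow> l) (at_left T)"
  proof (rule convergent_of_one_sided[OF lb ub])
    fix p q :: real assume pq: "p < q"
    \<comment> \<open>A level \<open>c\<close> with \<open>c * (1 - c) \<noteq> L\<close> is crossed
      in one direction only, since \<open>v'\<close> has a fixed sign there near \<open>T\<close>.
      Every interval contains such levels, because the second difference of the quadratic is
      \<open>- 2 * (e * e)\<close> and not 0.\<close>
    have "\<exists>c. p < c \<and> c < q \<and> c * (1 - c) \<noteq> L"
    proof (rule ccontr)
      assume "\<nexists>c. p < c \<and> c < q \<and> c * (1 - c) \<noteq> L"
      then have *: "\<And>c. p < c \<Longrightarrow> c < q \<Longrightarrow> c * (1 - c) = L" by blast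
      define m e where "m = (p + q) / 2" and "e = (q - p) / 4"
      have "0 < e" "p < m - e" "m + e < q" using pq by (auto simp: m_def e_def field_simps)
      then have "m * (1 - m) = L" "(m + e) * (1 - (m + e)) = L" "(m - e) * (1 - (m - e)) = L"
        using *[of m] *[of "m + e"] *[of "m - e"] by auto
      moreover have "2 * (e * e) = 2 * (m * (1 - m)) - (m + e) * (1 - (m + e)) - (m - e) * (1 - (m - e))"
        by algebra
      ultimately have "2 * (e * e) = 0" by simp
      then show False using \<open>0 < e\<close> by simp
    qed
    then obtain c where c: "p < c" "c < q" "c * (1 - c) \<noteq> L" by blast
    have lim: "((\<lambda>t. c * (1 - c) - F t) \<longlongrightarrow> c * (1 - c) - L) (at_left T)"
      by (intro tendsto_intros F)
    show "\<exists>c. p < c \<and> c < q \<and> (eventually (\<lambda>t. c \<le> v t) (at_left T) \<or> eventually (\<lambda>t. v t \<le> c) (at_left T))"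
    proof (cases "0 < c * (1 - c) - L")
      case True
      have "eventually (\<lambda>t. v t = c \<longrightarrow> 0 < (v t * (1 - v t) - F t) / Q t) (at_left T)"
        using order_tendstoD(1)[OF lim True] Q by eventually_elim auto
      then show ?thesis using eventually_one_side[OF v] c by blast
    next
      case False
      then have "c * (1 - c) - L < 0" using c by simp
      from order_tendstoD(2)[OF lim this]
      have "eventually (\<lambda>t. v t = c \<longrightarrow> (v t * (1 - v t) - F t) / Q t < 0) (at_left T)"
        using Q by eventually_elim (auto simp: divide_less_0_iff)
      then show ?thesis using eventually_one_side'[OF v] c by blast
    qed
  qed simp
  then obtain l where l: "(v \<longlongrightarrow> l) (at_left T)" by blast
  \<comment> \<open>\<open>d\<close> is the limiting velocity of \<open>v\<close> in the time
    \<tau>; were it nonzero, \<open>v\<close> would run off at least as fast as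
    \<open>d / 2 * \<tau>\<close>.\<close>
  define d where "d = l * (1 - l) - L"
  have lim: "((\<lambda>t. v t * (1 - v t) - F t) \<longlongrightarrow> d) (at_left T)"
    unfolding d_def by (intro tendsto_intros F l)
  have "d = 0"
  proof (rule ccontr)
    assume "d \<noteq> 0"
    then consider "0 < d" | "d < 0" by linarith
    then show False
    proof cases
      case 1
      then have half: "d / 2 < d" by simp
      have "filterlim v at_top (at_left T)"
      proof (rule filterlim_at_top_of_deriv_ge[OF v \<tau> _ _ \<tau>_lim])
        show "eventually (\<lambda>t. d / 2 * (1 / Q t) \<le> (v t * (1 - v t) - F t) / Q t) (at_left T)"
          using order_tendstoD(1)[OF lim, of "d / 2", OF half] Q
        proof eventually_elim
          case (elim t)
          then have "d / 2 / Q t \<le> (v t * (1 - v t) - F t) / Q t" by (intro divide_right_mono) auto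
          then show ?case by simp
        qed
      qed (use 1 in simp)
      then show False using not_tendsto_and_filterlim_at_infinity[OF _ l]
          filterlim_at_top_imp_at_infinity by auto
    next
      case 2
      then have half: "d < d / 2" by simp
      have "filterlim (\<lambda>t. - v t) at_top (at_left T)"
      proof (rule filterlim_at_top_of_deriv_ge[OF _ \<tau> _ _ \<tau>_lim])
        show "eventually (\<lambda>t. ((\<lambda>t. - v t) has_real_derivative - ((v t * (1 - v t) - F t) / Q t)) (at t)) (at_left T)"
          using v by eventually_elim (auto intro!: derivative_eq_intros)
        show "eventually (\<lambda>t. - d / 2 * (1 / Q t) \<le> - ((v t * (1 - v t) - F t) / Q t)) (at_left T)"
          using order_tendstoD(2)[OF lim, of "d / 2", OF half] Q
        proof eventually_elim
          case (elim t)
          then have "(v t * (1 - v t) - F t) / Q t \<le> d / 2 / Q t" by (intro divide_right_mono) auto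
          then show ?case by simp
        qed
      qed (use 2 in simp)
      then show False using not_tendsto_and_filterlim_at_infinity[OF _ tendsto_minus[OF l]]
          filterlim_at_top_imp_at_infinity by auto
    qed
  qed
  then show ?thesis using l by (auto simp: d_def)
qed

text \<open>Barbalat's lemma; the point is that \<open>f\<^sup>2 + (2 C / c) G\<close> is nonincreasing.\<close>

lemma barbalat:
  fixes f f' G G' \<tau> \<tau>' :: "real \<Rightarrow> real"
  assumes f: "eventually (\<lambda>t. (f has_real_derivative f' t) (at t)) (at_left T)"
    and G: "eventually (\<lambda>t. (G has_real_derivative G' t) (at t)) (at_left T)"
    and \<tau>: "eventually (\<lambda>t. (\<tau> has_real_derivative \<tau>' t) (at t)) (at_left T)"
    and f0: "eventually (\<lambda>t. 0 \<le> f t) (at_left T)" and f': "eventually (\<lambda>t. f' t \<le> C * \<tau>' t) (at_left T)"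
    and G': "eventually (\<lambda>t. G' t \<le> - (c * f t * \<tau>' t)) (at_left T)"
    and \<tau>': "eventually (\<lambda>t. 0 \<le> \<tau>' t) (at_left T)" and pos: "0 < c" "0 \<le> C"
    and lb: "eventually (\<lambda>t. b \<le> G t) (at_left T)"
    and \<tau>_lim: "filterlim \<tau> at_top (at_left T)"
  shows "(f \<longlongrightarrow> 0) (at_left T)" and "\<exists>l. (G \<longlongrightarrow> l) (at_left T)"
proof -
  have "eventually (\<lambda>t. ((\<lambda>t. - G t) has_real_derivative - G' t) (at t) \<and> 0 \<le> - G' t) (at_left T)"
    using G G' f0 \<tau>'
  proof eventually_elim
    case (elim t)
    then have "0 \<le> c * f t * \<tau>' t" using pos by simp
    then show ?case using elim by (auto intro!: derivative_eq_intros)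
  qed
  moreover have "eventually (\<lambda>t. - G t \<le> - b) (at_left T)" using lb by eventually_elim auto
  ultimately have "\<exists>g. ((\<lambda>t. - G t) \<longlongrightarrow> g) (at_left T)"
    by (rule nonneg_deriv_at_left(2))
  then obtain g where "((\<lambda>t. - G t) \<longlongrightarrow> g) (at_left T)" ..
  from tendsto_minus[OF this] have g: "(G \<longlongrightarrow> - g) (at_left T)" by simp
  then show "\<exists>l. (G \<longlongrightarrow> l) (at_left T)" by blast
  define K where "K = 2 * C / c"
  have K: "0 \<le> K" "K * c = 2 * C" using pos by (auto simp: K_def)
  have "eventually (\<lambda>t. ((\<lambda>t. - (f t)\<^sup>2 - K * G t) has_real_derivative - (2 * f t * f' t) - K * G' t) (at t)
     \<and> 0 \<le> - (2 * f t * f' t) - K * G' t) (at_left T)"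
    using f G f0 f' G'
  proof eventually_elim
    case (elim t)
    have "2 * f t * f' t \<le> 2 * f t * (C * \<tau>' t)" using elim by (intro mult_left_mono) auto
    also have "\<dots> = K * (c * f t * \<tau>' t)" using K by (metis mult.assoc mult.commute)
    also have "\<dots> \<le> K * (- G' t)" using elim K by (intro mult_left_mono) auto
    finally show ?case using elim by (auto intro!: derivative_eq_intros)
  qed
  moreover have "eventually (\<lambda>t. - (f t)\<^sup>2 - K * G t \<le> - K * b) (at_left T)"
    using lb
  proof eventually_elim
    case (elim t)
    then have "K * b \<le> K * G t" using K(1) by (rule mult_left_mono)
    then show ?case using zero_le_power2[of "f t"] by linarith
  qed
  ultimately have "\<exists>h. ((\<lambda>t. - (f t)\<^sup>2 - K * G t) \<longlongrightarrow> h) (at_left T)"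
    by (rule nonneg_deriv_at_left(2))
  then obtain h where "((\<lambda>t. - (f t)\<^sup>2 - K * G t) \<longlongrightarrow> h) (at_left T)" ..
  from tendsto_diff[OF tendsto_minus[OF this] tendsto_mult[OF tendsto_const[of K] g]]
  obtain m where "((\<lambda>t. (f t)\<^sup>2) \<longlongrightarrow> m) (at_left T)" by auto
  from tendsto_real_sqrt[OF this] have "((\<lambda>t. sqrt ((f t)\<^sup>2)) \<longlongrightarrow> sqrt m) (at_left T)" .
  then have lim: "(f \<longlongrightarrow> sqrt m) (at_left T)"
    by (rule Lim_transform_eventually) (use f0 in eventually_elim, auto)
  have "0 \<le> sqrt m" by (rule tendsto_lowerbound[OF lim f0]) simp
  \<comment> \<open>A positive limit of \<open>f\<close> would make \<open>G\<close> decrease at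
    least linearly in \<tau>, although \<open>G\<close> converges.\<close>
  moreover have "\<not> 0 < sqrt m"
  proof
    assume m: "0 < sqrt m"
    define e where "e = sqrt m / 2"
    have e: "0 < e" "e < sqrt m" using m by (auto simp: e_def)
    have "filterlim (\<lambda>t. - G t) at_top (at_left T)"
    proof (rule filterlim_at_top_of_deriv_ge[OF _ \<tau> _ _ \<tau>_lim])
      show "eventually (\<lambda>t. ((\<lambda>t. - G t) has_real_derivative - G' t) (at t)) (at_left T)"
        using G by eventually_elim (auto intro!: derivative_eq_intros)
      show "eventually (\<lambda>t. c * e * \<tau>' t \<le> - G' t) (at_left T)"
        using order_tendstoD(1)[OF lim e(2)] G' \<tau>'
      proof eventually_elim
        case (elim t)
        then have "c * e * \<tau>' t \<le> c * f t * \<tau>' t" using pos by (intro mult_right_mono mult_left_mono) auto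
        then show ?case using elim by simp
      qed
      show "0 < c * e" using pos e by simp
    qed
    then show False using not_tendsto_and_filterlim_at_infinity[OF _ tendsto_minus[OF g]]
        filterlim_at_top_imp_at_infinity by auto
  qed
  ultimately show "(f \<longlongrightarrow> 0) (at_left T)" using lim by (simp add: order_less_le)
qed

text \<open>Comparison with \<open>\<lambda>' = - \<lambda>\<^sup>2 - \<omega>\<^sup>2\<close>,
  along whose solutions the function \<theta> below is constant. Here \<theta> is nondecreasing and
  bounded, so \<open>arctan (l / \<omega>)\<close> has a limit \<open>A\<close>; the alternatives
  are \<open>A > - pi / 2\<close> and \<open>A = - pi / 2\<close>.\<close>

lemma riccati_dichotomy:
  fixes l l' U :: "real \<Rightarrow> real"
  assumes \<omega>: "0 < \<omega>" and "t0 < T"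
    and l: "\<And>t. t0 < t \<Longrightarrow> t < T \<Longrightarrow> (l has_real_derivative l' t) (at t)"
    and ge: "\<And>t. t0 < t \<Longrightarrow> t < T \<Longrightarrow> - (l t)\<^sup>2 - \<omega>\<^sup>2 \<le> l' t"
    and U: "\<And>t. t0 < t \<Longrightarrow> t < T \<Longrightarrow> (U has_real_derivative l t * U t) (at t)"
    and U_pos: "\<And>t. t0 < t \<Longrightarrow> t < T \<Longrightarrow> 0 < U t"
  shows "(\<exists>M. eventually (\<lambda>t. - M \<le> l t) (at_left T)) \<or>
    (filterlim l at_bot (at_left T) \<and> (U \<longlongrightarrow> 0) (at_left T) \<and>
     (\<forall>t. t0 < t \<longrightarrow> t < T \<longrightarrow> arctan (l t / \<omega>) + \<omega> * t \<le> - pi / 2 + \<omega> * T))"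
proof -
  have near: "eventually (\<lambda>t. t0 < t \<and> t < T) (at_left T)"
    using \<open>t0 < T\<close> by (auto simp: eventually_at_left_field)
  define \<theta> where "\<theta> t = arctan (l t / \<omega>) + \<omega> * t" for t
  define \<theta>' where "\<theta>' t = l' t / \<omega> / (1 + (l t / \<omega>)\<^sup>2) + \<omega>" for t
  have \<theta>: "(\<theta> has_real_derivative \<theta>' t) (at t)" if "t0 < t" "t < T" for t
    unfolding \<theta>_def[abs_def] \<theta>'_def
    by (rule derivative_eq_intros l[OF that] refl | use \<omega> in \<open>simp add: divide_inverse\<close>)+
  have \<theta>'_nonneg: "0 \<le> \<theta>' t" if "t0 < t" "t < T" for t
  proof -
    have "\<theta>' t = (l' t + (l t)\<^sup>2 + \<omega>\<^sup>2) * \<omega> / (\<omega>\<^sup>2 + (l t)\<^sup>2)"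
      using \<omega> unfolding \<theta>'_def
      by (simp add: divide_simps power2_eq_square) (simp add: algebra_simps add_pos_nonneg add_nonneg_eq_0_iff)
    moreover have "0 \<le> (l' t + (l t)\<^sup>2 + \<omega>\<^sup>2) * \<omega> / (\<omega>\<^sup>2 + (l t)\<^sup>2)"
      using ge[OF that] \<omega> by (intro divide_nonneg_nonneg mult_nonneg_nonneg) auto
    ultimately show ?thesis by simp
  qed
  have \<theta>_mono: "\<theta> x \<le> \<theta> y" if "t0 < x" "x \<le> y" "y < T" for x y
    by (rule DERIV_nonneg_imp_nondecreasing[OF that(2)])
      (use \<theta> \<theta>'_nonneg that in \<open>meson less_le_trans le_less_trans\<close>)
  have "\<exists>A. (\<theta> \<longlongrightarrow> A) (at_left T)"
  proof (rule nonneg_deriv_at_left(2))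
    show "eventually (\<lambda>t. (\<theta> has_real_derivative \<theta>' t) (at t) \<and> 0 \<le> \<theta>' t) (at_left T)"
      using near by eventually_elim (use \<theta> \<theta>'_nonneg in auto)
    show "eventually (\<lambda>t. \<theta> t \<le> pi / 2 + \<omega> * T) (at_left T)"
      using near
    proof eventually_elim
      case (elim t)
      have "\<omega> * t \<le> \<omega> * T" using elim \<omega> by simp
      then show ?case using arctan_ubound[of "l t / \<omega>"] by (simp add: \<theta>_def)
    qed
  qed
  then obtain A' where A': "(\<theta> \<longlongrightarrow> A') (at_left T)" ..
  have \<theta>_le: "\<theta> x \<le> A'" if "t0 < x" "x < T" for x
  proof (rule tendsto_lowerbound[OF A'])
    show "eventually (\<lambda>t. \<theta> x \<le> \<theta> t) (at_left T)"
      using \<theta>_mono that by (auto simp: eventually_at_left_field intro!: exI[of _ x])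
  qed simp
  define A where "A = A' - \<omega> * T"
  have "((\<lambda>t. \<theta> t - \<omega> * t) \<longlongrightarrow> A) (at_left T)"
    unfolding A_def by (intro tendsto_intros A')
  then have lim: "((\<lambda>t. arctan (l t / \<omega>)) \<longlongrightarrow> A) (at_left T)" by (simp add: \<theta>_def)
  have A_bounds: "- pi / 2 \<le> A" "A \<le> pi / 2"
  proof -
    show "- pi / 2 \<le> A"
      by (rule tendsto_lowerbound[OF lim]) (use arctan_lbound less_imp_le in \<open>auto intro!: always_eventually\<close>)
    show "A \<le> pi / 2"
      by (rule tendsto_upperbound[OF lim]) (use arctan_ubound less_imp_le in \<open>auto intro!: always_eventually\<close>)
  qed
  show ?thesis
  proof (cases "A = - pi / 2")
    case False
    \<comment> \<open>The midpoint of \<open>- pi / 2\<close> and \<open>A\<close>, whose tangent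
      gives a finite lower bound for \<open>l / \<omega>\<close>.\<close>
    define a where "a = (A - pi / 2) / 2"
    have a: "- pi / 2 < a" "a < A" "a \<le> 0" using A_bounds False by (auto simp: a_def)
    have "eventually (\<lambda>t. - (- \<omega> * tan a) \<le> l t) (at_left T)"
      using order_tendstoD(1)[OF lim a(2)]
    proof eventually_elim
      case (elim t)
      have "tan a < tan (arctan (l t / \<omega>))"
        by (rule tan_monotone) (use elim a arctan_ubound in auto)
      then show ?case using \<omega> by (simp add: tan_arctan field_simps)
    qed
    then show ?thesis by blast
  next
    case True
    have bound: "arctan (l t / \<omega>) + \<omega> * t \<le> - pi / 2 + \<omega> * T" if "t0 < t" "t < T" for t
      using \<theta>_le[OF that] True by (simp add: \<theta>_def A_def)
    have "filterlim l at_bot (at_left T)"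
      unfolding filterlim_at_bot
    proof
      fix Z
      have "A < arctan (Z / \<omega>)" using True arctan_lbound[of "Z / \<omega>"] by simp
      from order_tendstoD(2)[OF lim this] show "eventually (\<lambda>t. l t \<le> Z) (at_left T)"
        by eventually_elim (use \<omega> in \<open>simp add: arctan_less_iff divide_less_cancel\<close>)
    qed
    moreover have "(U \<longlongrightarrow> 0) (at_left T)"
    proof -
      \<comment> \<open>\<open>S\<close> vanishes at \<open>T\<close> and has the logarithmic
        derivative \<open>- \<omega> * cot (\<omega> * (T - t))\<close>, the comparison solution
        that blows up at \<open>T\<close>. The bound on the arctangent puts \<open>l\<close> below
        it, so \<open>U / S\<close> is nonincreasing and \<open>U\<close> is at most a multiple of
        \<open>S\<close>.\<close>
      define S where "S t = sin (\<omega> * (T - t))" for t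
      have near2: "eventually (\<lambda>t. T - pi / (2 * \<omega>) < t) (at_left T)"
        using \<omega> by (auto simp: eventually_at_left_field intro!: exI[of _ "T - pi / (2 * \<omega>)"])
      have S_pos: "eventually (\<lambda>t. 0 < S t) (at_left T)"
        using near near2
      proof eventually_elim
        case (elim t)
        then have "0 < \<omega> * (T - t)" "\<omega> * (T - t) < pi / 2" using \<omega> by (auto simp: field_simps)
        then show ?case unfolding S_def by (intro sin_gt_zero) auto
      qed
      have "eventually (\<lambda>t. ((\<lambda>t. - (U t / S t)) has_real_derivative
          - (l t * S t + \<omega> * cos (\<omega> * (T - t))) * U t / (S t)\<^sup>2) (at t) \<and>
          0 \<le> - (l t * S t + \<omega> * cos (\<omega> * (T - t))) * U t / (S t)\<^sup>2) (at_left T)"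
        using near near2 S_pos
      proof eventually_elim
        case (elim t)
        define p where "p = \<omega> * (T - t)"
        have p: "0 < p" "p < pi / 2" using elim \<omega> by (auto simp: field_simps p_def)
        have "arctan (l t / \<omega>) \<le> p - pi / 2" using bound[of t] elim by (simp add: p_def algebra_simps)
        then have "tan (arctan (l t / \<omega>)) \<le> tan (p - pi / 2)"
          using arctan_lbound[of "l t / \<omega>"] p by (subst tan_mono_le_eq) auto
        moreover have "tan (p - pi / 2) = - cos p / sin p" by (simp add: tan_def sin_diff cos_diff)
        ultimately have "l t / \<omega> \<le> - cos p / sin p" by (simp only: tan_arctan)
        moreover have "0 < sin p" using p by (intro sin_gt_zero) auto
        ultimately have "l t * S t + \<omega> * cos p \<le> 0"
          using \<omega> unfolding S_def p_def[symmetric] by (simp add: field_simps)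
        moreover have "(U has_real_derivative l t * U t) (at t)" "0 < U t" using elim U U_pos by auto
        moreover have "(S has_real_derivative - \<omega> * cos p) (at t)"
          unfolding S_def[abs_def] p_def by (auto intro!: derivative_eq_intros)
        moreover have "0 \<le> - (l t * S t + \<omega> * cos p) * U t / (S t)\<^sup>2"
          using calculation by (intro divide_nonneg_nonneg mult_nonneg_nonneg) auto
        moreover have "((\<lambda>t. - (U t / S t)) has_real_derivative - (l t * S t + \<omega> * cos p) * U t / (S t)\<^sup>2) (at t)"
          using calculation elim
          by (auto intro!: derivative_eq_intros simp: power2_eq_square algebra_simps divide_simps)
        ultimately show ?case unfolding p_def[symmetric] by blast
      qed
      from nonneg_deriv_at_left(1)[OF this]
      obtain c where c: "eventually (\<lambda>t. c \<le> - (U t / S t)) (at_left T)" by blast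
      have "eventually (\<lambda>t. U t \<le> - c * S t) (at_left T)"
        using c S_pos by eventually_elim (simp add: field_simps)
      moreover have "((\<lambda>t. - c * S t) \<longlongrightarrow> - c * sin (\<omega> * (T - T))) (at_left T)"
        unfolding S_def by (intro tendsto_intros)
      moreover have "eventually (\<lambda>t. 0 \<le> U t) (at_left T)"
        using near by eventually_elim (use U_pos in \<open>auto intro: less_imp_le\<close>)
      ultimately show ?thesis by (intro tendsto_sandwich[of "\<lambda>_. 0" U _ "\<lambda>t. - c * S t"]) auto
    qed
    ultimately show ?thesis using bound by blast
  qed
qed

subsection \<open>The profile at blow-up\<close>

text \<open>Here \<open>l\<close> is \<open>\<lambda>\<^sub>1\<close> and \<open>b i\<close> is \<open>1 / (\<lambda>\<^sub>i(0) - \<lambda>\<^sub>1(0))\<close>, so that \<open>\<lambda>\<^sub>i = l + 1 / (U\<^sup>2 (s + b i))\<close> for \<open>i > J\<close>.\<close>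

locale REP_profile =
  fixes T \<omega> \<kappa> :: real and n J :: nat and b :: "nat \<Rightarrow> real" and l U s \<rho> :: "real \<Rightarrow> real"
  assumes T: "0 < T" and \<omega>: "0 < \<omega>" and \<kappa>: "0 < \<kappa>" and n: "2 \<le> n" and J: "1 \<le> J" "J \<le> n"
    and b: "\<And>i. i \<in> {J<..n} \<Longrightarrow> 0 < b i"
    and D_l: "\<And>t. 0 < t \<Longrightarrow> t < T \<Longrightarrow> (l has_real_derivative - (l t)\<^sup>2 + (\<kappa> * \<rho> t - \<omega>\<^sup>2)) (at t)"
    and D_U: "\<And>t. 0 < t \<Longrightarrow> t < T \<Longrightarrow> (U has_real_derivative l t * U t) (at t)"
    and D_s: "\<And>t. 0 < t \<Longrightarrow> t < T \<Longrightarrow> (s has_real_derivative 1 / (U t)\<^sup>2) (at t)"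
    and D_\<rho>: "\<And>t. 0 < t \<Longrightarrow> t < T \<Longrightarrow> (\<rho> has_real_derivative
        - \<rho> t * (n * l t + (\<Sum>i\<in>{J<..n}. 1 / ((U t)\<^sup>2 * (s t + b i))))) (at t)"
    and U: "\<And>t. 0 < t \<Longrightarrow> t < T \<Longrightarrow> 0 < U t"
    and s: "\<And>t. 0 < t \<Longrightarrow> t < T \<Longrightarrow> 0 < s t"
    and \<rho>: "\<And>t. 0 < t \<Longrightarrow> t < T \<Longrightarrow> 0 < \<rho> t"
    and l_lim: "filterlim l at_bot (at_left T)" and U_lim: "(U \<longlongrightarrow> 0) (at_left T)"
begin

abbreviation ev :: "(real \<Rightarrow> bool) \<Rightarrow> bool" where "ev P \<equiv> eventually P (at_left T)"

section \<open>The quantities of the profile and their derivatives\<close>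

text \<open>\<open>w\<close> is the second solution of \<open>U'' = h U\<close> and \<mu> its
  logarithmic derivative; \<open>v\<close> is \<open>- l\<close> measured in the time unit
  \<open>Q\<close>. The error of replacing \<open>s + b i\<close> by \<open>s\<close> is collected
  in \<epsilon>, and \<beta> would be constant if that error were absent.\<close>

definition "Q t = (U t)\<^sup>2 * s t"
definition "w t = U t * s t"
definition "v t = - l t * Q t"
definition "h t = \<kappa> * \<rho> t - \<omega>\<^sup>2"
definition "\<mu> t = (1 - v t) / Q t"
definition "\<epsilon> t = (\<Sum>i\<in>{J<..n}. b i / (s t + b i))"
definition "\<Phi> t = \<kappa> * \<rho> t * (Q t)\<^sup>2"
definition "\<beta> t = \<rho> t * U t ^ n * s t ^ (n - J)"

lemma near: "ev (\<lambda>t. 0 < t \<and> t < T)"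
  using T by (auto simp: eventually_at_left_field)

context
  fixes t assumes t: "0 < t" "t < T"
begin

lemma Q_pos: "0 < Q t" using U[OF t] s[OF t] by (simp add: Q_def)
lemma w_pos: "0 < w t" using U[OF t] s[OF t] by (simp add: w_def)
lemma \<Phi>_pos: "0 < \<Phi> t" using \<kappa> \<rho>[OF t] Q_pos by (simp add: \<Phi>_def)
lemma \<beta>_pos: "0 < \<beta> t" using \<rho>[OF t] U[OF t] s[OF t] by (simp add: \<beta>_def)

lemma w_sq: "(w t)\<^sup>2 = Q t * s t" by (simp add: w_def Q_def power2_eq_square)

lemma hQ: "h t * (Q t)\<^sup>2 = \<Phi> t - \<omega>\<^sup>2 * (Q t)\<^sup>2"
  by (simp add: h_def \<Phi>_def algebra_simps)

lemma \<epsilon>_nonneg: "0 \<le> \<epsilon> t"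
  unfolding \<epsilon>_def using b s[OF t] by (intro sum_nonneg) (simp add: less_imp_le add_pos_pos)

lemma \<epsilon>_le: "\<epsilon> t \<le> (\<Sum>i\<in>{J<..n}. b i) / s t"
  unfolding \<epsilon>_def sum_divide_distrib using b s[OF t]
  by (intro sum_mono divide_left_mono) (auto simp: less_imp_le add_pos_pos intro!: mult_pos_pos)

lemma D_Q: "(Q has_real_derivative 1 - 2 * v t) (at t)"
  unfolding Q_def[abs_def] v_def using U[OF t]
  by (auto intro!: derivative_eq_intros D_U[OF t] D_s[OF t] simp: Q_def power2_eq_square field_simps)

lemma D_v: "(v has_real_derivative (v t * (1 - v t) - h t * (Q t)\<^sup>2) / Q t) (at t)"
  unfolding v_def[abs_def] using Q_pos
  by (auto intro!: derivative_eq_intros D_l[OF t] D_Q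
      simp: v_def h_def field_simps power2_eq_square)

lemma D_w: "(w has_real_derivative (1 - v t) / U t) (at t)"
  unfolding w_def[abs_def] v_def using U[OF t]
  by (auto intro!: derivative_eq_intros D_U[OF t] D_s[OF t] simp: Q_def power2_eq_square field_simps)

lemma D_w': "(w has_real_derivative \<mu> t * w t) (at t)"
proof -
  have "(1 - v t) / U t = \<mu> t * w t"
    using U[OF t] s[OF t] by (simp add: \<mu>_def Q_def w_def power2_eq_square field_simps)
  then show ?thesis using D_w by simp
qed

lemma D_ln_w: "((\<lambda>t. ln (w t)) has_real_derivative \<mu> t) (at t)"
  using w_pos by (auto intro!: derivative_eq_intros D_w')

lemma D_ln_s: "((\<lambda>t. ln (s t)) has_real_derivative 1 / Q t) (at t)"
  using s[OF t] by (auto intro!: derivative_eq_intros D_s[OF t] simp: Q_def)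

lemma D_inv_s: "((\<lambda>t. 1 / s t) has_real_derivative - 1 / (Q t * s t)) (at t)"
  using s[OF t] U[OF t]
  by (auto intro!: derivative_eq_intros D_s[OF t] simp: Q_def field_simps power2_eq_square)

text \<open>Both \<open>l\<close> and \<mu> are logarithmic derivatives of solutions of
  \<open>y'' = h y\<close>, so they share one Riccati equation.\<close>

lemma D_\<mu>: "(\<mu> has_real_derivative - (\<mu> t)\<^sup>2 + h t) (at t)"
  unfolding \<mu>_def[abs_def] using Q_pos
  by (auto intro!: derivative_eq_intros D_v D_Q simp: \<mu>_def) (simp add: field_simps power2_eq_square)

text \<open>As \<open>\<mu> * w\<close> is \<open>w'\<close>, this is the linear equation
  \<open>w'' = h w\<close>.\<close>

lemma D_\<mu>w: "((\<lambda>t. \<mu> t * w t) has_real_derivative h t * w t) (at t)"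
  by (auto intro!: derivative_eq_intros D_\<mu> D_w') (simp add: algebra_simps power2_eq_square)

text \<open>Each summand with \<open>i > J\<close> equals \<open>(1 - b i / (s + b i)) / Q\<close>,
  so the sum is \<open>(n - J - \<epsilon>) / Q\<close>; moreover
  \<open>l = - v / Q\<close>.\<close>

lemma D_\<rho>': "(\<rho> has_real_derivative \<rho> t * (n * v t - (real n - real J) + \<epsilon> t) / Q t) (at t)"
proof -
  have "Q t * (1 / ((U t)\<^sup>2 * (s t + b i))) = 1 - b i / (s t + b i)" if "i \<in> {J<..n}" for i
  proof -
    have "Q t * (1 / ((U t)\<^sup>2 * (s t + b i))) = s t / (s t + b i)" using U[OF t] by (simp add: Q_def)
    also have "\<dots> = 1 - b i / (s t + b i)" using b[OF that] s[OF t] by (simp add: field_simps)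
    finally show ?thesis .
  qed
  then have "Q t * (\<Sum>i\<in>{J<..n}. 1 / ((U t)\<^sup>2 * (s t + b i))) = (\<Sum>i\<in>{J<..n}. 1 - b i / (s t + b i))"
    unfolding sum_distrib_left by (intro sum.cong) auto
  also have "\<dots> = (real n - real J) - \<epsilon> t"
    using J by (simp add: \<epsilon>_def sum_subtractf)
  finally have *: "(\<Sum>i\<in>{J<..n}. 1 / ((U t)\<^sup>2 * (s t + b i))) = ((real n - real J) - \<epsilon> t) / Q t"
    using Q_pos by (simp add: field_simps)
  have "- \<rho> t * (n * l t + (\<Sum>i\<in>{J<..n}. 1 / ((U t)\<^sup>2 * (s t + b i))))
      = \<rho> t * (n * v t - (real n - real J) + \<epsilon> t) / Q t"
    unfolding * using Q_pos by (simp add: v_def field_simps)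
  then show ?thesis using D_\<rho>[OF t] by simp
qed

text \<open>In the logarithmic derivative, \<rho> contributes
  \<open>n * v - (n - J) + \<epsilon>\<close> and \<open>Q\<^sup>2\<close> contributes twice
  \<open>1 - 2 * v\<close>, all over \<open>Q\<close>.\<close>

lemma D_\<Phi>: "(\<Phi> has_real_derivative \<Phi> t * ((real n - 4) * v t + 2 - (real n - real J) + \<epsilon> t) / Q t) (at t)"
  unfolding \<Phi>_def[abs_def] using Q_pos
  by (auto intro!: derivative_eq_intros D_\<rho>' D_Q simp: field_simps power2_eq_square)

text \<open>The powers of \<open>U\<close> and \<open>s\<close> in \<beta> cancel all of
  \<open>\<rho>' / \<rho>\<close> except the error term.\<close>

lemma D_ln_\<beta>: "((\<lambda>t. ln (\<beta> t)) has_real_derivative \<epsilon> t / Q t) (at t)"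
proof -
  have l: "l t = - v t / Q t" using Q_pos by (simp add: v_def)
  have *: "((\<lambda>t. ln (\<rho> t) + n * ln (U t) + real (n - J) * ln (s t)) has_real_derivative \<epsilon> t / Q t) (at t)"
  proof -
    have "((\<lambda>t. ln (\<rho> t)) has_real_derivative (n * v t - (real n - real J) + \<epsilon> t) / Q t) (at t)"
      using \<rho>[OF t] by (auto intro!: derivative_eq_intros D_\<rho>')
    moreover have "((\<lambda>t. ln (U t)) has_real_derivative - v t / Q t) (at t)"
      using U[OF t] by (auto intro!: derivative_eq_intros D_U[OF t] simp: l)
    ultimately have "((\<lambda>t. ln (\<rho> t) + n * ln (U t) + real (n - J) * ln (s t)) has_real_derivative
        (n * v t - (real n - real J) + \<epsilon> t) / Q t + n * (- v t / Q t) + real (n - J) * (1 / Q t)) (at t)"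
      by (intro DERIV_add DERIV_cmult D_ln_s)
    moreover have "(n * v t - (real n - real J) + \<epsilon> t) / Q t + n * (- v t / Q t) + real (n - J) * (1 / Q t) = \<epsilon> t / Q t"
      using Q_pos J by (simp add: of_nat_diff field_simps)
    ultimately show ?thesis by simp
  qed
  have near: "eventually (\<lambda>x. 0 < x \<and> x < T) (nhds t)"
    using eventually_nhds_in_open[of "{0<..<T}" t] t by simp
  have "eventually (\<lambda>x. ln (\<beta> x) = ln (\<rho> x) + n * ln (U x) + real (n - J) * ln (s x)) (nhds t)"
    using near
  proof eventually_elim
    case (elim x)
    then show ?case
      using \<rho>[of x] U[of x] s[of x] by (simp add: \<beta>_def ln_mult ln_realpow)
  qed
  then show ?thesis using * by (subst DERIV_cong_ev[OF refl _ refl])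
qed

lemma \<rho>_eq: "\<rho> t = \<beta> t / (U t ^ J * w t ^ (n - J))"
  using U[OF t] s[OF t] J
  by (simp add: \<beta>_def w_def power_mult_distrib power_add[symmetric] field_simps)

text \<open>In effect \<open>\<Phi> = \<kappa> * \<beta> * s^(J - 2) * w^(4 - n)\<close>, multiplied
  out because either exponent may be negative. As \<beta> converges, this formula governs the later
  case distinction on \<open>J\<close> and \<open>n\<close>.\<close>

lemma \<Phi>_eq: "\<Phi> t * w t ^ n * (s t)\<^sup>2 = \<kappa> * \<beta> t * s t ^ J * w t ^ 4"
proof -
  have "\<Phi> t * w t ^ n * (s t)\<^sup>2 = \<kappa> * \<rho> t * U t ^ n * (s t ^ (n - J) * s t ^ J) * (Q t)\<^sup>2 * (s t)\<^sup>2"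
    using J by (simp add: \<Phi>_def w_def power_mult_distrib power_add[symmetric])
  also have "\<dots> = \<kappa> * \<beta> t * s t ^ J * w t ^ 4"
    by (simp add: \<beta>_def Q_def w_def power_mult_distrib)
  finally show ?thesis .
qed

end

lemma ev_at: "(\<And>t. 0 < t \<Longrightarrow> t < T \<Longrightarrow> P t) \<Longrightarrow> ev P"
  using near by eventually_elim blast

section \<open>Size of \<open>w\<close>, \<open>s\<close>, \<open>Q\<close>, \<open>v\<close> and
  \<beta> near \<open>T\<close>\<close>

text \<open>From \<open>U'' = h U \<ge> - \<omega>\<^sup>2 U\<close> and \<open>U < 1\<close> near
  \<open>T\<close>, the function \<open>U' + \<omega>\<^sup>2 t\<close> with \<open>U' = l U\<close>
  is nondecreasing.\<close>

lemma lU_bounded: obtains C where "0 < C" "ev (\<lambda>t. - C \<le> l t * U t)"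
proof -
  have "ev (\<lambda>t. U t < 1)" using order_tendstoD(2)[OF U_lim] by simp
  then have "ev (\<lambda>t. ((\<lambda>t. l t * U t + \<omega>\<^sup>2 * t) has_real_derivative \<kappa> * \<rho> t * U t + \<omega>\<^sup>2 * (1 - U t)) (at t)
      \<and> 0 \<le> \<kappa> * \<rho> t * U t + \<omega>\<^sup>2 * (1 - U t))"
    using near
  proof eventually_elim
    case (elim t)
    then have "0 \<le> \<kappa> * \<rho> t * U t + \<omega>\<^sup>2 * (1 - U t)"
      using \<kappa> \<rho>[of t] U[of t] by (simp add: less_imp_le)
    moreover have "((\<lambda>t. l t * U t + \<omega>\<^sup>2 * t) has_real_derivative \<kappa> * \<rho> t * U t + \<omega>\<^sup>2 * (1 - U t)) (at t)"
      using elim by (auto intro!: derivative_eq_intros D_l D_U) (simp add: algebra_simps power2_eq_square)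
    ultimately show ?case by blast
  qed
  from nonneg_deriv_at_left(1)[OF this]
  obtain c where "ev (\<lambda>t. c \<le> l t * U t + \<omega>\<^sup>2 * t)" by blast
  then have "ev (\<lambda>t. - (\<bar>c\<bar> + \<omega>\<^sup>2 * T + 1) \<le> l t * U t)" using near
  proof eventually_elim
    case (elim t)
    then have "\<omega>\<^sup>2 * t \<le> \<omega>\<^sup>2 * T" by (intro mult_left_mono) auto
    then show ?case using elim by linarith
  qed
  moreover have "0 < \<bar>c\<bar> + \<omega>\<^sup>2 * T + 1" using T by (simp add: add_nonneg_pos)
  ultimately show thesis using that by blast
qed

text \<open>The Wronskian identity \<open>U w' = 1 + U' w\<close> makes \<open>w\<close> increase wherever it is small.\<close>

lemma w_bounded_below: obtains c where "0 < c" "ev (\<lambda>t. c \<le> w t)"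
proof -
  obtain C where C: "0 < C" "ev (\<lambda>t. - C \<le> l t * U t)" by (rule lU_bounded)
  \<comment> \<open>For \<open>w \<le> 1 / (2 * C)\<close> one has
    \<open>v = - (l * U) * w \<le> 1 / 2\<close>, so \<open>w' = (1 - v) / U\<close> is
    positive.\<close>
  define c where "c = 1 / (2 * C)"
  have small: "ev (\<lambda>t. w t \<le> c \<longrightarrow> 0 < (1 - v t) / U t)"
    using C(2) near
  proof eventually_elim
    case (elim t)
    show ?case
    proof
      assume "w t \<le> c"
      have "v t = - (l t * U t) * w t" by (simp add: v_def Q_def w_def power2_eq_square)
      also have "\<dots> \<le> C * w t" using elim w_pos[of t] by (intro mult_right_mono) auto
      also have "\<dots> \<le> C * c" using \<open>w t \<le> c\<close> C by simp
      finally show "0 < (1 - v t) / U t" using elim U[of t] C by (simp add: c_def)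
    qed
  qed
  then have "ev (\<lambda>t. w t = c \<longrightarrow> 0 < (1 - v t) / U t)" by eventually_elim simp
  with eventually_one_side[OF ev_at[OF D_w]] consider "ev (\<lambda>t. c \<le> w t)" | "ev (\<lambda>t. w t \<le> c)" by blast
  then show thesis
  proof cases
    case 1
    then show ?thesis using that[of c] C by (simp add: c_def)
  next
    case 2
    have "ev (\<lambda>t. ((\<lambda>t. ln (w t)) has_real_derivative \<mu> t) (at t) \<and> 0 \<le> \<mu> t)"
      using small 2 near
    proof eventually_elim
      case (elim t)
      then show ?case using D_ln_w[of t] U[of t] Q_pos[of t] by (auto simp: \<mu>_def zero_less_divide_iff)
    qed
    from nonneg_deriv_at_left(1)[OF this] obtain d where "ev (\<lambda>t. d \<le> ln (w t))" by blast
    then have "ev (\<lambda>t. exp d \<le> w t)"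
      using near by eventually_elim (use w_pos ln_ge_iff in auto)
    then show ?thesis using that[of "exp d"] by simp
  qed
qed

text \<open>Here \<open>s = w / U\<close> with \<open>w\<close> bounded below and \<open>U\<close>
  tending to 0. Consequently \<open>ln s\<close> is a time that runs to infinity.\<close>

lemma s_lim: "filterlim s at_top (at_left T)"
proof -
  obtain c where c: "0 < c" "ev (\<lambda>t. c \<le> w t)" by (rule w_bounded_below)
  have "filterlim U (at_right 0) (at_left T)"
    using U_lim ev_at[of "\<lambda>t. 0 < U t"] U by (auto simp: filterlim_at elim: eventually_mono)
  then have "filterlim (\<lambda>t. inverse (U t)) at_top (at_left T)"
    by (rule filterlim_compose[OF filterlim_inverse_at_top_right])
  then have "filterlim (\<lambda>t. c * inverse (U t)) at_top (at_left T)"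
    by (rule filterlim_tendsto_pos_mult_at_top[OF tendsto_const c(1)])
  then show ?thesis
    by (rule filterlim_at_top_mono) (use c(2) near in eventually_elim, use U in \<open>auto simp: w_def field_simps\<close>)
qed

lemma ln_s_lim: "filterlim (\<lambda>t. ln (s t)) at_top (at_left T)"
  by (rule filterlim_compose[OF ln_at_top s_lim])

lemma inv_s_lim: "((\<lambda>t. 1 / s t) \<longlongrightarrow> 0) (at_left T)"
  using tendsto_divide_0[OF tendsto_const filterlim_at_top_imp_at_infinity[OF s_lim]] .

text \<open>The pair \<mu>, \<open>w\<close> satisfies the hypotheses of
  \<open>riccati_dichotomy\<close> just as \<open>l\<close>, \<open>U\<close> do, but the blow-up
  alternative would make \<open>w\<close> tend to 0.\<close>

lemma \<mu>_bounded_below: obtains M where "0 \<le> M" "ev (\<lambda>t. - M \<le> \<mu> t)"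
proof -
  obtain c where c: "0 < c" "ev (\<lambda>t. c \<le> w t)" by (rule w_bounded_below)
  have "(\<exists>M. ev (\<lambda>t. - M \<le> \<mu> t)) \<or> (filterlim \<mu> at_bot (at_left T) \<and> (w \<longlongrightarrow> 0) (at_left T) \<and>
     (\<forall>t. 0 < t \<longrightarrow> t < T \<longrightarrow> arctan (\<mu> t / \<omega>) + \<omega> * t \<le> - pi / 2 + \<omega> * T))"
    by (rule riccati_dichotomy[OF \<omega> T D_\<mu> _ D_w' w_pos]) (use \<kappa> \<rho> in \<open>auto simp: h_def less_imp_le\<close>)
  moreover have "\<not> (w \<longlongrightarrow> 0) (at_left T)"
    using tendsto_lowerbound[OF _ c(2)] c(1) by force
  ultimately obtain M where M: "ev (\<lambda>t. - M \<le> \<mu> t)" by blast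
  have "ev (\<lambda>t. - \<bar>M\<bar> \<le> \<mu> t)" using M by eventually_elim simp
  then show thesis using that[of "\<bar>M\<bar>"] by simp
qed

text \<open>As \<open>w\<close> is almost nondecreasing and \<open>(1/s)' = - 1/w\<^sup>2\<close> with \<open>1/s \<longlongrightarrow> 0\<close>, one gets \<open>Q = w\<^sup>2/s = O(T - t)\<close>.\<close>

lemma Q_lim: "(Q \<longlongrightarrow> 0) (at_left T)"
proof -
  obtain M where M: "0 \<le> M" "ev (\<lambda>t. - M \<le> \<mu> t)" by (rule \<mu>_bounded_below)
  obtain t0 where t0: "t0 < T" "\<And>t. t0 < t \<Longrightarrow> t < T \<Longrightarrow> 0 < t" "\<And>t. t0 < t \<Longrightarrow> t < T \<Longrightarrow> - M \<le> \<mu> t"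
    using eventually_conj[OF M(2) near] by (auto simp: eventually_at_left_field)
  \<comment> \<open>\<open>ln w + M * t\<close> is nondecreasing; \<open>K\<close> absorbs, for the
    square of \<open>w\<close>, the possible loss over a time span of at most
    \<open>T\<close>.\<close>
  define K where "K = exp (2 * M * T)"
  have w_growth: "(w t)\<^sup>2 \<le> K * (w x)\<^sup>2" if tx: "t0 < t" "t \<le> x" "x < T" for t x
  proof -
    have "ln (w t) + M * t \<le> ln (w x) + M * x"
    proof (rule DERIV_nonneg_imp_nondecreasing[OF tx(2)])
      fix y assume "t \<le> y" "y \<le> x"
      then have y: "t0 < y" "y < T" using tx by auto
      show "\<exists>z. ((\<lambda>x. ln (w x) + M * x) has_real_derivative z) (at y) \<and> 0 \<le> z"
        by (rule exI[of _ "\<mu> y + M"])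
          (use DERIV_add[OF D_ln_w[OF t0(2)[OF y] y(2)] DERIV_cmult_Id[of M]] t0(3)[OF y] in auto)
    qed
    moreover have "M * x \<le> M * t + M * T"
      using M tx t0(2)[of t] by (simp add: distrib_left[symmetric] mult_left_mono)
    ultimately have "ln ((w t)\<^sup>2) \<le> ln (K * (w x)\<^sup>2)"
      using w_pos[OF t0(2), of t] w_pos[OF t0(2), of x] tx by (simp add: K_def ln_mult ln_realpow)
    then show ?thesis
      using w_pos[OF t0(2), of t] w_pos[OF t0(2), of x] tx by (subst (asm) ln_le_cancel_iff) (auto simp: K_def)
  qed
  have Q_le: "Q t \<le> K * (T - t)" if t: "t0 < t" "t < T" for t
  proof -
    have wt: "0 < w t" using w_pos[OF t0(2)[OF t] t(2)] .
    \<comment> \<open>From \<open>t\<close> on, \<open>a\<close> bounds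
      \<open>1 / w\<^sup>2 = - (1 / s)'\<close>. Thus \<open>1 / s x + a * x\<close> is
      nondecreasing in \<open>x\<close> with limit \<open>a * T\<close>, which gives
      \<open>1 / s t \<le> a * (T - t)\<close>.\<close>
    define a where "a = K / (w t)\<^sup>2"
    have "1 / s t + a * t \<le> 1 / s x + a * x" if x: "t \<le> x" "x < T" for x
    proof (rule DERIV_nonneg_imp_nondecreasing[OF x(1)])
      fix y assume "t \<le> y" "y \<le> x"
      then have y: "t0 < y" "y < T" "t \<le> y" using t x by auto
      have wy: "0 < w y" using w_pos[OF t0(2)[OF y(1,2)] y(2)] .
      have "1 / (w y)\<^sup>2 \<le> a"
        unfolding a_def using w_growth[OF t(1) y(3,2)] wt wy by (simp add: field_simps)
      then show "\<exists>z. ((\<lambda>x. 1 / s x + a * x) has_real_derivative z) (at y) \<and> 0 \<le> z"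
        using w_sq[OF t0(2)[OF y(1,2)] y(2)] DERIV_add[OF D_inv_s[OF t0(2)[OF y(1,2)] y(2)] DERIV_cmult_Id[of a]]
        by (intro exI[of _ "- 1 / (Q y * s y) + a"]) auto
    qed
    then have "ev (\<lambda>x. 1 / s t + a * t \<le> 1 / s x + a * x)"
      using t by (auto simp: eventually_at_left_field intro!: exI[of _ t])
    moreover have "((\<lambda>x. 1 / s x + a * x) \<longlongrightarrow> 0 + a * T) (at_left T)"
      by (intro tendsto_intros inv_s_lim)
    ultimately have "1 / s t + a * t \<le> 0 + a * T" by (intro tendsto_lowerbound) auto
    then have "1 / s t \<le> K * (T - t) / (w t)\<^sup>2" by (simp add: a_def algebra_simps diff_divide_distrib)
    then have "1 / s t * (w t)\<^sup>2 \<le> K * (T - t)" using wt by (simp add: pos_le_divide_eq)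
    then show ?thesis
      using s[OF t0(2)[OF t] t(2)] w_sq[OF t0(2)[OF t] t(2)] by simp
  qed
  have "((\<lambda>t. K * (T - t)) \<longlongrightarrow> K * (T - T)) (at_left T)" by (intro tendsto_intros)
  moreover have "ev (\<lambda>t. Q t \<le> K * (T - t))"
    using t0(1) Q_le by (auto simp: eventually_at_left_field)
  moreover have "ev (\<lambda>t. 0 \<le> Q t)" by (rule ev_at) (simp add: Q_pos less_imp_le)
  ultimately show ?thesis by (intro tendsto_sandwich[of "\<lambda>_. 0" Q _ "\<lambda>t. K * (T - t)"]) auto
qed

lemma v_pos: "ev (\<lambda>t. 0 < v t)"
proof -
  have "ev (\<lambda>t. l t < 0)" using l_lim unfolding filterlim_at_bot_dense by blast
  then show ?thesis using near
    by eventually_elim (use Q_pos in \<open>auto simp: v_def mult_neg_pos\<close>)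
qed

lemma Q_small: "0 < e \<Longrightarrow> ev (\<lambda>t. Q t < e)"
  using order_tendstoD(2)[OF Q_lim] by simp

text \<open>By definition \<open>v = 1 - \<mu> * Q\<close>, where \<mu> is bounded below and
  \<open>Q\<close> tends to 0.\<close>

lemma v_upper: assumes "1 < c" shows "ev (\<lambda>t. v t < c)"
proof -
  obtain M where M: "0 \<le> M" "ev (\<lambda>t. - M \<le> \<mu> t)" by (rule \<mu>_bounded_below)
  have "ev (\<lambda>t. Q t < (c - 1) / (M + 1))" using assms M by (intro Q_small) auto
  then show ?thesis using M(2) near
  proof eventually_elim
    case (elim t)
    have "- M * Q t \<le> \<mu> t * Q t" using elim Q_pos[of t] by (intro mult_right_mono) auto
    then have "v t \<le> 1 + M * Q t" using elim Q_pos[of t] by (simp add: \<mu>_def)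
    moreover have "M * Q t \<le> (M + 1) * Q t" using elim Q_pos[of t] by simp
    moreover have "(M + 1) * Q t < c - 1" using elim M by (simp add: field_simps)
    ultimately show ?case by linarith
  qed
qed

lemma v_le_2: "ev (\<lambda>t. v t \<le> 2)"
  using v_upper[of 2] by (auto elim: eventually_mono)

text \<open>A limit below 1/2 would make \<open>Q' = 1 - 2 * v\<close> positive near
  \<open>T\<close>, against \<open>Q\<close> tending to 0. In the theorem the two bounds become
  \<open>q \<le> p\<close> and \<open>0 \<le> q\<close>.\<close>

lemma v_limit_bounds: assumes "(v \<longlongrightarrow> a) (at_left T)" shows "1 / 2 \<le> a" "a \<le> 1"
proof -
  show "1 / 2 \<le> a"
  proof (rule ccontr)
    assume "\<not> 1 / 2 \<le> a"
    then have "a < 1 / 2" by simp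
    then have "ev (\<lambda>t. v t < 1 / 2)" by (rule order_tendstoD(2)[OF assms])
    then have "ev (\<lambda>t. ((\<lambda>t. ln (Q t)) has_real_derivative (1 - 2 * v t) / Q t) (at t) \<and> 0 \<le> (1 - 2 * v t) / Q t)"
      using near by eventually_elim (auto intro!: derivative_eq_intros D_Q simp: Q_pos less_imp_le)
    from nonneg_deriv_at_left(1)[OF this] obtain c where "ev (\<lambda>t. c \<le> ln (Q t))" by blast
    then have "ev (\<lambda>t. exp c \<le> Q t)" using near by eventually_elim (use Q_pos ln_ge_iff in auto)
    moreover have "ev (\<lambda>t. Q t < exp c)" by (rule Q_small) simp
    ultimately have "ev (\<lambda>t. False)" by eventually_elim simp
    then show False by simp
  qed
  show "a \<le> 1"
  proof (rule ccontr)
    assume "\<not> a \<le> 1"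
    then obtain c where c: "1 < c" "c < a" by (meson dense not_le)
    have "ev (\<lambda>t. False)" using v_upper[OF c(1)] order_tendstoD(1)[OF assms c(2)] by eventually_elim simp
    then show False by simp
  qed
qed

text \<open>\<open>ln \<beta>\<close> is nondecreasing, and
  \<open>\<epsilon> / Q \<le> C / (Q * s) = - (C / s)'\<close> makes
  \<open>ln \<beta> + C / s\<close> nonincreasing.\<close>

lemma \<beta>_lim: obtains B where "0 < B" "(\<beta> \<longlongrightarrow> B) (at_left T)"
proof -
  define C where "C = (\<Sum>i\<in>{J<..n}. b i)"
  have "ev (\<lambda>t. ((\<lambda>t. - ln (\<beta> t) - C * (1 / s t)) has_real_derivative - (\<epsilon> t / Q t) - C * (- 1 / (Q t * s t))) (at t) \<and>
      0 \<le> - (\<epsilon> t / Q t) - C * (- 1 / (Q t * s t)))"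
    using near
  proof eventually_elim
    case (elim t)
    then have t: "0 < t" "t < T" by auto
    have "\<epsilon> t / Q t \<le> C / s t / Q t"
      using \<epsilon>_le[OF t] Q_pos[OF t] unfolding C_def by (intro divide_right_mono) auto
    moreover have "((\<lambda>t. - ln (\<beta> t) - C * (1 / s t)) has_real_derivative - (\<epsilon> t / Q t) - C * (- 1 / (Q t * s t))) (at t)"
      by (intro DERIV_diff DERIV_minus DERIV_cmult D_ln_\<beta>[OF t] D_inv_s[OF t])
    ultimately show ?case by (simp add: mult.commute)
  qed
  from nonneg_deriv_at_left(1)[OF this] obtain c where c: "ev (\<lambda>t. c \<le> - ln (\<beta> t) - C * (1 / s t))" by blast
  have C: "0 \<le> C" unfolding C_def using b by (intro sum_nonneg) (auto intro: less_imp_le)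
  have bound: "ev (\<lambda>t. ln (\<beta> t) \<le> - c)"
    using c near
  proof eventually_elim
    case (elim t)
    have "0 \<le> C * (1 / s t)" using C s[of t] elim by simp
    then show ?case using elim by linarith
  qed
  have "ev (\<lambda>t. ((\<lambda>t. ln (\<beta> t)) has_real_derivative \<epsilon> t / Q t) (at t) \<and> 0 \<le> \<epsilon> t / Q t)"
    by (rule ev_at) (simp add: D_ln_\<beta> \<epsilon>_nonneg Q_pos less_imp_le)
  from nonneg_deriv_at_left(2)[OF this bound] obtain B where "((\<lambda>t. ln (\<beta> t)) \<longlongrightarrow> B) (at_left T)" by blast
  from tendsto_exp[OF this] have "((\<lambda>t. exp (ln (\<beta> t))) \<longlongrightarrow> exp B) (at_left T)" .
  then have "(\<beta> \<longlongrightarrow> exp B) (at_left T)"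
    by (rule Lim_transform_eventually) (rule ev_at, simp add: \<beta>_pos)
  then show thesis using that[of "exp B"] by simp
qed

lemma \<beta>_bounded_below: obtains c where "0 < c" "ev (\<lambda>t. c \<le> \<beta> t)"
proof -
  obtain B where B: "0 < B" "(\<beta> \<longlongrightarrow> B) (at_left T)" by (rule \<beta>_lim)
  have "ev (\<lambda>t. B / 2 \<le> \<beta> t)"
    using order_tendstoD(1)[OF B(2), of "B / 2"] B(1) by (auto elim: eventually_mono)
  then show thesis using that[of "B / 2"] B by simp
qed

text \<open>\<open>w * exp (M * t)\<close> is nondecreasing because \<open>\<mu> \<ge> - M\<close>.
  Passing to the reciprocal keeps the limit finite: \<open>m = 0\<close> means that \<open>w\<close>
  tends to infinity.\<close>

lemma inv_w_lim: obtains m where "0 \<le> m" "((\<lambda>t. 1 / w t) \<longlongrightarrow> m) (at_left T)"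
proof -
  obtain M where M: "0 \<le> M" "ev (\<lambda>t. - M \<le> \<mu> t)" by (rule \<mu>_bounded_below)
  have "ev (\<lambda>t. ((\<lambda>t. - (exp (- M * t) / w t)) has_real_derivative (\<mu> t + M) * exp (- M * t) / w t) (at t)
      \<and> 0 \<le> (\<mu> t + M) * exp (- M * t) / w t)"
    using M(2) near
  proof eventually_elim
    case (elim t)
    then have "0 \<le> (\<mu> t + M) * exp (- M * t) / w t" using w_pos[of t] by simp
    moreover have "((\<lambda>t. - (exp (- M * t) / w t)) has_real_derivative (\<mu> t + M) * exp (- M * t) / w t) (at t)"
      using elim w_pos[of t]
      by (auto intro!: derivative_eq_intros D_w') (simp add: field_simps power2_eq_square)
    ultimately show ?case by blast
  qed
  moreover have "ev (\<lambda>t. - (exp (- M * t) / w t) \<le> 0)" by (rule ev_at) (simp add: w_pos less_imp_le)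
  ultimately have "\<exists>m. ((\<lambda>t. - (exp (- M * t) / w t)) \<longlongrightarrow> m) (at_left T)"
    by (rule nonneg_deriv_at_left(2))
  then obtain m where "((\<lambda>t. - (exp (- M * t) / w t)) \<longlongrightarrow> m) (at_left T)" ..
  then have "((\<lambda>t. - (exp (M * t) * - (exp (- M * t) / w t))) \<longlongrightarrow> - (exp (M * T) * m)) (at_left T)"
    by (intro tendsto_intros)
  moreover have "- (exp (M * t) * - (exp (- M * t) / w t)) = 1 / w t" for t
    by (simp add: exp_minus)
  ultimately have lim: "((\<lambda>t. 1 / w t) \<longlongrightarrow> - (exp (M * T) * m)) (at_left T)"
    by (simp only:)
  moreover have "0 \<le> - (exp (M * T) * m)"
    by (rule tendsto_lowerbound[OF lim]) (auto intro!: ev_at simp: w_pos less_imp_le)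
  ultimately show thesis using that by blast
qed

section \<open>Convergence of \<open>v\<close>\<close>

text \<open>\<open>logistic_convergent\<close> applies with the time \<open>ln s\<close>; the
  harvesting term \<open>h * Q\<^sup>2 = \<Phi> - \<omega>\<^sup>2 * Q\<^sup>2\<close> has the limit
  of \<Phi> since \<open>Q\<close> tends to 0.\<close>

lemma v_converges_of_\<Phi>:
  assumes "(\<Phi> \<longlongrightarrow> L) (at_left T)"
  obtains a where "(v \<longlongrightarrow> a) (at_left T)" "a * (1 - a) = L"
proof -
  have "((\<lambda>t. \<Phi> t - \<omega>\<^sup>2 * (Q t)\<^sup>2) \<longlongrightarrow> L - \<omega>\<^sup>2 * 0\<^sup>2) (at_left T)"
    by (intro tendsto_intros assms Q_lim)
  then have F: "((\<lambda>t. h t * (Q t)\<^sup>2) \<longlongrightarrow> L) (at_left T)" by (simp add: h_def \<Phi>_def algebra_simps)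
  have lb: "ev (\<lambda>t. 0 \<le> v t)" using v_pos by eventually_elim simp
  have "\<exists>a. (v \<longlongrightarrow> a) (at_left T) \<and> a * (1 - a) = L"
    by (rule logistic_convergent[where Q = Q, OF ev_at ev_at ev_at ln_s_lim F lb v_le_2]) (auto intro: Q_pos D_v D_ln_s)
  then show thesis using that by blast
qed

text \<open>Since \<open>v * (1 - v) \<le> 1 / 4\<close>, such a \<Phi> would make \<open>v\<close>
  decrease at least at unit rate in the time \<open>ln s\<close>, against \<open>v > 0\<close>. This
  is what excludes the impossible pairs of \<open>J\<close> and \<open>n\<close>.\<close>

lemma \<Phi>_not_large: "\<not> ev (\<lambda>t. 2 \<le> \<Phi> t)"
proof
  assume large: "ev (\<lambda>t. 2 \<le> \<Phi> t)"
  have "((\<lambda>t. \<omega>\<^sup>2 * (Q t)\<^sup>2) \<longlongrightarrow> \<omega>\<^sup>2 * 0\<^sup>2) (at_left T)" by (intro tendsto_intros Q_lim)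
  then have "ev (\<lambda>t. \<omega>\<^sup>2 * (Q t)\<^sup>2 < 1 / 2)" by (intro order_tendstoD(2)) auto
  with large have "ev (\<lambda>t. 1 * (1 / Q t) \<le> - ((v t * (1 - v t) - h t * (Q t)\<^sup>2) / Q t))"
    using near
  proof eventually_elim
    case (elim t)
    have "0 \<le> (v t - 1 / 2)\<^sup>2" by simp
    then have "v t * (1 - v t) \<le> 1 / 4" by (simp add: power2_eq_square algebra_simps)
    then have "1 \<le> - (v t * (1 - v t) - h t * (Q t)\<^sup>2)" using elim hQ[of t] by simp
    then have "1 / Q t \<le> - (v t * (1 - v t) - h t * (Q t)\<^sup>2) / Q t"
      using Q_pos[of t] elim by (intro divide_right_mono) auto
    then show ?case unfolding minus_divide_left by simp
  qed
  moreover have "ev (\<lambda>t. ((\<lambda>t. - v t) has_real_derivative - ((v t * (1 - v t) - h t * (Q t)\<^sup>2) / Q t)) (at t))"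
    by (intro ev_at DERIV_minus D_v)
  ultimately have "filterlim (\<lambda>t. - v t) at_top (at_left T)"
    by (intro filterlim_at_top_of_deriv_ge[OF _ ev_at[OF D_ln_s] _ _ ln_s_lim, where c = 1]) auto
  then have "ev (\<lambda>t. 0 < - v t)" unfolding filterlim_at_top_dense by blast
  with v_pos have "ev (\<lambda>t. False)" by eventually_elim simp
  then show False by simp
qed


lemma \<epsilon>_lim: "(\<epsilon> \<longlongrightarrow> 0) (at_left T)"
proof (rule tendsto_sandwich)
  show "ev (\<lambda>t. 0 \<le> \<epsilon> t)" by (rule ev_at[OF \<epsilon>_nonneg])
  show "ev (\<lambda>t. \<epsilon> t \<le> (\<Sum>i\<in>{J<..n}. b i) * (1 / s t))" using ev_at[OF \<epsilon>_le] by simp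
  show "((\<lambda>t. (\<Sum>i\<in>{J<..n}. b i) * (1 / s t)) \<longlongrightarrow> 0) (at_left T)"
    by (rule tendsto_mult_right_zero[OF inv_s_lim])
qed simp

text \<open>With \<open>\<tau> = ln s\<close> as time and \<open>y = \<Phi>\<^bsup>1/(n-4)\<^esup>\<close>, the pair \<open>(v, \<Phi>)\<close> satisfies, up to integrable errors, the
  damped oscillator \<open>y'' + (2a - 1) y' - a (1 - a) y + y\<^bsup>n-3\<^esup> = 0\<close>, with \<open>y'/y = v - a\<close>; the quantity
  \<open>E\<close> below is its energy.\<close>

lemma v_converges_oscillator:
  assumes J3: "3 \<le> J" and nJ: "2 * J < n"
  obtains a \<eta> where "(v \<longlongrightarrow> a) (at_left T)" "0 < \<eta>" "ev (\<lambda>t. \<eta> \<le> \<Phi> t)"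
proof -
  define N where "N = real n - 4"
  \<comment> \<open>The value of \<open>v\<close> at which \<Phi> is stationary up to \<epsilon>.
    The inequality \<open>a > 1 / 2\<close> amounts to \<open>2 * J < n\<close>, and
    \<open>a < 1\<close> to \<open>J > 2\<close>.\<close>
  define a where "a = (real n - real J - 2) / N"
  have nJ': "2 * real J + 1 \<le> real n" "3 \<le> real J" using nJ J3 by linarith+
  have N: "3 \<le> N" using nJ' by (simp add: N_def)
  have a: "1 / 2 < a" "a < 1" using nJ' N by (auto simp: a_def N_def field_simps)
  have Na: "N * a = real n - real J - 2" using N by (simp add: a_def)
  define x where "x t = v t - a" for t
  have D_x: "(x has_real_derivative (v t * (1 - v t) - \<Phi> t + \<omega>\<^sup>2 * (Q t)\<^sup>2) / Q t) (at t)" if "0 < t" "t < T" for t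
    unfolding x_def[abs_def] using D_v[OF that] hQ[OF that]
    by (auto intro!: derivative_eq_intros)
  have D_Phi: "(\<Phi> has_real_derivative \<Phi> t * (N * x t + \<epsilon> t) / Q t) (at t)" if "0 < t" "t < T" for t
  proof -
    have "(real n - 4) * v t + 2 - (real n - real J) + \<epsilon> t = N * x t + \<epsilon> t"
      unfolding x_def right_diff_distrib Na by (simp add: N_def)
    then show ?thesis using D_\<Phi>[OF that] by simp
  qed
  define good where "good t \<longleftrightarrow> 0 < t \<and> t < T \<and> 0 < v t \<and> v t \<le> 2 \<and> \<epsilon> t \<le> 1 \<and> Q t \<le> 1" for t
  have good: "ev good"
  proof -
    have "ev (\<lambda>t. \<epsilon> t < 1)" using order_tendstoD(2)[OF \<epsilon>_lim] by simp
    then show ?thesis using near v_pos v_le_2 Q_small[OF zero_less_one]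
      unfolding good_def by eventually_elim auto
  qed
  have goodD: "0 < t" "t < T" "0 < v t" "v t \<le> 2" "0 \<le> \<epsilon> t" "\<epsilon> t \<le> 1" "0 < Q t" "Q t \<le> 1" "0 < \<Phi> t"
      "\<bar>x t\<bar> \<le> 2" "0 < s t" "(Q t)\<^sup>2 \<le> Q t" "(x t)\<^sup>2 \<le> 4" if "good t" for t
  proof -
    show *: "0 < t" "t < T" "0 < v t" "v t \<le> 2" "0 \<le> \<epsilon> t" "\<epsilon> t \<le> 1" "0 < Q t" "Q t \<le> 1" "0 < \<Phi> t" "0 < s t"
      using that \<epsilon>_nonneg[of t] Q_pos[of t] \<Phi>_pos[of t] s[of t] by (auto simp: good_def)
    show x2: "\<bar>x t\<bar> \<le> 2" using * a by (auto simp: x_def abs_le_iff)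
    show "(Q t)\<^sup>2 \<le> Q t" using * by (simp add: power2_eq_square mult_left_le)
    show "(x t)\<^sup>2 \<le> 4" using abs_le_square_iff[of "x t" 2] x2 by simp
  qed
  \<comment> \<open>At the level \<open>c\<close> of \<open>\<Phi> * exp (v)\<close> the term
    \<open>- \<Phi>\<close> dominates the logarithmic derivative, so \<open>c\<close> is crossed
    only downwards; staying above it is excluded by \<open>\<Phi>_not_large\<close>. The factor
    \<open>exp 2\<close> in \<open>c\<close> comes from \<open>v \<le> 2\<close>.\<close>
  obtain P where P: "2 \<le> P" "ev (\<lambda>t. \<Phi> t \<le> P)"
  proof -
    define C where "C = 2 * N + 2 + \<omega>\<^sup>2"
    define c where "c = (C + 1) * exp 2"
    have C: "2 \<le> C" using N by (simp add: C_def)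
    define \<psi>' where "\<psi>' t = \<Phi> t * exp (v t) * (N * x t + \<epsilon> t + v t * (1 - v t) - \<Phi> t + \<omega>\<^sup>2 * (Q t)\<^sup>2) / Q t" for t
    have D: "ev (\<lambda>t. ((\<lambda>t. \<Phi> t * exp (v t)) has_real_derivative \<psi>' t) (at t))"
      using near
    proof eventually_elim
      case (elim t)
      then have t: "0 < t" "t < T" by auto
      show ?case unfolding \<psi>'_def using Q_pos[OF t] hQ[OF t]
        by (auto intro!: derivative_eq_intros D_Phi[OF t] D_v[OF t]) (simp add: field_simps)
    qed
    have large: "ev (\<lambda>t. c \<le> \<Phi> t * exp (v t) \<longrightarrow> C + 1 \<le> \<Phi> t)"
      using good
    proof eventually_elim
      case (elim t)
      show ?case
      proof
        assume *: "c \<le> \<Phi> t * exp (v t)"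
        have "\<Phi> t * exp (v t) \<le> \<Phi> t * exp 2" using goodD[OF elim] by simp
        then have "(C + 1) * exp 2 \<le> \<Phi> t * exp 2" using * unfolding c_def by linarith
        then show "C + 1 \<le> \<Phi> t" by simp
      qed
    qed
    have "ev (\<lambda>t. \<Phi> t * exp (v t) = c \<longrightarrow> \<psi>' t < 0)"
      using good large
    proof eventually_elim
      case (elim t)
      note g = goodD[OF elim(1)]
      show ?case
      proof
        assume "\<Phi> t * exp (v t) = c"
        then have "C + 1 \<le> \<Phi> t" using elim by simp
        moreover have "N * x t \<le> N * 2" using g N by (intro mult_left_mono) auto
        moreover have "0 \<le> v t * v t" by simp
        then have "v t * (1 - v t) \<le> 1" using sum_squares_bound[of "v t" 1] g
          by (simp add: algebra_simps power2_eq_square)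
        moreover have "\<omega>\<^sup>2 * (Q t)\<^sup>2 \<le> \<omega>\<^sup>2 * 1" using g by (intro mult_left_mono) auto
        ultimately have "N * x t + \<epsilon> t + v t * (1 - v t) - \<Phi> t + \<omega>\<^sup>2 * (Q t)\<^sup>2 < 0"
          using g unfolding C_def by linarith
        then show "\<psi>' t < 0" using g by (simp add: \<psi>'_def divide_less_0_iff mult_less_0_iff)
      qed
    qed
    from eventually_one_side'[OF D this]
    consider "ev (\<lambda>t. c \<le> \<Phi> t * exp (v t))" | "ev (\<lambda>t. \<Phi> t * exp (v t) \<le> c)" by blast
    then show thesis
    proof cases
      case 1
      then have "ev (\<lambda>t. 2 \<le> \<Phi> t)" using large by eventually_elim (use C in auto)
      then show ?thesis using \<Phi>_not_large by blast
    next
      case 2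
      have "ev (\<lambda>t. \<Phi> t \<le> max c 2)"
        using 2 good
      proof eventually_elim
        case (elim t)
        have "\<Phi> t * 1 \<le> \<Phi> t * exp (v t)" using goodD[OF elim(2)] by (intro mult_left_mono) auto
        then show ?case using elim by simp
      qed
      then show ?thesis using that[of "max c 2"] by simp
    qed
  qed
  \<comment> \<open>In terms of the oscillator, \<open>Y\<close> is \<open>y\<^sup>2\<close>,
    \<open>\<Phi> * Y\<close> is \<open>y^(N + 2)\<close>, and \<open>f\<close> is
    \<open>y'\<^sup>2\<close> up to the error from \<epsilon>.\<close>
  define Y where "Y t = \<Phi> t powr (2 / N)" for t
  define Yb where "Yb = P powr (2 / N)"
  define E where "E t = Y t * ((x t)\<^sup>2 / 2 - a * (1 - a) / 2 + \<Phi> t / (N + 2))" for t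
  define f where "f t = Y t * (x t)\<^sup>2" for t
  define Cb where "Cb = (\<Sum>i\<in>{J<..n}. b i)"
  have Cb: "0 \<le> Cb" unfolding Cb_def using b by (intro sum_nonneg) (auto intro: less_imp_le)
  have Yb: "0 < Yb" using P by (simp add: Yb_def)
  have Y_pos: "0 < Y t" if "0 < t" "t < T" for t using \<Phi>_pos[OF that] by (simp add: Y_def)
  have Y_le: "ev (\<lambda>t. Y t \<le> Yb)"
    using P(2) good
  proof eventually_elim
    case (elim t)
    then show ?case using goodD[OF elim(2)] N unfolding Y_def Yb_def by (intro powr_mono2) auto
  qed
  have D_Y: "(Y has_real_derivative Y t * (2 * x t + 2 * \<epsilon> t / N) / Q t) (at t)" if t: "0 < t" "t < T" for t
  proof -
    have "(Y has_real_derivative 2 / N * \<Phi> t powr (2 / N - 1) * (\<Phi> t * (N * x t + \<epsilon> t) / Q t)) (at t)"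
      unfolding Y_def[abs_def] using \<Phi>_pos[OF t]
      using DERIV_fun_powr[OF D_Phi[OF t], of "2 / N"] by simp
    moreover have "2 / N * \<Phi> t powr (2 / N - 1) * (\<Phi> t * (N * x t + \<epsilon> t) / Q t) = Y t * (2 * x t + 2 * \<epsilon> t / N) / Q t"
    proof -
      have "\<Phi> t powr (2 / N - 1) = Y t / \<Phi> t" using \<Phi>_pos[OF t] by (simp add: Y_def powr_diff)
      then show ?thesis using \<Phi>_pos[OF t] N Q_pos[OF t] by (simp add: field_simps)
    qed
    ultimately show ?thesis by simp
  qed
  \<comment> \<open>All terms of leading order cancel except the damping
    \<open>- (2 * a - 1) * f\<close>; the others carry a factor \<open>Q\<^sup>2\<close> or
    \<epsilon>.\<close>
  define E' where "E' t = Y t * (- (2 * a - 1) * (x t)\<^sup>2 + x t * (\<omega>\<^sup>2 * (Q t)\<^sup>2)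
      + \<epsilon> t / N * ((x t)\<^sup>2 - a * (1 - a) + \<Phi> t)) / Q t" for t
  have D_E: "(E has_real_derivative E' t) (at t)" if t: "0 < t" "t < T" for t
  proof -
    define X where "X = x t"
    have v: "v t = X + a" by (simp add: X_def x_def)
    have "(E has_real_derivative Y t * (2 * x t + 2 * \<epsilon> t / N) / Q t * ((x t)\<^sup>2 / 2 - a * (1 - a) / 2 + \<Phi> t / (N + 2))
      + (x t * ((v t * (1 - v t) - \<Phi> t + \<omega>\<^sup>2 * (Q t)\<^sup>2) / Q t) + \<Phi> t * (N * x t + \<epsilon> t) / Q t / (N + 2)) * Y t) (at t)"
    proof -
      have "((\<lambda>t. (x t)\<^sup>2 / 2) has_real_derivative
          x t * ((v t * (1 - v t) - \<Phi> t + \<omega>\<^sup>2 * (Q t)\<^sup>2) / Q t)) (at t)"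
        by (auto intro!: derivative_eq_intros D_x[OF t])
      from DERIV_mult[OF D_Y[OF t] DERIV_add[OF DERIV_diff[OF this DERIV_const[of "a * (1 - a) / 2"]]
          DERIV_cdivide[OF D_Phi[OF t], of "N + 2"]]]
      show ?thesis unfolding E_def[abs_def] by simp
    qed
    moreover have "Y t * (2 * x t + 2 * \<epsilon> t / N) / Q t * ((x t)\<^sup>2 / 2 - a * (1 - a) / 2 + \<Phi> t / (N + 2))
      + (x t * ((v t * (1 - v t) - \<Phi> t + \<omega>\<^sup>2 * (Q t)\<^sup>2) / Q t) + \<Phi> t * (N * x t + \<epsilon> t) / Q t / (N + 2)) * Y t = E' t"
    proof -
      \<comment> \<open>The common divisor \<open>Q\<close> is split off, and \<Phi> and \<epsilon>
        are rescaled to clear \<open>N + 2\<close> and \<open>N\<close>; a polynomial identity is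
        left.\<close>
      have factor: "y * (2 * X + 2 * e / N) / q * (Z + p / (N + 2)) + (X * (W / q) + p * (N * X + e) / q / (N + 2)) * y
        = y * ((2 * X + 2 * (e / N)) * (Z + p / (N + 2)) + (X * W + p / (N + 2) * (N * X + e))) / q" for y q e p Z W
        by (simp add: divide_inverse algebra_simps)
      define ph ee where "ph = \<Phi> t / (N + 2)" and "ee = \<epsilon> t / N"
      have sub: "\<Phi> t = ph * (N + 2)" "\<epsilon> t = ee * N" using N by (auto simp: ph_def ee_def)
      have "(2 * X + 2 * ee) * (X\<^sup>2 / 2 - a * (1 - a) / 2 + ph)
          + (X * ((X + a) * (1 - (X + a)) - ph * (N + 2) + \<omega>\<^sup>2 * (Q t)\<^sup>2) + ph * (N * X + ee * N))
        = - (2 * a - 1) * X\<^sup>2 + X * (\<omega>\<^sup>2 * (Q t)\<^sup>2) + ee * (X\<^sup>2 - a * (1 - a) + ph * (N + 2))"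
        by (simp add: field_simps power2_eq_square)
      then show ?thesis
        unfolding E'_def v X_def[symmetric] unfolding factor
        unfolding ph_def[symmetric] ee_def[symmetric] unfolding sub by (simp only:)
    qed
    ultimately show ?thesis by simp
  qed
  define f' where "f' t = Y t * ((2 * x t + 2 * \<epsilon> t / N) * (x t)\<^sup>2
      + 2 * x t * (v t * (1 - v t) - \<Phi> t + \<omega>\<^sup>2 * (Q t)\<^sup>2)) / Q t" for t
  have D_f: "(f has_real_derivative f' t) (at t)" if t: "0 < t" "t < T" for t
    unfolding f_def[abs_def] f'_def using Q_pos[OF t]
    by (auto intro!: derivative_eq_intros D_Y[OF t] D_x[OF t]) (simp add: field_simps power2_eq_square)
  \<comment> \<open>The errors in \<open>E'\<close> are at most \<open>C1\<close> and
    \<open>C2 / (Q * s) = - (C2 / s)'\<close>, so the corrected energy \<open>G\<close> decreases at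
    least at the rate \<open>(2 * a - 1) * f / Q\<close>.\<close>
  define C1 where "C1 = 2 * \<omega>\<^sup>2 * Yb"
  define C2 where "C2 = Yb * (4 + P) * Cb / N"
  define G where "G t = E t - C1 * t + C2 * (1 / s t)" for t
  define G' where "G' t = E' t - C1 + C2 * (- 1 / (Q t * s t))" for t
  have C: "0 \<le> C1" "0 \<le> C2" using Yb P Cb N by (auto simp: C1_def C2_def)
  have D_G: "(G has_real_derivative G' t) (at t)" if t: "0 < t" "t < T" for t
    unfolding G_def[abs_def] G'_def
    by (intro DERIV_add DERIV_diff D_E[OF t] DERIV_cmult D_inv_s[OF t] DERIV_cmult_Id)
  have G'_le: "ev (\<lambda>t. G' t \<le> - ((2 * a - 1) * f t * (1 / Q t)))"
    using good Y_le P(2)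
  proof eventually_elim
    case (elim t)
    note g = goodD[OF elim(1)]
    have Y0: "0 < Y t" using Y_pos g by simp
    have "x t * (\<omega>\<^sup>2 * (Q t)\<^sup>2) \<le> 2 * (\<omega>\<^sup>2 * Q t)"
      using g by (intro mult_mono mult_left_mono) auto
    then have "Y t * (x t * (\<omega>\<^sup>2 * (Q t)\<^sup>2)) \<le> Y t * (2 * (\<omega>\<^sup>2 * Q t))"
      using Y0 by (intro mult_left_mono) auto
    also have "\<dots> \<le> Yb * (2 * (\<omega>\<^sup>2 * Q t))" using elim g by (intro mult_right_mono) auto
    finally have "Y t * (x t * (\<omega>\<^sup>2 * (Q t)\<^sup>2)) \<le> Yb * (2 * (\<omega>\<^sup>2 * Q t))" .
    then have 1: "Y t * (x t * (\<omega>\<^sup>2 * (Q t)\<^sup>2)) \<le> C1 * Q t" by (simp add: C1_def mult_ac)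
    have "(x t)\<^sup>2 - a * (1 - a) + \<Phi> t \<le> 4 + P"
      using g(13) elim(3) mult_pos_pos[of a "1 - a"] a by linarith
    then have "\<epsilon> t / N * ((x t)\<^sup>2 - a * (1 - a) + \<Phi> t) \<le> \<epsilon> t / N * (4 + P)"
      using g N by (intro mult_left_mono) auto
    also have "\<dots> \<le> Cb / s t / N * (4 + P)"
      using \<epsilon>_le[OF g(1,2)] N P by (intro mult_right_mono divide_right_mono) (auto simp: Cb_def)
    finally have "Y t * (\<epsilon> t / N * ((x t)\<^sup>2 - a * (1 - a) + \<Phi> t)) \<le> Y t * (Cb / s t / N * (4 + P))"
      using Y0 by (intro mult_left_mono) auto
    also have "\<dots> \<le> Yb * (Cb / s t / N * (4 + P))"
      using elim g Cb P N by (intro mult_right_mono) auto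
    also have "\<dots> = C2 * (1 / s t)" by (simp add: C2_def mult_ac)
    finally have 2: "Y t * (\<epsilon> t / N * ((x t)\<^sup>2 - a * (1 - a) + \<Phi> t)) \<le> C2 * (1 / s t)" .
    have "E' t * Q t = - (2 * a - 1) * f t + Y t * (x t * (\<omega>\<^sup>2 * (Q t)\<^sup>2)) + Y t * (\<epsilon> t / N * ((x t)\<^sup>2 - a * (1 - a) + \<Phi> t))"
    proof -
      have "E' t * Q t = Y t * (- (2 * a - 1) * (x t)\<^sup>2 + x t * (\<omega>\<^sup>2 * (Q t)\<^sup>2)
          + \<epsilon> t / N * ((x t)\<^sup>2 - a * (1 - a) + \<Phi> t))" using g by (simp add: E'_def)
      then show ?thesis by (simp add: f_def algebra_simps)
    qed
    then have "E' t * Q t \<le> - (2 * a - 1) * f t + C1 * Q t + C2 * (1 / s t)" using 1 2 by linarith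
    then have "E' t \<le> (- (2 * a - 1) * f t + C1 * Q t + C2 * (1 / s t)) / Q t"
      using g by (simp add: pos_le_divide_eq)
    also have "\<dots> = - ((2 * a - 1) * f t * (1 / Q t)) + C1 + C2 * (1 / (Q t * s t))"
      using g by (simp add: field_simps)
    finally show ?case by (simp add: G'_def)
  qed
  define Cf where "Cf = Yb * (24 + 4 * (3 + P + \<omega>\<^sup>2))"
  have f'_le: "ev (\<lambda>t. f' t \<le> Cf * (1 / Q t))"
    using good Y_le P(2)
  proof eventually_elim
    case (elim t)
    note g = goodD[OF elim(1)]
    have Y0: "0 < Y t" using Y_pos g by simp
    have "2 * \<epsilon> t / N \<le> 2 * 1 / 1" using g N by (intro frac_le) auto
    then have "(2 * x t + 2 * \<epsilon> t / N) * (x t)\<^sup>2 \<le> 6 * 4" using g N by (intro mult_mono) auto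
    moreover have "\<bar>v t * (1 - v t)\<bar> \<le> 2 * 1"
      unfolding abs_mult using g by (intro mult_mono) auto
    then have "\<bar>v t * (1 - v t) - \<Phi> t + \<omega>\<^sup>2 * (Q t)\<^sup>2\<bar> \<le> 3 + P + \<omega>\<^sup>2"
    proof -
      have "0 \<le> \<omega>\<^sup>2 * (Q t)\<^sup>2" "\<omega>\<^sup>2 * (Q t)\<^sup>2 \<le> \<omega>\<^sup>2" using g by (auto intro!: mult_left_le)
      then show ?thesis using \<open>\<bar>v t * (1 - v t)\<bar> \<le> 2 * 1\<close> g(9) elim(3) by linarith
    qed
    then have "\<bar>2 * x t * (v t * (1 - v t) - \<Phi> t + \<omega>\<^sup>2 * (Q t)\<^sup>2)\<bar> \<le> 4 * (3 + P + \<omega>\<^sup>2)"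
      unfolding abs_mult using g by (intro mult_mono) auto
    ultimately have "Y t * ((2 * x t + 2 * \<epsilon> t / N) * (x t)\<^sup>2 + 2 * x t * (v t * (1 - v t) - \<Phi> t + \<omega>\<^sup>2 * (Q t)\<^sup>2))
        \<le> Y t * (24 + 4 * (3 + P + \<omega>\<^sup>2))"
      using Y0 by (intro mult_left_mono) auto
    also have "\<dots> \<le> Cf" unfolding Cf_def using elim P by (intro mult_right_mono) auto
    finally show ?case unfolding f'_def using g by (simp add: divide_right_mono)
  qed
  have E_ge: "ev (\<lambda>t. - Yb \<le> E t)"
    using good Y_le
  proof eventually_elim
    case (elim t)
    note g = goodD[OF elim(1)]
    have Y0: "0 < Y t" using Y_pos g by simp
    have "a * (1 - a) \<le> 1 * 1" using a by (intro mult_mono) auto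
    moreover have "0 \<le> \<Phi> t / (N + 2)" using g N by simp
    ultimately have "- 1 \<le> (x t)\<^sup>2 / 2 - a * (1 - a) / 2 + \<Phi> t / (N + 2)" using zero_le_power2[of "x t"] by linarith
    then have "Y t * (- 1) \<le> E t" unfolding E_def using Y0 by (intro mult_left_mono) auto
    then show ?case using elim by simp
  qed
  have G_ge: "ev (\<lambda>t. - Yb - C1 * T \<le> G t)"
    using E_ge good
  proof eventually_elim
    case (elim t)
    note g = goodD[OF elim(2)]
    have "C1 * t \<le> C1 * T" "0 \<le> C2 * (1 / s t)" using g C by (auto intro!: mult_left_mono)
    then show ?case using elim by (simp add: G_def)
  qed
  have f0: "ev (\<lambda>t. 0 \<le> f t)" by (rule ev_at) (simp add: f_def Y_pos less_imp_le)
  have Cf0: "0 \<le> Cf" using Yb P by (simp add: Cf_def)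
  have Q0: "ev (\<lambda>t. 0 \<le> 1 / Q t)" by (rule ev_at) (simp add: Q_pos less_imp_le)
  have a0: "0 < 2 * a - 1" using a by simp
  note bar = barbalat[OF ev_at[OF D_f] ev_at[OF D_G] ev_at[OF D_ln_s] f0 f'_le G'_le Q0 a0 Cf0 G_ge ln_s_lim]
  have f_lim: "(f \<longlongrightarrow> 0) (at_left T)" by (rule bar(1))
  obtain g where g: "(G \<longlongrightarrow> g) (at_left T)" using bar(2) by blast
  define A where "A = a * (1 - a) / 2"
  have A: "0 < A" using a by (simp add: A_def)
  \<comment> \<open>The energy without its kinetic part; it converges because \<open>f\<close> tends
    to 0.\<close>
  define V where "V t = Y t * (- A + \<Phi> t / (N + 2))" for t
  define e where "e = g + C1 * T"
  have V_lim: "(V \<longlongrightarrow> e) (at_left T)"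
  proof -
    have "((\<lambda>t. G t + C1 * t - C2 * (1 / s t) - f t / 2) \<longlongrightarrow> g + C1 * T - C2 * 0 - 0 / 2) (at_left T)"
      by (intro tendsto_diff tendsto_add g tendsto_mult tendsto_const tendsto_ident_at inv_s_lim
          tendsto_divide f_lim) simp
    moreover have "G t + C1 * t - C2 * (1 / s t) - f t / 2 = V t" for t
      unfolding G_def E_def f_def V_def A_def by (simp add: algebra_simps)
    ultimately show ?thesis by (simp add: e_def)
  qed
  have "\<exists>\<eta>>0. ev (\<lambda>t. \<eta> \<le> \<Phi> t)"
  proof (cases "e = 0")
    case False
    \<comment> \<open>As \<open>\<bar>V\<bar> \<le> Cv * Y\<close>, a nonzero limit of
      \<open>V\<close> keeps \<open>Y\<close>, and with it \<Phi>, away from 0.\<close>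
    define Cv where "Cv = A + P"
    have Cv: "0 < Cv" using A P by (simp add: Cv_def)
    define y0 where "y0 = \<bar>e\<bar> / 2 / Cv"
    have y0: "0 < y0" using False Cv by (simp add: y0_def)
    have "((\<lambda>t. \<bar>V t\<bar>) \<longlongrightarrow> \<bar>e\<bar>) (at_left T)" by (intro tendsto_intros V_lim)
    then have "ev (\<lambda>t. \<bar>e\<bar> / 2 < \<bar>V t\<bar>)" using False by (intro order_tendstoD(1)) auto
    then have "ev (\<lambda>t. y0 powr (N / 2) \<le> \<Phi> t)" using good P(2)
    proof eventually_elim
      case (elim t)
      note g = goodD[OF elim(2)]
      have Y0: "0 < Y t" using Y_pos g by simp
      have "\<Phi> t / (N + 2) \<le> \<Phi> t" "0 \<le> \<Phi> t / (N + 2)" using g N by (auto simp: field_simps)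
      then have "\<bar>- A + \<Phi> t / (N + 2)\<bar> \<le> Cv" using A elim g unfolding Cv_def by linarith
      then have "\<bar>V t\<bar> \<le> Y t * Cv" unfolding V_def abs_mult using Y0 by (intro mult_mono) auto
      then have "\<bar>e\<bar> / 2 \<le> Y t * Cv" using elim by simp
      then have "y0 \<le> Y t" unfolding y0_def using Cv by (simp add: field_simps)
      then have "y0 powr (N / 2) \<le> Y t powr (N / 2)" using y0 N by (intro powr_mono2) auto
      also have "\<dots> = \<Phi> t" using g N by (simp add: Y_def powr_powr)
      finally show ?case .
    qed
    then show ?thesis using y0 by (intro exI[of _ "y0 powr (N / 2)"]) auto
  next
    case True
    \<comment> \<open>At \<open>\<Phi> = c\<close> one has
      \<open>\<bar>V\<bar> = c powr (2 / N) * (A / 2)\<close>, impossible near \<open>T\<close>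
      because \<open>V\<close> tends to 0; so \<Phi> ends up on one side of
      \<open>c\<close>.\<close>
    define c where "c = (N + 2) * (A / 2)"
    have c: "0 < c" using N A by (simp add: c_def)
    have "((\<lambda>t. \<bar>V t\<bar>) \<longlongrightarrow> \<bar>e\<bar>) (at_left T)" by (intro tendsto_intros V_lim)
    then have "ev (\<lambda>t. \<bar>V t\<bar> < c powr (2 / N) * (A / 2))" using True c A by (intro order_tendstoD(2)) auto
    then have "ev (\<lambda>t. \<Phi> t = c \<longrightarrow> 0 < \<Phi> t * (N * x t + \<epsilon> t) / Q t)"
      using near
    proof eventually_elim
      case (elim t)
      have "\<bar>V t\<bar> = c powr (2 / N) * (A / 2)" if "\<Phi> t = c"
      proof -
        have "- A + \<Phi> t / (N + 2) = - (A / 2)" unfolding that c_def using N by (simp add: field_simps)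
        then show ?thesis using A by (simp add: V_def Y_def that abs_mult)
      qed
      then show ?case using elim by auto
    qed
    from eventually_one_side[OF ev_at[OF D_Phi] this]
    consider "ev (\<lambda>t. c \<le> \<Phi> t)" | "ev (\<lambda>t. \<Phi> t \<le> c)" by blast
    then show ?thesis
    proof cases
      case 1
      then show ?thesis using c by blast
    next
      case 2
      \<comment> \<open>Below \<open>c\<close> the bracket in \<open>V\<close> is at most
        \<open>- (A / 2)\<close>, so \<open>Y\<close> and then \<Phi> tend to 0. But then
        \<open>v\<close> tends to 1, which exceeds \<open>a\<close>, and \<open>ln \<Phi>\<close>
        grows without bound: a contradiction.\<close>
      have "(Y \<longlongrightarrow> 0) (at_left T)"
      proof (rule tendsto_sandwich)
        show "ev (\<lambda>t. 0 \<le> Y t)" by (rule ev_at) (simp add: Y_pos less_imp_le)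
        show "((\<lambda>t. - 2 / A * V t) \<longlongrightarrow> 0) (at_left T)"
          using V_lim True by (intro tendsto_mult_right_zero) simp
        show "ev (\<lambda>t. Y t \<le> - 2 / A * V t)"
          using 2 near
        proof eventually_elim
          case (elim t)
          then have Y0: "0 < Y t" using Y_pos by simp
          have "\<Phi> t / (N + 2) \<le> c / (N + 2)" using elim N by (intro divide_right_mono) auto
          also have "\<dots> = A / 2" unfolding c_def by (rule nonzero_mult_div_cancel_left) (use N in simp)
          finally have "- A + \<Phi> t / (N + 2) \<le> - (A / 2)" by linarith
          then have "V t \<le> Y t * (- (A / 2))" unfolding V_def using Y0 by (intro mult_left_mono) auto
          then show ?case using A by (simp add: field_simps)
        qed
      qed simp
      then have "((\<lambda>t. Y t powr (N / 2)) \<longlongrightarrow> 0 powr (N / 2)) (at_left T)"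
        using N by (intro tendsto_powr2 tendsto_const) (auto intro!: ev_at simp: Y_pos less_imp_le)
      then have "((\<lambda>t. Y t powr (N / 2)) \<longlongrightarrow> 0) (at_left T)" by simp
      then have "(\<Phi> \<longlongrightarrow> 0) (at_left T)"
      proof (rule Lim_transform_eventually)
        show "ev (\<lambda>t. Y t powr (N / 2) = \<Phi> t)"
        proof (rule ev_at)
          fix t assume "0 < t" "t < T"
          then show "Y t powr (N / 2) = \<Phi> t" using \<Phi>_pos[of t] N by (simp add: Y_def powr_powr)
        qed
      qed
      from v_converges_of_\<Phi>[OF this] obtain r where r: "(v \<longlongrightarrow> r) (at_left T)" "r * (1 - r) = 0" by blast
      then have "r = 1" using v_limit_bounds[OF r(1)] by auto
      have mid: "(a + 1) / 2 < 1" using a by simp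
      have "filterlim (\<lambda>t. ln (\<Phi> t)) at_top (at_left T)"
      proof (rule filterlim_at_top_of_deriv_ge[OF _ ev_at[OF D_ln_s] _ _ ln_s_lim])
        show "ev (\<lambda>t. ((\<lambda>t. ln (\<Phi> t)) has_real_derivative (N * x t + \<epsilon> t) / Q t) (at t))"
        proof (rule ev_at)
          fix t assume t: "0 < t" "t < T"
          show "((\<lambda>t. ln (\<Phi> t)) has_real_derivative (N * x t + \<epsilon> t) / Q t) (at t)"
            using \<Phi>_pos[OF t] by (auto intro!: derivative_eq_intros D_Phi[OF t])
        qed
        show "ev (\<lambda>t. (N * ((1 - a) / 2)) * (1 / Q t) \<le> (N * x t + \<epsilon> t) / Q t)"
          using good order_tendstoD(1)[OF r(1)[unfolded \<open>r = 1\<close>] mid]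
        proof eventually_elim
          case (elim t)
          note g = goodD[OF elim(1)]
          have "(1 - a) / 2 \<le> x t" using elim by (simp add: x_def field_simps)
          then have "N * ((1 - a) / 2) \<le> N * x t" using N by (intro mult_left_mono) auto
          then have "N * ((1 - a) / 2) / Q t \<le> (N * x t + \<epsilon> t) / Q t"
            using g by (intro divide_right_mono) auto
          then show ?case by simp
        qed
        show "0 < N * ((1 - a) / 2)" using N a by simp
      qed
      then have "ev (\<lambda>t. ln P < ln (\<Phi> t))" unfolding filterlim_at_top_dense by blast
      then have "ev (\<lambda>t. False)" using P(2) good
      proof eventually_elim
        case (elim t)
        then show ?case using goodD(9)[OF elim(3)] P(1) by simp
      qed
      then show ?thesis by simp
    qed
  qed
  then obtain \<eta> where \<eta>: "0 < \<eta>" "ev (\<lambda>t. \<eta> \<le> \<Phi> t)" by blast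
  \<comment> \<open>With \<open>Y\<close> bounded away from 0, the limit 0 of
    \<open>f = Y * x\<^sup>2\<close> forces \<open>x\<close> to 0.\<close>
  have "((\<lambda>t. (x t)\<^sup>2) \<longlongrightarrow> 0) (at_left T)"
  proof (rule tendsto_sandwich[where f = "\<lambda>_. 0"])
    show "((\<lambda>t. f t / \<eta> powr (2 / N)) \<longlongrightarrow> 0) (at_left T)"
      using tendsto_divide[OF f_lim tendsto_const[of "\<eta> powr (2 / N)"]] \<eta> by simp
    show "ev (\<lambda>t. (x t)\<^sup>2 \<le> f t / \<eta> powr (2 / N))"
      using \<eta>(2)
    proof eventually_elim
      case (elim t)
      then have "\<eta> powr (2 / N) \<le> Y t" unfolding Y_def using \<eta>(1) N by (intro powr_mono2) auto
      then have "\<eta> powr (2 / N) * (x t)\<^sup>2 \<le> f t" unfolding f_def by (intro mult_right_mono) auto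
      then show ?case using \<eta>(1) by (simp add: field_simps)
    qed
  qed auto
  from tendsto_real_sqrt[OF this] have "((\<lambda>t. \<bar>x t\<bar>) \<longlongrightarrow> 0) (at_left T)" by simp
  then have "(x \<longlongrightarrow> 0) (at_left T)" by (rule tendsto_rabs_zero_cancel)
  then have "(v \<longlongrightarrow> a) (at_left T)" unfolding x_def[abs_def] by (rule LIM_zero_cancel)
  then show thesis using that \<eta> by blast
qed


text \<open>By \<open>\<Phi>_eq\<close>, \<Phi> behaves like \<open>s^(J - 2) * w^(4 - n)\<close>.
  For \<open>J = 1\<close> it tends to 0, for \<open>J = 2\<close> and \<open>n \<ge> 4\<close> it
  converges, the remaining cases with \<open>n \<le> 2 * J\<close> are contradictory, and the rest
  is the oscillator. The alternative at the end prepares the divergence of \<rho>.\<close>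

lemma v_converges:
  "2 * J \<le> n \<and> (\<exists>a. (v \<longlongrightarrow> a) (at_left T) \<and> (a = 1 \<or> (\<exists>\<eta>>0. ev (\<lambda>t. \<eta> \<le> \<Phi> t))))"
proof -
  obtain B where B: "0 < B" "(\<beta> \<longlongrightarrow> B) (at_left T)" by (rule \<beta>_lim)
  obtain m where m: "0 \<le> m" "((\<lambda>t. 1 / w t) \<longlongrightarrow> m) (at_left T)" by (rule inv_w_lim)
  obtain B0 where B0: "0 < B0" "ev (\<lambda>t. B0 \<le> \<beta> t)" by (rule \<beta>_bounded_below)
  \<comment> \<open>For \<open>a \<noteq> 1\<close> the bounds on the limit give
    \<open>L = a * (1 - a) > 0\<close>, so \<Phi> stays above \<open>L / 2\<close>.\<close>
  have limit: "\<exists>a. (v \<longlongrightarrow> a) (at_left T) \<and> a * (1 - a) = L \<and> (a = 1 \<or> (\<exists>\<eta>>0. ev (\<lambda>t. \<eta> \<le> \<Phi> t)))"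
    if L: "(\<Phi> \<longlongrightarrow> L) (at_left T)" for L
  proof -
    obtain a where a: "(v \<longlongrightarrow> a) (at_left T)" "a * (1 - a) = L" using v_converges_of_\<Phi>[OF L] .
    have "\<exists>\<eta>>0. ev (\<lambda>t. \<eta> \<le> \<Phi> t)" if "a \<noteq> 1"
    proof -
      have "0 < L" using v_limit_bounds[OF a(1)] that a(2) by (metis diff_gt_0_iff_gt half_gt_zero_iff
            less_le_trans mult_pos_pos order_less_le zero_less_one)
      then have "L / 2 < L" by simp
      then have "ev (\<lambda>t. L / 2 < \<Phi> t)" by (rule order_tendstoD(1)[OF L])
      then have "ev (\<lambda>t. L / 2 \<le> \<Phi> t)" by eventually_elim simp
      then show ?thesis using \<open>0 < L\<close> by (intro exI[of _ "L / 2"]) simp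
    qed
    then show ?thesis using a by blast
  qed
  have s_ge: "ev (\<lambda>t. Z \<le> s t)" for Z using s_lim unfolding filterlim_at_top by blast
  consider (one) "J = 1" | (two) "J = 2" "4 \<le> n" | (two_small) "J = 2" "n \<le> 3" | (three) "J = 3" "n = 3"
    | (big) "3 \<le> J" "4 \<le> n" "n \<le> 2 * J" | (osc) "3 \<le> J" "2 * J < n"
    using J n by linarith
  then show ?thesis
  proof cases
    case one
    have "(\<Phi> \<longlongrightarrow> 0) (at_left T)"
    proof -
      \<comment> \<open>In the three ranges \<Phi> is \<open>\<kappa> * \<beta>\<close> times
        \<open>Q\<close>, \<open>U\<close> and \<open>1 / (w^(n - 4) * s)\<close> respectively, each
        a factor tending to 0.\<close>
      consider "n = 2" | "n = 3" | "4 \<le> n" using n by linarith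
      then show ?thesis
      proof cases
        case 1
        have "((\<lambda>t. \<kappa> * \<beta> t * Q t) \<longlongrightarrow> \<kappa> * B * 0) (at_left T)" by (intro tendsto_intros B Q_lim)
        then have "((\<lambda>t. \<kappa> * \<beta> t * Q t) \<longlongrightarrow> 0) (at_left T)" by simp
        then show ?thesis
        proof (rule Lim_transform_eventually)
          show "ev (\<lambda>t. \<kappa> * \<beta> t * Q t = \<Phi> t)"
          proof (rule ev_at)
            fix t assume t: "0 < t" "t < T"
            have w4: "w t ^ 4 = Q t * s t * (w t)\<^sup>2"
              unfolding w_sq[OF t, symmetric] by (simp add: power4_eq_xxxx power2_eq_square)
            have "\<Phi> t * ((w t)\<^sup>2 * (s t)\<^sup>2) = \<kappa> * \<beta> t * s t * w t ^ 4"
              using \<Phi>_eq[OF t] unfolding 1 one by (simp add: mult_ac)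
            also have "\<dots> = \<kappa> * \<beta> t * Q t * ((w t)\<^sup>2 * (s t)\<^sup>2)"
              unfolding w4 by (simp add: power2_eq_square)
            finally show "\<kappa> * \<beta> t * Q t = \<Phi> t" using w_pos[OF t] s[OF t] by simp
          qed
        qed
      next
        case 2
        have "((\<lambda>t. \<kappa> * \<beta> t * U t) \<longlongrightarrow> \<kappa> * B * 0) (at_left T)" by (intro tendsto_intros B U_lim)
        then have "((\<lambda>t. \<kappa> * \<beta> t * U t) \<longlongrightarrow> 0) (at_left T)" by simp
        then show ?thesis
        proof (rule Lim_transform_eventually)
          show "ev (\<lambda>t. \<kappa> * \<beta> t * U t = \<Phi> t)"
          proof (rule ev_at)
            fix t assume t: "0 < t" "t < T"
            have "\<Phi> t * (w t ^ 3 * (s t)\<^sup>2) = \<kappa> * \<beta> t * s t * w t ^ 4"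
              using \<Phi>_eq[OF t] unfolding 2 one by (simp add: mult_ac)
            also have "\<dots> = \<kappa> * \<beta> t * U t * (w t ^ 3 * (s t)\<^sup>2)"
              by (simp add: w_def power_mult_distrib eval_nat_numeral mult_ac)
            finally show "\<kappa> * \<beta> t * U t = \<Phi> t" using w_pos[OF t] s[OF t] by simp
          qed
        qed
      next
        case 3
        have "((\<lambda>t. \<kappa> * \<beta> t * (1 / w t) ^ (n - 4) * (1 / s t)) \<longlongrightarrow> \<kappa> * B * m ^ (n - 4) * 0) (at_left T)"
          by (intro tendsto_intros B m inv_s_lim)
        then have "((\<lambda>t. \<kappa> * \<beta> t * (1 / w t) ^ (n - 4) * (1 / s t)) \<longlongrightarrow> 0) (at_left T)" by simp
        then show ?thesis
        proof (rule Lim_transform_eventually)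
          show "ev (\<lambda>t. \<kappa> * \<beta> t * (1 / w t) ^ (n - 4) * (1 / s t) = \<Phi> t)"
          proof (rule ev_at)
            fix t assume t: "0 < t" "t < T"
            have "w t ^ n = w t ^ (n - 4) * w t ^ 4" using 3 by (simp add: power_add[symmetric])
            then have "\<Phi> t * w t ^ (n - 4) * s t * (w t ^ 4 * s t) = \<kappa> * \<beta> t * (w t ^ 4 * s t)"
              using \<Phi>_eq[OF t] unfolding one by (simp add: power2_eq_square mult_ac)
            then show "\<kappa> * \<beta> t * (1 / w t) ^ (n - 4) * (1 / s t) = \<Phi> t"
              using w_pos[OF t] s[OF t] by (simp add: power_one_over field_simps)
          qed
        qed
      qed
    qed
    from limit[OF this] show ?thesis using one n by auto
  next
    case two
    have "(\<Phi> \<longlongrightarrow> \<kappa> * B * m ^ (n - 4)) (at_left T)"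
    proof (rule Lim_transform_eventually)
      show "((\<lambda>t. \<kappa> * \<beta> t * (1 / w t) ^ (n - 4)) \<longlongrightarrow> \<kappa> * B * m ^ (n - 4)) (at_left T)"
        by (intro tendsto_intros B m)
      show "ev (\<lambda>t. \<kappa> * \<beta> t * (1 / w t) ^ (n - 4) = \<Phi> t)"
      proof (rule ev_at)
        fix t assume t: "0 < t" "t < T"
        have "w t ^ n = w t ^ (n - 4) * w t ^ 4" using two by (simp add: power_add[symmetric])
        then have "\<Phi> t * w t ^ (n - 4) * (w t ^ 4 * (s t)\<^sup>2) = \<kappa> * \<beta> t * (w t ^ 4 * (s t)\<^sup>2)"
          using \<Phi>_eq[OF t] unfolding two by (simp add: mult_ac)
        then show "\<kappa> * \<beta> t * (1 / w t) ^ (n - 4) = \<Phi> t"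
          using w_pos[OF t] s[OF t] by (simp add: power_one_over field_simps)
      qed
    qed
    from limit[OF this] show ?thesis using two by auto
  next
    case two_small
    have \<Phi>w: "\<Phi> t = \<kappa> * \<beta> t * w t ^ (4 - n)" if t: "0 < t" "t < T" for t
    proof -
      have "w t ^ 4 = w t ^ (4 - n) * w t ^ n" using two_small by (simp add: power_add[symmetric])
      then have "\<Phi> t * (w t ^ n * (s t)\<^sup>2) = \<kappa> * \<beta> t * w t ^ (4 - n) * (w t ^ n * (s t)\<^sup>2)"
        using \<Phi>_eq[OF t] unfolding two_small by (simp add: mult_ac)
      then show ?thesis using w_pos[OF t] s[OF t] by simp
    qed
    \<comment> \<open>The exponent of \<open>w\<close> in \<Phi> is 1 or 2. If \<open>w\<close>
      tends to infinity, \<Phi> becomes large. If \<open>w\<close> has a finite limit, then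
      \<open>v\<close> has a limit below 1, and \<open>(ln w)' = (1 - v) / Q\<close> drives
      \<open>w\<close> to infinity after all.\<close>
    have False
    proof (cases "m = 0")
      case True
      define Z where "Z = max 1 (2 / (\<kappa> * B0))"
      have Z: "1 \<le> Z" "2 / (\<kappa> * B0) \<le> Z" by (auto simp: Z_def)
      have "ev (\<lambda>t. 1 / w t < 1 / Z)" using order_tendstoD(2)[OF m(2)] True Z by simp
      then have "ev (\<lambda>t. 2 \<le> \<Phi> t)" using B0(2) near
      proof eventually_elim
        case (elim t)
        then have wZ: "Z \<le> w t" using w_pos[of t] Z by (simp add: field_simps)
        have "Z ^ 1 \<le> w t ^ 1" using wZ by simp
        also have "w t ^ 1 \<le> w t ^ (4 - n)" using wZ Z two_small by (intro power_increasing) auto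
        finally have "2 / (\<kappa> * B0) \<le> w t ^ (4 - n)" using Z by simp
        then have "2 \<le> \<kappa> * B0 * w t ^ (4 - n)" using \<kappa> B0 by (simp add: field_simps)
        also have "\<dots> \<le> \<kappa> * \<beta> t * w t ^ (4 - n)"
          using elim \<kappa> w_pos[of t] by (intro mult_right_mono mult_left_mono) auto
        finally show ?case using \<Phi>w elim by simp
      qed
      then show False using \<Phi>_not_large by blast
    next
      case False
      then have m0: "0 < m" using m by simp
      have "((\<lambda>t. 1 / (1 / w t)) \<longlongrightarrow> 1 / m) (at_left T)" using m0 by (intro tendsto_intros m) auto
      then have w_lim: "(w \<longlongrightarrow> 1 / m) (at_left T)" by simp
      have "(\<Phi> \<longlongrightarrow> \<kappa> * B * (1 / m) ^ (4 - n)) (at_left T)"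
      proof (rule Lim_transform_eventually)
        show "((\<lambda>t. \<kappa> * \<beta> t * w t ^ (4 - n)) \<longlongrightarrow> \<kappa> * B * (1 / m) ^ (4 - n)) (at_left T)"
          by (intro tendsto_intros B w_lim)
        show "ev (\<lambda>t. \<kappa> * \<beta> t * w t ^ (4 - n) = \<Phi> t)" by (rule ev_at) (simp add: \<Phi>w)
      qed
      from limit[OF this] obtain a where a: "(v \<longlongrightarrow> a) (at_left T)" "a * (1 - a) = \<kappa> * B * (1 / m) ^ (4 - n)"
        by blast
      moreover have "0 < \<kappa> * B * (1 / m) ^ (4 - n)" using \<kappa> B m0 by simp
      ultimately have a1: "a < 1" using v_limit_bounds[OF a(1)] by (metis diff_self mult_zero_right order_less_le)
      have "filterlim (\<lambda>t. ln (w t)) at_top (at_left T)"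
      proof (rule filterlim_at_top_of_deriv_ge[OF ev_at[OF D_ln_w] ev_at[OF D_ln_s] _ _ ln_s_lim])
        have "a < (1 + a) / 2" using a1 by simp
        then have "ev (\<lambda>t. v t < (1 + a) / 2)" by (rule order_tendstoD(2)[OF a(1)])
        then show "ev (\<lambda>t. (1 - a) / 2 * (1 / Q t) \<le> \<mu> t)" using near
        proof eventually_elim
          case (elim t)
          have "(1 - a) / 2 / Q t \<le> (1 - v t) / Q t"
            using elim Q_pos[of t] by (intro divide_right_mono) (auto simp: field_simps)
          then show ?case by (simp add: \<mu>_def)
        qed
        show "0 < (1 - a) / 2" using a1 by simp
      qed
      moreover have "((\<lambda>t. ln (w t)) \<longlongrightarrow> ln (1 / m)) (at_left T)"
        using m0 by (intro tendsto_intros w_lim) auto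
      ultimately show False
        using not_tendsto_and_filterlim_at_infinity filterlim_at_top_imp_at_infinity
        by (metis trivial_limit_at_left_real)
    qed
    then show ?thesis ..
  next
    case three
    obtain c where c: "0 < c" "ev (\<lambda>t. c \<le> w t)" by (rule w_bounded_below)
    \<comment> \<open>Here \<open>\<Phi> = \<kappa> * \<beta> * w * s\<close> with \<beta> and
      \<open>w\<close> bounded below and \<open>s\<close> tending to infinity.\<close>
    have "ev (\<lambda>t. 2 \<le> \<Phi> t)"
      using c(2) B0(2) s_ge[of "2 / (\<kappa> * B0 * c)"] near
    proof eventually_elim
      case (elim t)
      then have t: "0 < t" "t < T" by auto
      have "\<Phi> t * (w t ^ 3 * (s t)\<^sup>2) = \<kappa> * \<beta> t * w t * s t * (w t ^ 3 * (s t)\<^sup>2)"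
        using \<Phi>_eq[OF t] unfolding three by (simp add: eval_nat_numeral mult_ac)
      then have "\<Phi> t = \<kappa> * \<beta> t * w t * s t" using w_pos[OF t] s[OF t] by simp
      moreover have "\<kappa> * B0 * c * s t \<le> \<kappa> * \<beta> t * w t * s t"
        using elim \<kappa> B0 c s[OF t] by (intro mult_right_mono mult_mono) auto
      moreover have "2 \<le> \<kappa> * B0 * c * s t" using elim \<kappa> B0 c by (simp add: field_simps)
      ultimately show ?case by simp
    qed
    then show ?thesis using \<Phi>_not_large by blast
  next
    case big
    \<comment> \<open>Squaring permits \<open>w\<^sup>2 = Q * s\<close> and leaves
      \<open>\<Phi>\<^sup>2 = (\<kappa> * \<beta>)\<^sup>2 * s^(2 * J - n) / Q^(n - 4)\<close>. The
      exponents are nonnegative and not both 0, while \<open>s\<close> tends to infinity and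
      \<open>Q\<close> to 0.\<close>
    have \<Phi>2: "(\<Phi> t)\<^sup>2 * Q t ^ (n - 4) = (\<kappa> * \<beta> t)\<^sup>2 * s t ^ (2 * J - n)" if t: "0 < t" "t < T" for t
    proof -
      have "n = (n - 4) + 4" "J = (J - 2) + 2" using big by linarith+
      then have "w t ^ n = w t ^ (n - 4) * w t ^ 4" "s t ^ J = s t ^ (J - 2) * (s t)\<^sup>2"
        by (metis power_add)+
      then have "\<Phi> t * w t ^ (n - 4) * (w t ^ 4 * (s t)\<^sup>2) = \<kappa> * \<beta> t * s t ^ (J - 2) * (w t ^ 4 * (s t)\<^sup>2)"
        using \<Phi>_eq[OF t] by (simp add: mult_ac)
      then have "\<Phi> t * w t ^ (n - 4) = \<kappa> * \<beta> t * s t ^ (J - 2)" using w_pos[OF t] s[OF t] by simp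
      then have "(\<Phi> t * w t ^ (n - 4))\<^sup>2 = (\<kappa> * \<beta> t * s t ^ (J - 2))\<^sup>2" by simp
      then have "(\<Phi> t)\<^sup>2 * (w t ^ (n - 4))\<^sup>2 = (\<kappa> * \<beta> t)\<^sup>2 * (s t ^ (J - 2))\<^sup>2" by (simp only: power_mult_distrib)
      moreover have "(w t ^ (n - 4))\<^sup>2 = Q t ^ (n - 4) * s t ^ (n - 4)"
        using w_sq[OF t] by (metis power_even_eq power_mult power_mult_distrib mult.commute)
      moreover have "(s t ^ (J - 2))\<^sup>2 = s t ^ (2 * J - n) * s t ^ (n - 4)"
        using big by (simp add: power_add[symmetric] power_mult[symmetric] algebra_simps)
      ultimately show ?thesis using s[OF t] by simp
    qed
    define Z where "Z = max 1 (4 / (\<kappa> * B0)\<^sup>2)"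
    have Z: "1 \<le> Z" "4 / (\<kappa> * B0)\<^sup>2 \<le> Z" by (auto simp: Z_def)
    have "ev (\<lambda>t. Q t < 1 / Z)" using Z by (intro Q_small) simp
    then have large: "ev (\<lambda>t. 2 \<le> \<Phi> t)" if "4 < n \<or> n < 2 * J"
      using B0(2) s_ge[of Z] near
    proof eventually_elim
      case (elim t)
      then have t: "0 < t" "t < T" by auto
      have Q1: "Q t \<le> 1" using elim Z by (smt (verit) divide_le_eq_1)
      have s1: "1 \<le> s t" using elim Z by simp
      have "Z * Q t ^ (n - 4) \<le> s t ^ (2 * J - n)"
      proof (cases "4 < n")
        case True
        have "Q t ^ (n - 4) \<le> Q t ^ 1" using True Q1 Q_pos[OF t] by (intro power_decreasing) auto
        then have "Z * Q t ^ (n - 4) \<le> Z * Q t" using Z by simp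
        also have "\<dots> \<le> 1" using elim Z by (simp add: field_simps)
        also have "1 \<le> s t ^ (2 * J - n)" using s1 by (rule one_le_power)
        finally show ?thesis .
      next
        case False
        then have n4: "n = 4" "1 \<le> 2 * J - n" using big that by auto
        have "Z * Q t ^ (n - 4) = Z" using n4 by simp
        also have "\<dots> \<le> s t ^ 1" using elim by simp
        also have "\<dots> \<le> s t ^ (2 * J - n)" using n4 s1 by (intro power_increasing) auto
        finally show ?thesis .
      qed
      then have "(\<kappa> * B0)\<^sup>2 * (Z * Q t ^ (n - 4)) \<le> (\<kappa> * \<beta> t)\<^sup>2 * s t ^ (2 * J - n)"
        using elim \<kappa> B0 s[OF t] Z Q_pos[OF t] by (intro mult_mono power_mono) auto
      then have "(\<kappa> * B0)\<^sup>2 * Z * Q t ^ (n - 4) \<le> (\<Phi> t)\<^sup>2 * Q t ^ (n - 4)" using \<Phi>2[OF t] by (simp add: mult_ac)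
      then have "(\<kappa> * B0)\<^sup>2 * Z \<le> (\<Phi> t)\<^sup>2" using Q_pos[OF t] by simp
      moreover have "4 \<le> (\<kappa> * B0)\<^sup>2 * Z" using Z \<kappa> B0 by (simp add: field_simps)
      ultimately have "2\<^sup>2 \<le> (\<Phi> t)\<^sup>2" by simp
      then show ?case using \<Phi>_pos[OF t] by (rule power2_le_imp_le[OF _ less_imp_le])
    qed
    have "4 < n \<or> n < 2 * J" using big by auto
    then show ?thesis using large \<Phi>_not_large by blast
  next
    case osc
    obtain a \<eta> where "(v \<longlongrightarrow> a) (at_left T)" "0 < \<eta>" "ev (\<lambda>t. \<eta> \<le> \<Phi> t)"
      using v_converges_oscillator[OF osc] .
    then show ?thesis using osc by auto
  qed
qed

section \<open>Divergence of \<rho> and of the \<open>\<lambda>\<^sub>i\<close> with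
  \<open>i > J\<close>\<close>

text \<open>If \<open>v\<close> tends to 1, then \<open>Q * \<rho>' / \<rho>\<close> tends to
  \<open>n - (n - J) = J > 0\<close>, so \<open>ln \<rho>\<close> grows at least linearly in
  \<open>ln s\<close>. Otherwise \<open>\<Phi> \<ge> \<eta>\<close> reads
  \<open>\<rho> \<ge> \<eta> / (\<kappa> * Q\<^sup>2)\<close>.\<close>

lemma \<rho>_lim: "filterlim \<rho> at_top (at_left T)"
proof -
  obtain a where a: "(v \<longlongrightarrow> a) (at_left T)" "a = 1 \<or> (\<exists>\<eta>>0. ev (\<lambda>t. \<eta> \<le> \<Phi> t))"
    using v_converges by blast
  show ?thesis
  proof (cases "a = 1")
    case True
    have "filterlim (\<lambda>t. ln (\<rho> t)) at_top (at_left T)"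
    proof (rule filterlim_at_top_of_deriv_ge[OF _ ev_at[OF D_ln_s] _ _ ln_s_lim, where c = "1 / 2"])
      show "ev (\<lambda>t. ((\<lambda>t. ln (\<rho> t)) has_real_derivative (n * v t - (real n - real J) + \<epsilon> t) / Q t) (at t))"
      proof (rule ev_at)
        fix t assume t: "0 < t" "t < T"
        show "((\<lambda>t. ln (\<rho> t)) has_real_derivative (n * v t - (real n - real J) + \<epsilon> t) / Q t) (at t)"
          using \<rho>[OF t] by (auto intro!: derivative_eq_intros D_\<rho>'[OF t])
      qed
      have "((\<lambda>t. n * v t - (real n - real J) + \<epsilon> t) \<longlongrightarrow> n * a - (real n - real J) + 0) (at_left T)"
        by (intro tendsto_intros a \<epsilon>_lim)
      then have "ev (\<lambda>t. 1 / 2 < n * v t - (real n - real J) + \<epsilon> t)"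
        by (rule order_tendstoD(1)) (use True J in simp)
      then show "ev (\<lambda>t. 1 / 2 * (1 / Q t) \<le> (n * v t - (real n - real J) + \<epsilon> t) / Q t)"
        using near
      proof eventually_elim
        case (elim t)
        then have "1 / 2 / Q t \<le> (n * v t - (real n - real J) + \<epsilon> t) / Q t"
          using Q_pos[of t] by (intro divide_right_mono) auto
        then show ?case by simp
      qed
      show "0 < (1 / 2 :: real)" by simp
    qed
    then have "filterlim (\<lambda>t. exp (ln (\<rho> t))) at_top (at_left T)"
      by (rule filterlim_compose[OF exp_at_top])
    then show ?thesis
      by (rule filterlim_at_top_mono) (rule ev_at, simp add: \<rho>)
  next
    case False
    then obtain \<eta> where \<eta>: "0 < \<eta>" "ev (\<lambda>t. \<eta> \<le> \<Phi> t)" using a by blast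
    have "filterlim Q (at_right 0) (at_left T)"
      using Q_lim ev_at[of "\<lambda>t. 0 < Q t", OF Q_pos] by (auto simp: filterlim_at elim: eventually_mono)
    then have "filterlim (\<lambda>t. inverse (Q t)) at_top (at_left T)"
      by (rule filterlim_compose[OF filterlim_inverse_at_top_right])
    moreover have "0 < \<eta> / \<kappa>" using \<eta> \<kappa> by simp
    ultimately have "filterlim (\<lambda>t. \<eta> / \<kappa> * inverse (Q t)) at_top (at_left T)"
      by (intro filterlim_tendsto_pos_mult_at_top[OF tendsto_const])
    then show ?thesis
    proof (rule filterlim_at_top_mono)
      show "ev (\<lambda>t. \<eta> / \<kappa> * inverse (Q t) \<le> \<rho> t)"
        using \<eta>(2) near Q_small[OF zero_less_one]
      proof eventually_elim
        case (elim t)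
        then have t: "0 < t" "t < T" by auto
        have "(Q t)\<^sup>2 \<le> Q t" using elim Q_pos[OF t] by (simp add: power2_eq_square mult_left_le)
        then have "\<kappa> * \<rho> t * (Q t)\<^sup>2 \<le> \<kappa> * \<rho> t * Q t" using \<kappa> \<rho>[OF t] by (intro mult_left_mono) auto
        then have "\<eta> \<le> \<kappa> * \<rho> t * Q t" using elim by (simp add: \<Phi>_def)
        then show ?case using \<kappa> Q_pos[OF t] by (simp add: field_simps)
      qed
    qed
  qed
qed

text \<open>If \<open>\<mu>\<close> did not tend to infinity, it would be bounded above, hence so would \<open>w\<close>; then \<open>\<rho>\<close> is at least
  \<open>const / (T - t)\<close>, and \<open>w'' = h w\<close> forces \<open>w' = \<mu> w\<close> to infinity.\<close>

lemma \<mu>_lim: "filterlim \<mu> at_top (at_left T)"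
proof -
  have "ev (\<lambda>t. K \<le> \<mu> t)" if K: "0 < K" for K
  proof -
    \<comment> \<open>The threshold makes \<open>\<mu>' = h - K\<^sup>2\<close> positive where
      \<open>\<mu> = K\<close>, so \<mu> crosses \<open>K\<close> only upwards.\<close>
    have "ev (\<lambda>t. (K\<^sup>2 + \<omega>\<^sup>2) / \<kappa> < \<rho> t)" using \<rho>_lim unfolding filterlim_at_top_dense by blast
    then have "ev (\<lambda>t. \<mu> t = K \<longrightarrow> 0 < - (\<mu> t)\<^sup>2 + h t)"
      by eventually_elim (use \<kappa> in \<open>auto simp: h_def field_simps\<close>)
    from eventually_one_side[OF ev_at[OF D_\<mu>] this]
    consider "ev (\<lambda>t. K \<le> \<mu> t)" | "ev (\<lambda>t. \<mu> t \<le> K)" by blast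
    then show ?thesis
    proof cases
      case 2
      have "ev (\<lambda>t. ((\<lambda>t. K * t - ln (w t)) has_real_derivative K - \<mu> t) (at t) \<and> 0 \<le> K - \<mu> t)"
        using 2 near
        by eventually_elim (auto intro!: DERIV_diff DERIV_cmult_Id D_ln_w)
      from nonneg_deriv_at_left(1)[OF this] obtain d where d: "ev (\<lambda>t. d \<le> K * t - ln (w t))" by blast
      define W where "W = exp (K * T - d)"
      have w_le: "ev (\<lambda>t. w t \<le> W)"
        using d near
      proof eventually_elim
        case (elim t)
        then have "K * t \<le> K * T" using K by simp
        then have "ln (w t) \<le> K * T - d" using elim by simp
        then have "exp (ln (w t)) \<le> W" by (simp only: W_def exp_le_cancel_iff)
        then show ?case using w_pos[of t] elim by simp
      qed
      obtain c where c: "0 < c" "ev (\<lambda>t. c \<le> w t)" by (rule w_bounded_below)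
      obtain B0 where B0: "0 < B0" "ev (\<lambda>t. B0 \<le> \<beta> t)" by (rule \<beta>_bounded_below)
      obtain C where C: "0 < C" "ev (\<lambda>t. - C \<le> l t * U t)" by (rule lU_bounded)
      \<comment> \<open>Since \<open>U' = l * U \<ge> - C\<close> and \<open>U\<close> tends to 0 at
        \<open>T\<close>, one gets \<open>U \<le> C * (T - t)\<close>.\<close>
      have "ev (\<lambda>t. ((\<lambda>t. U t + C * t) has_real_derivative l t * U t + C) (at t) \<and> 0 \<le> l t * U t + C)"
        using C(2) near
        by eventually_elim (auto intro!: DERIV_add DERIV_cmult_Id D_U)
      moreover have "((\<lambda>t. U t + C * t) \<longlongrightarrow> 0 + C * T) (at_left T)" by (intro tendsto_intros U_lim)
      ultimately have "ev (\<lambda>t. U t + C * t \<le> 0 + C * T)" by (rule nonneg_deriv_at_left(3))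
      then have U_le: "ev (\<lambda>t. U t \<le> C * (T - t))" by eventually_elim (simp add: algebra_simps)
      have W: "0 < W" by (simp add: W_def)
      \<comment> \<open>From \<open>\<rho> = \<beta> / (U^J * w^(n - J))\<close>, where
        \<open>U^J \<le> U\<close> because \<open>U < 1\<close> and
        \<open>J \<ge> 1\<close>.\<close>
      define e where "e = \<kappa> * B0 / (C * W ^ (n - J))"
      have e: "0 < e" using \<kappa> B0 C W by (simp add: e_def)
      have U1: "ev (\<lambda>t. U t < 1)" using order_tendstoD(2)[OF U_lim] by simp
      have \<rho>_ge: "ev (\<lambda>t. e / (T - t) \<le> \<kappa> * \<rho> t)"
        using U_le B0(2) w_le U1 near
      proof eventually_elim
        case (elim t)
        then have t: "0 < t" "t < T" by auto
        have "U t ^ J \<le> U t ^ 1" using U[OF t] elim J by (intro power_decreasing) auto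
        then have "U t ^ J * w t ^ (n - J) \<le> (C * (T - t)) * W ^ (n - J)"
          using elim U[OF t] w_pos[OF t] C by (intro mult_mono power_mono) auto
        moreover have "0 < U t ^ J * w t ^ (n - J)" using U[OF t] w_pos[OF t] by simp
        ultimately have "B0 / ((C * (T - t)) * W ^ (n - J)) \<le> \<beta> t / (U t ^ J * w t ^ (n - J))"
          using elim B0 by (intro frac_le) auto
        then have "B0 / ((C * (T - t)) * W ^ (n - J)) \<le> \<rho> t" using \<rho>_eq[OF t] by simp
        then have "\<kappa> * (B0 / ((C * (T - t)) * W ^ (n - J))) \<le> \<kappa> * \<rho> t" using \<kappa> by (intro mult_left_mono) auto
        then show ?case by (simp add: e_def mult_ac)
      qed
      \<comment> \<open>Large \<rho> gives \<open>h \<ge> \<kappa> * \<rho> / 2\<close>; hence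
        \<open>(\<mu> * w)' = h * w\<close> exceeds a multiple of \<open>1 / (T - t)\<close>, whose
        primitive \<open>- ln (T - t)\<close> diverges.\<close>
      have h_ge: "ev (\<lambda>t. \<omega>\<^sup>2 * 2 / \<kappa> < \<rho> t)" using \<rho>_lim unfolding filterlim_at_top_dense by blast
      have "filterlim (\<lambda>t. \<mu> t * w t) at_top (at_left T)"
      proof (rule filterlim_at_top_of_deriv_ge[OF ev_at[OF D_\<mu>w]])
        show "ev (\<lambda>t. ((\<lambda>t. - ln (T - t)) has_real_derivative 1 / (T - t)) (at t))"
          using near by eventually_elim (auto intro!: derivative_eq_intros)
        show "ev (\<lambda>t. (e * c / 2) * (1 / (T - t)) \<le> h t * w t)"
          using h_ge \<rho>_ge c(2) near
        proof eventually_elim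
          case (elim t)
          have "\<omega>\<^sup>2 * 2 < \<kappa> * \<rho> t" using elim \<kappa> by (simp add: field_simps)
          then have "\<kappa> * \<rho> t / 2 \<le> h t" by (simp add: h_def)
          moreover have "e / (T - t) / 2 \<le> \<kappa> * \<rho> t / 2" using elim by (intro divide_right_mono) auto
          ultimately have "e / (T - t) / 2 \<le> h t" by (rule order.trans[rotated])
          moreover have "0 \<le> e / (T - t) / 2" using elim e by simp
          ultimately have "e / (T - t) / 2 * c \<le> h t * w t" using elim c by (intro mult_mono) auto
          then show ?case by (simp add: mult_ac)
        qed
        show "0 < e * c / 2" using e c by simp
        have "filterlim (\<lambda>t. T - t) (at_right 0) (at_left T)"
        proof -
          have "((\<lambda>t. T - t) \<longlongrightarrow> T - T) (at_left T)" by (intro tendsto_intros)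
          then show ?thesis using near by (auto simp: filterlim_at elim: eventually_mono)
        qed
        then have "filterlim (\<lambda>t. ln (T - t)) at_bot (at_left T)"
          by (rule filterlim_compose[OF ln_at_0])
        then show "filterlim (\<lambda>t. - ln (T - t)) at_top (at_left T)"
          by (simp add: filterlim_uminus_at_bot)
      qed
      then have "ev (\<lambda>t. K * W < \<mu> t * w t)" unfolding filterlim_at_top_dense by blast
      then have "ev (\<lambda>t. False)" using 2 w_le near
      proof eventually_elim
        case (elim t)
        have "\<mu> t * w t \<le> K * w t" using elim w_pos[of t] by (intro mult_right_mono) auto
        also have "\<dots> \<le> K * W" using elim K by simp
        finally show ?case using elim by simp
      qed
      then show ?thesis by simp
    qed
  qed
  then show ?thesis unfolding filterlim_at_top_gt[where c = 0] by blast
qed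

text \<open>The function falls short of \<open>\<mu> = l + 1 / Q\<close> by
  \<open>b i / (U\<^sup>2 * s * (s + b i)) \<le> b i / w\<^sup>2\<close>, which is bounded.\<close>

lemma upper_lim:
  assumes "i \<in> {J<..n}"
  shows "filterlim (\<lambda>t. l t + 1 / ((U t)\<^sup>2 * (s t + b i))) at_top (at_left T)"
proof -
  obtain c where c: "0 < c" "ev (\<lambda>t. c \<le> w t)" by (rule w_bounded_below)
  have "filterlim (\<lambda>t. - (b i / c\<^sup>2) + \<mu> t) at_top (at_left T)"
    by (rule filterlim_tendsto_add_at_top[OF tendsto_const \<mu>_lim])
  then show ?thesis
  proof (rule filterlim_at_top_mono)
    show "ev (\<lambda>t. - (b i / c\<^sup>2) + \<mu> t \<le> l t + 1 / ((U t)\<^sup>2 * (s t + b i)))"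
      using c(2) near
    proof eventually_elim
      case (elim t)
      then have t: "0 < t" "t < T" by auto
      note pos = U[OF t] s[OF t] b[OF assms] Q_pos[OF t]
      have "\<mu> t = l t + 1 / Q t" using pos by (simp add: \<mu>_def v_def field_simps)
      moreover have "1 / Q t - 1 / ((U t)\<^sup>2 * (s t + b i)) = b i / ((U t)\<^sup>2 * s t * (s t + b i))"
      proof -
        have d: "s t + b i \<noteq> 0" using pos by simp
        have 1: "1 / Q t = (s t + b i) / ((U t)\<^sup>2 * s t * (s t + b i))" using d pos by (simp add: Q_def)
        have 2: "1 / ((U t)\<^sup>2 * (s t + b i)) = s t / ((U t)\<^sup>2 * s t * (s t + b i))"
          using pos by simp
        show ?thesis unfolding 1 2 diff_divide_distrib[symmetric] by simp
      qed
      moreover have "b i / ((U t)\<^sup>2 * s t * (s t + b i)) \<le> b i / (w t)\<^sup>2"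
        using pos by (intro divide_left_mono) (auto simp: w_def power2_eq_square mult_left_mono)
      moreover have "b i / (w t)\<^sup>2 \<le> b i / c\<^sup>2"
        using elim c pos by (intro divide_left_mono power_mono) auto
      ultimately show ?case by linarith
    qed
  qed
qed

end

subsection \<open>Reduction to the profile\<close>

text \<open>Near \<open>t\<close> the half-open interval agrees with a compact one
  \<open>{a..c}\<close>, \<open>t < c < T\<close>, on which the fundamental theorem of calculus
  applies.\<close>

lemma integral_has_real_derivative_Ico:
  fixes g :: "real \<Rightarrow> real"
  assumes g: "continuous_on {a..<T} g" and t: "t \<in> {a..<T}"
  shows "((\<lambda>x. integral {a..x} g) has_real_derivative g t) (at t within {a..<T})"
proof -
  define c where "c = (t + T) / 2"
  have c: "t < c" "c < T" using t by (auto simp: c_def)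
  have "((\<lambda>x. integral {a..x} g) has_real_derivative g t) (at t within {a..c})"
    by (rule integral_has_real_derivative) (use c t in \<open>auto intro: continuous_on_subset[OF g]\<close>)
  moreover have "at t within {a..c} = at t within {a..<T}"
    by (rule at_within_nhd[of _ "{..<c}"]) (use c in auto)
  ultimately show ?thesis by simp
qed

lemma constant_on_Ico:
  fixes f :: "real \<Rightarrow> real"
  assumes "\<And>t. t \<in> {a..<T} \<Longrightarrow> (f has_real_derivative 0) (at t within {a..<T})" "t \<in> {a..<T}"
  shows "f t = f a"
proof -
  have "\<exists>c. \<forall>x\<in>{a..<T}. f x = c"
    by (rule has_field_derivative_zero_constant) (use assms in auto)
  then show ?thesis using assms(2) by force
qed

text \<open>Integrating factor. In the theorem it shows that \<rho> and the differences
  \<open>\<lambda>\<^sub>i - \<lambda>\<^sub>1\<close> keep their signs.\<close>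

lemma linear_ode_solution:
  fixes f g :: "real \<Rightarrow> real"
  assumes g: "continuous_on {a..<T} g"
    and f: "\<And>t. t \<in> {a..<T} \<Longrightarrow> (f has_real_derivative g t * f t) (at t within {a..<T})"
    and t: "t \<in> {a..<T}"
  shows "f t = f a * exp (integral {a..t} g)"
proof -
  have "f t * exp (- integral {a..t} g) = f a * exp (- integral {a..a} g)"
  proof (rule constant_on_Ico[OF _ t])
    fix x assume x: "x \<in> {a..<T}"
    show "((\<lambda>t. f t * exp (- integral {a..t} g)) has_real_derivative 0) (at x within {a..<T})"
      by (rule derivative_eq_intros f[OF x] integral_has_real_derivative_Ico[OF g x] refl | simp)+
  qed
  then show ?thesis by (simp add: exp_minus field_simps)
qed

lemma deriv_le_imp_le_linear:
  fixes f f' :: "real \<Rightarrow> real"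
  assumes f: "\<And>t. t \<in> {a..<T} \<Longrightarrow> (f has_real_derivative f' t) (at t within {a..<T})"
    and le: "\<And>t. t \<in> {a..<T} \<Longrightarrow> f' t \<le> K" and t: "t \<in> {a..<T}"
  shows "f t \<le> f a + K * (t - a)"
proof -
  have "f t - K * t \<le> f a - K * a"
  proof (rule DERIV_nonpos_imp_decreasing_open[where f = "\<lambda>x. f x - K * x"])
    show "a \<le> t" using t by simp
    have "continuous_on {a..<T} f"
      using f by (rule DERIV_continuous_on)
    then show "continuous_on {a..t} (\<lambda>x. f x - K * x)"
      by (intro continuous_intros) (use t in \<open>auto elim!: continuous_on_subset\<close>)
    fix x assume x: "a < x" "x < t"
    then have "at x within {a..<T} = at x" using t by (intro at_within_interior) auto
    then have "(f has_real_derivative f' x) (at x)" using f[of x] x t by simp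
    then show "\<exists>y. ((\<lambda>x. f x - K * x) has_real_derivative y) (at x) \<and> y \<le> 0"
      using le[of x] x t by (intro exI[of _ "f' x - K"]) (auto intro!: derivative_eq_intros)
  qed
  then show ?thesis by (simp add: algebra_simps)
qed

theorem theorem1p1:
  fixes n J :: nat and k cb rho0 tB :: real
    and lam0 :: "nat \<Rightarrow> real"
    and lam :: "nat \<Rightarrow> real \<Rightarrow> real" and rho :: "real \<Rightarrow> real"
  assumes n: "n \<ge> 2"
    and k: "k > 0" and cb: "cb > 0" and rho0: "rho0 > 0"
    and J: "1 \<le> J" "J \<le> n"
    and eq: "\<forall>i\<in>{1..J}. lam0 i = lam0 1"
    and gap: "\<forall>i. J < i \<and> i \<le> n \<longrightarrow> lam0 1 < lam0 i"
    and sorted: "\<forall>i j. J < i \<and> i \<le> j \<and> j \<le> n \<longrightarrow> lam0 i \<le> lam0 j"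
    and sol: "REP_solution n k cb rho0 lam0 tB lam rho"
    and maximal: "\<not> (\<exists>T > tB. \<exists>lam' rho'. REP_solution n k cb rho0 lam0 T lam' rho')"
    and finite_tB: "0 < tB"
  shows "2 * J \<le> n
    \<and> tB \<ge> 1 / sqrt (k * cb / n) * arctan (lam0 1 / sqrt (k * cb / n))
             + pi / (2 * sqrt (k * cb / n))
    \<and> (\<forall>i\<in>{1..J}. filterlim (lam i) at_bot (at_left tB))
    \<and> (\<forall>i. J < i \<and> i \<le> n \<longrightarrow> filterlim (lam i) at_top (at_left tB))
    \<and> filterlim rho at_top (at_left tB)
    \<and> (\<exists>p q. 0 \<le> q \<and> q \<le> p \<and>
        ((\<lambda>t. lam 1 t * exp (integral {0..t} (\<lambda>s. lam 1 s + lam n s))) \<longlongrightarrow> - p) (at_left tB) \<and>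
        ((\<lambda>t. lam n t * exp (integral {0..t} (\<lambda>s. lam 1 s + lam n s))) \<longlongrightarrow> q) (at_left tB))"
proof -
  define \<kappa> where "\<kappa> = k / real n"
  define \<omega> where "\<omega> = sqrt (k * cb / n)"
  have \<kappa>: "0 < \<kappa>" using k n by (simp add: \<kappa>_def)
  have \<omega>: "0 < \<omega>" using k cb n by (simp add: \<omega>_def)
  have \<omega>2: "\<omega>\<^sup>2 = \<kappa> * cb" using k cb n by (simp add: \<omega>_def \<kappa>_def)
  have init: "rho 0 = rho0" "\<And>i. i \<in> {1..n} \<Longrightarrow> lam i 0 = lam0 i"
    using sol by (auto simp: REP_solution_def)
  have D_lam: "(lam i has_real_derivative - (lam i t)\<^sup>2 + (\<kappa> * rho t - \<omega>\<^sup>2)) (at t within {0..<tB})"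
    if "t \<in> {0..<tB}" "i \<in> {1..n}" for t i
  proof -
    have "k / real n * (rho t - cb) = \<kappa> * rho t - \<omega>\<^sup>2" unfolding \<omega>2 \<kappa>_def right_diff_distrib ..
    moreover have "(lam i has_real_derivative - (lam i t)\<^sup>2 + k / real n * (rho t - cb)) (at t within {0..<tB})"
      using sol that unfolding REP_solution_def by blast
    ultimately show ?thesis by (simp only:)
  qed
  have D_rho: "(rho has_real_derivative (- (\<Sum>i=1..n. lam i t)) * rho t) (at t within {0..<tB})"
    if "t \<in> {0..<tB}" for t
    using sol that by (simp add: REP_solution_def mult.commute)
  have interior: "at t within {0..<tB} = at t" if "0 < t" "t < tB" for t
    using that by (intro at_within_interior) auto
  have cont: "continuous_on {0..<tB} (lam i)" if "i \<in> {1..n}" for i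
    using D_lam[OF _ that] by (rule DERIV_continuous_on)
  have one: "1 \<in> {1..n}" using n by simp
  have "rho t = rho 0 * exp (integral {0..t} (\<lambda>t. - (\<Sum>i=1..n. lam i t)))" if "t \<in> {0..<tB}" for t
    by (rule linear_ode_solution[OF _ D_rho that]) (intro continuous_intros cont)
  then have rho_pos: "0 < rho t" if "t \<in> {0..<tB}" for t using that rho0 init by simp
  define a where "a i = lam0 i - lam0 1" for i
  \<comment> \<open>The forcing is common to all \<open>\<lambda>\<^sub>i\<close> and drops out of
    the differences, which satisfy a linear equation. They vanish for \<open>i \<le> J\<close> and
    stay positive for \<open>i > J\<close>, so \<open>\<lambda>\<^sub>1\<close> remains the
    smallest.\<close>
  define e where "e i t = lam i t - lam 1 t" for i t
  have D_e: "(e i has_real_derivative - (lam 1 t + lam i t) * e i t) (at t within {0..<tB})"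
    if "t \<in> {0..<tB}" "i \<in> {1..n}" for t i
    unfolding e_def[abs_def] using D_lam[OF that] D_lam[OF that(1) one]
    by (auto intro!: derivative_eq_intros) (simp add: algebra_simps power2_eq_square)
  have e_exp: "e i t = a i * exp (integral {0..t} (\<lambda>t. - (lam 1 t + lam i t)))"
    if "t \<in> {0..<tB}" "i \<in> {1..n}" for t i
  proof -
    have "e i t = e i 0 * exp (integral {0..t} (\<lambda>t. - (lam 1 t + lam i t)))"
      by (rule linear_ode_solution[OF _ D_e[OF _ that(2)] that(1)]) (intro continuous_intros cont one that(2))
    then show ?thesis using init(2)[OF that(2)] init(2)[OF one] by (simp add: e_def a_def)
  qed
  have e_low: "lam i t = lam 1 t" if "t \<in> {0..<tB}" "i \<in> {1..J}" for t i
  proof -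
    have "lam0 i = lam0 1" using eq that(2) by blast
    moreover have "i \<in> {1..n}" using that(2) J by auto
    note e_exp[OF that(1) this]
    ultimately show ?thesis by (simp add: e_def a_def)
  qed
  have a_pos: "0 < a i" if "i \<in> {J<..n}" for i using gap that by (simp add: a_def)
  have e_pos: "0 < e i t" if "t \<in> {0..<tB}" "i \<in> {J<..n}" for t i
  proof -
    have "i \<in> {1..n}" using that(2) J by auto
    from e_exp[OF that(1) this] show ?thesis using a_pos[OF that(2)] by simp
  qed
  have lam_ge: "lam 1 t \<le> lam i t" if "t \<in> {0..<tB}" "i \<in> {1..n}" for t i
    using e_low[OF that(1), of i] e_pos[OF that(1), of i] that(2) by (cases "i \<le> J") (auto simp: e_def)
  define U where "U t = exp (integral {0..t} (lam 1))" for t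
  have U: "0 < U t" for t by (simp add: U_def)
  have D_U: "(U has_real_derivative lam 1 t * U t) (at t within {0..<tB})" if "t \<in> {0..<tB}" for t
    unfolding U_def[abs_def]
    by (rule derivative_eq_intros integral_has_real_derivative_Ico[OF cont[OF one] that] refl | simp)+
  have "(\<exists>M. eventually (\<lambda>t. - M \<le> lam 1 t) (at_left tB)) \<or>
    (filterlim (lam 1) at_bot (at_left tB) \<and> (U \<longlongrightarrow> 0) (at_left tB) \<and>
     (\<forall>t. 0 < t \<longrightarrow> t < tB \<longrightarrow> arctan (lam 1 t / \<omega>) + \<omega> * t \<le> - pi / 2 + \<omega> * tB))"
  proof (rule riccati_dichotomy[OF \<omega> finite_tB])
    fix t assume t: "0 < t" "t < tB"
    then show "(lam 1 has_real_derivative - (lam 1 t)\<^sup>2 + (\<kappa> * rho t - \<omega>\<^sup>2)) (at t)"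
      using D_lam[of t 1] one interior[OF t] by auto
    show "(U has_real_derivative lam 1 t * U t) (at t)" using D_U[of t] interior[OF t] t by simp
    show "- (lam 1 t)\<^sup>2 - \<omega>\<^sup>2 \<le> - (lam 1 t)\<^sup>2 + (\<kappa> * rho t - \<omega>\<^sup>2)"
      using \<kappa> rho_pos[of t] t by simp
    show "0 < U t" by (rule U)
  qed
  \<comment> \<open>A lower bound on \<open>\<lambda>\<^sub>1\<close> bounds every
    \<open>\<lambda>\<^sub>i\<close> below, hence \<rho> above since \<open>(ln \<rho>)'\<close> is
    minus their sum, hence every \<open>\<lambda>\<^sub>i\<close> above since
    \<open>\<lambda>\<^sub>i' \<le> \<kappa> * \<rho>\<close>. A bounded solution extends, against
    maximality.\<close>
  moreover have "\<not> (\<exists>M. eventually (\<lambda>t. - M \<le> lam 1 t) (at_left tB))"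
  proof
    assume "\<exists>M. eventually (\<lambda>t. - M \<le> lam 1 t) (at_left tB)"
    then obtain M t0 where M: "t0 < tB" "\<And>t. t0 < t \<Longrightarrow> t < tB \<Longrightarrow> - M \<le> lam 1 t"
      by (auto simp: eventually_at_left_field)
    have "compact (lam 1 ` {0..t0})"
      by (intro compact_continuous_image continuous_on_subset[OF cont[OF one]]) (use M in auto)
    then have "bounded (lam 1 ` {0..t0})" by (rule compact_imp_bounded)
    then have "\<exists>M'. \<forall>t\<in>{0..t0}. \<bar>lam 1 t\<bar> \<le> M'" by (auto simp: bounded_iff)
    then obtain M' where M': "\<And>t. t \<in> {0..t0} \<Longrightarrow> \<bar>lam 1 t\<bar> \<le> M'" by blast
    define C where "C = max 0 (max M M')"
    have C0: "0 \<le> C" by (simp add: C_def)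
    have C: "- C \<le> lam 1 t" if "t \<in> {0..<tB}" for t
    proof (cases "t \<le> t0")
      case True
      then have "\<bar>lam 1 t\<bar> \<le> M'" using that by (intro M') auto
      moreover have "M' \<le> C" by (simp add: C_def)
      ultimately show ?thesis by linarith
    next
      case False
      then have "- M \<le> lam 1 t" using that by (intro M) auto
      moreover have "M \<le> C" by (simp add: C_def)
      ultimately show ?thesis by linarith
    qed
    define R1 where "R1 = exp (ln rho0 + n * C * tB)"
    have rho_le: "rho t \<le> R1" if t: "t \<in> {0..<tB}" for t
    proof -
      have "ln (rho t) \<le> ln (rho 0) + n * C * (t - 0)"
      proof (rule deriv_le_imp_le_linear[OF _ _ t])
        fix t assume t: "t \<in> {0..<tB}"
        show "((\<lambda>t. ln (rho t)) has_real_derivative - (\<Sum>i=1..n. lam i t)) (at t within {0..<tB})"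
          using rho_pos[OF t] by (auto intro!: derivative_eq_intros D_rho[OF t])
        have "- C \<le> lam i t" if "i \<in> {1..n}" for i using C[OF t] lam_ge[OF t that] by simp
        then have "(\<Sum>i=1..n. - C) \<le> (\<Sum>i=1..n. lam i t)" by (intro sum_mono)
        then show "- (\<Sum>i=1..n. lam i t) \<le> n * C" by simp
      qed
      moreover have "n * C * t \<le> n * C * tB" using C0 t by (intro mult_left_mono) auto
      ultimately have "ln (rho t) \<le> ln rho0 + n * C * tB" using init by simp
      then have "exp (ln (rho t)) \<le> R1" by (simp only: R1_def exp_le_cancel_iff)
      then show ?thesis using rho_pos[OF t] by simp
    qed
    define R2 where "R2 = (\<Sum>i=1..n. \<bar>lam0 i\<bar>) + \<kappa> * R1 * tB"
    have R1: "0 < R1" by (simp add: R1_def)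
    have lam_le: "lam i t \<le> R2" if t: "t \<in> {0..<tB}" and i: "i \<in> {1..n}" for i t
    proof -
      have "lam i t \<le> lam i 0 + \<kappa> * R1 * (t - 0)"
      proof (rule deriv_le_imp_le_linear[OF D_lam[OF _ i] _ t])
        fix t assume t: "t \<in> {0..<tB}"
        have "\<kappa> * rho t \<le> \<kappa> * R1" using rho_le[OF t] \<kappa> by simp
        then show "- (lam i t)\<^sup>2 + (\<kappa> * rho t - \<omega>\<^sup>2) \<le> \<kappa> * R1"
          using zero_le_power2[of "lam i t"] zero_le_power2[of \<omega>] by linarith
      qed
      moreover have "\<kappa> * R1 * t \<le> \<kappa> * R1 * tB" using \<kappa> R1 t by (intro mult_left_mono) auto
      moreover have "\<bar>lam0 i\<bar> \<le> (\<Sum>i=1..n. \<bar>lam0 i\<bar>)" using i by (intro member_le_sum) auto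
      ultimately show ?thesis using init(2)[OF i] by (simp add: R2_def)
    qed
    define R where "R = max R1 (max R2 C)"
    have "\<exists>T>tB. \<exists>lam' rho'. REP_solution n k cb rho0 lam0 T lam' rho'"
    proof (rule bounded_REP_solution_extends[OF sol, of R])
      fix t assume t: "t \<in> {0..<tB}"
      show "\<bar>rho t\<bar> \<le> R" using rho_pos[OF t] rho_le[OF t] by (simp add: R_def)
      show "\<bar>lam i t\<bar> \<le> R" if "i \<in> {1..n}" for i
        using lam_le[OF t that] lam_ge[OF t that] C[OF t] by (auto simp: R_def abs_le_iff)
    qed
    then show False using maximal by blast
  qed
  ultimately have l_lim: "filterlim (lam 1) at_bot (at_left tB)" and U_lim: "(U \<longlongrightarrow> 0) (at_left tB)"
    and life: "\<And>t. 0 < t \<Longrightarrow> t < tB \<Longrightarrow> arctan (lam 1 t / \<omega>) + \<omega> * t \<le> - pi / 2 + \<omega> * tB" by auto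
  have lifespan: "tB \<ge> 1 / \<omega> * arctan (lam0 1 / \<omega>) + pi / (2 * \<omega>)"
  proof -
    \<comment> \<open>The inequality \<open>life\<close> holds for positive times; the initial value
      enters as \<open>t\<close> tends to 0 from the right.\<close>
    have "(lam 1 \<longlongrightarrow> lam 1 0) (at 0 within {0..<tB})"
      using cont[OF one] finite_tB by (simp add: continuous_on)
    moreover have "at 0 within {0..<tB} = at_right 0"
      using finite_tB by (intro at_within_nhd[of _ "{..<tB}"]) auto
    ultimately have "(lam 1 \<longlongrightarrow> lam0 1) (at_right 0)" using init(2)[OF one] by simp
    then have "((\<lambda>t. arctan (lam 1 t / \<omega>) + \<omega> * t) \<longlongrightarrow> arctan (lam0 1 / \<omega>) + \<omega> * 0) (at_right 0)"
      using \<omega> by (intro tendsto_intros) auto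
    moreover have "eventually (\<lambda>t. arctan (lam 1 t / \<omega>) + \<omega> * t \<le> - pi / 2 + \<omega> * tB) (at_right 0)"
      using life finite_tB unfolding eventually_at_right_field by blast
    ultimately have "arctan (lam0 1 / \<omega>) + \<omega> * 0 \<le> - pi / 2 + \<omega> * tB"
      by (rule tendsto_upperbound) simp
    then show ?thesis using \<omega> by (simp add: field_simps)
  qed
  define s where "s t = integral {0..t} (\<lambda>x. 1 / (U x)\<^sup>2)" for t
  have cont_U: "continuous_on {0..<tB} U"
    using D_U by (rule DERIV_continuous_on)
  have D_s: "(s has_real_derivative 1 / (U t)\<^sup>2) (at t within {0..<tB})" if "t \<in> {0..<tB}" for t
    unfolding s_def[abs_def]
    by (rule integral_has_real_derivative_Ico[OF _ that])
      (intro continuous_intros cont_U, use U in \<open>simp add: less_imp_neq[symmetric]\<close>)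
  have s0: "s 0 = 0" by (simp add: s_def)
  have s_pos: "0 < s t" if t: "0 < t" "t < tB" for t
  proof -
    have "s 0 < s t"
    proof (rule DERIV_pos_imp_increasing_open[OF t(1)])
      have "continuous_on {0..<tB} s"
        using D_s by (rule DERIV_continuous_on)
      then show "continuous_on {0..t} s" by (rule continuous_on_subset) (use t in auto)
      fix x assume x: "0 < x" "x < t"
      then show "\<exists>y. (s has_real_derivative y) (at x) \<and> 0 < y"
        using D_s[of x] interior[of x] t U[of x] by (intro exI[of _ "1 / (U x)\<^sup>2"]) auto
    qed
    then show ?thesis by (simp add: s0)
  qed
  define b where "b i = 1 / a i" for i
  have b_pos: "0 < b i" if "i \<in> {J<..n}" for i using a_pos[OF that] by (simp add: b_def)
  \<comment> \<open>\<open>1 / (e i * U\<^sup>2)\<close> has the derivative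
    \<open>(\<lambda>\<^sub>i - \<lambda>\<^sub>1) / (e i * U\<^sup>2) = 1 / U\<^sup>2 = s'\<close>,
    and its value at 0 is \<open>b i\<close>.\<close>
  have e_eq: "e i t = 1 / ((U t)\<^sup>2 * (s t + b i))" if t: "t \<in> {0..<tB}" and i: "i \<in> {J<..n}" for i t
  proof -
    have i': "i \<in> {1..n}" using i J by auto
    have "1 / (e i t * (U t)\<^sup>2) - s t = 1 / (e i 0 * (U 0)\<^sup>2) - s 0"
    proof (rule constant_on_Ico[OF _ t])
      fix x assume x: "x \<in> {0..<tB}"
      have pos: "e i x \<noteq> 0" "U x \<noteq> 0" using e_pos[OF x i] U[of x] by auto
      have l: "lam i x = e i x + lam 1 x" by (simp add: e_def)
      show "((\<lambda>t. 1 / (e i t * (U t)\<^sup>2) - s t) has_real_derivative 0) (at x within {0..<tB})"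
        using pos
        by (auto intro!: derivative_eq_intros D_e[OF x i'] D_U[OF x] D_s[OF x] simp: l)
          (simp add: field_simps power2_eq_square)
    qed
    moreover have "e i 0 = a i" using init(2)[OF i'] init(2)[OF one] by (simp add: e_def a_def)
    moreover have "U 0 = 1" by (simp add: U_def)
    ultimately have sb: "s t + b i = 1 / (e i t * (U t)\<^sup>2)" by (simp add: s0 b_def)
    show ?thesis unfolding sb using e_pos[OF t i] U[of t] by simp
  qed
  interpret REP_profile tB \<omega> \<kappa> n J b "lam 1" U s rho
  proof
    fix t assume t: "0 < t" "t < tB"
    then have t': "t \<in> {0..<tB}" by simp
    show "(lam 1 has_real_derivative - (lam 1 t)\<^sup>2 + (\<kappa> * rho t - \<omega>\<^sup>2)) (at t)"
      using D_lam[OF t' one] interior[OF t] by simp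
    show "(U has_real_derivative lam 1 t * U t) (at t)" using D_U[OF t'] interior[OF t] by simp
    show "(s has_real_derivative 1 / (U t)\<^sup>2) (at t)" using D_s[OF t'] interior[OF t] by simp
    show "0 < U t" "0 < s t" "0 < rho t" using U s_pos[OF t] rho_pos[OF t'] by auto
    have e0: "e i t = 0" if "i \<in> {1..J}" for i using e_low[OF t' that] by (simp add: e_def)
    have "(\<Sum>i=1..n. lam i t) = (\<Sum>i=1..n. lam 1 t + e i t)" by (simp add: e_def)
    also have "\<dots> = n * lam 1 t + (\<Sum>i=1..n. e i t)" by (simp add: sum.distrib)
    also have "(\<Sum>i=1..n. e i t) = (\<Sum>i\<in>{J<..n}. e i t)"
      using J by (intro sum.mono_neutral_right ballI e0) auto
    also have "\<dots> = (\<Sum>i\<in>{J<..n}. 1 / ((U t)\<^sup>2 * (s t + b i)))"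
      using e_eq[OF t'] by (intro sum.cong) auto
    finally have sum: "(\<Sum>i=1..n. lam i t) = n * lam 1 t + (\<Sum>i\<in>{J<..n}. 1 / ((U t)\<^sup>2 * (s t + b i)))" .
    have "- (\<Sum>i=1..n. lam i t) * rho t = - rho t * (\<Sum>i=1..n. lam i t)" by simp
    with D_rho[OF t'] show "(rho has_real_derivative - rho t * (n * lam 1 t
        + (\<Sum>i\<in>{J<..n}. 1 / ((U t)\<^sup>2 * (s t + b i))))) (at t)"
      unfolding interior[OF t] sum by (simp only:)
  qed (use finite_tB \<omega> \<kappa> n J b_pos l_lim U_lim in auto)
  have nJ: "2 * J \<le> n" using v_converges by blast
  obtain \<alpha> where \<alpha>: "(v \<longlongrightarrow> \<alpha>) (at_left tB)" using v_converges by blast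
  note \<alpha>_bounds = v_limit_bounds[OF \<alpha>]
  \<comment> \<open>From \<open>2 * J \<le> n\<close> and \<open>J \<ge> 1\<close> follows
    \<open>J < n\<close>, so \<open>\<lambda>\<^sub>n\<close> lies in the upper group.\<close>
  have nin: "n \<in> {J<..n}" "n \<in> {1..n}" using nJ J by auto
  \<comment> \<open>\<open>e n * Z\<close> is the constant \<open>a n\<close>, so
    \<open>Z = a n * U\<^sup>2 * (s + b n)\<close>, and \<open>\<lambda>\<^sub>1 * Z\<close> is
    \<open>- a n * v\<close> up to a factor tending to 1.\<close>
  define Z where "Z t = exp (integral {0..t} (\<lambda>s. lam 1 s + lam n s))" for t
  have Z: "lam 1 t * Z t = - a n * (v t * (1 + b n * (1 / s t)))" "lam n t * Z t = lam 1 t * Z t + a n"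
    if t: "0 < t" "t < tB" for t
  proof -
    have t': "t \<in> {0..<tB}" using t by simp
    have "integral {0..t} (\<lambda>t. - (lam 1 t + lam n t)) = - integral {0..t} (\<lambda>t. lam 1 t + lam n t)"
      by (rule integral_neg)
    then have eZ: "e n t * Z t = a n" using e_exp[OF t' nin(2)] by (simp add: Z_def exp_minus)
    then show "lam n t * Z t = lam 1 t * Z t + a n" by (simp add: e_def algebra_simps)
    have "Z t = a n / e n t" using eZ e_pos[OF t' nin(1)] by (simp add: field_simps)
    also have "\<dots> = a n * ((U t)\<^sup>2 * (s t + b n))" using e_eq[OF t' nin(1)] by simp
    finally have "Z t = a n * ((U t)\<^sup>2 * (s t + b n))" .
    then show "lam 1 t * Z t = - a n * (v t * (1 + b n * (1 / s t)))"
      using s_pos[OF t] unfolding v_def Q_def by (simp add: field_simps)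
  qed
  have "((\<lambda>t. - a n * (v t * (1 + b n * (1 / s t)))) \<longlongrightarrow> - a n * (\<alpha> * (1 + b n * 0))) (at_left tB)"
    by (intro tendsto_intros \<alpha> inv_s_lim)
  then have "((\<lambda>t. - a n * (v t * (1 + b n * (1 / s t)))) \<longlongrightarrow> - (a n * \<alpha>)) (at_left tB)" by simp
  then have Z1: "((\<lambda>t. lam 1 t * Z t) \<longlongrightarrow> - (a n * \<alpha>)) (at_left tB)"
    by (rule Lim_transform_eventually) (rule ev_at, simp only: Z)
  have "((\<lambda>t. lam 1 t * Z t + a n) \<longlongrightarrow> - (a n * \<alpha>) + a n) (at_left tB)"
    by (intro tendsto_intros Z1)
  then have Z2: "((\<lambda>t. lam n t * Z t) \<longlongrightarrow> - (a n * \<alpha>) + a n) (at_left tB)"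
    by (rule Lim_transform_eventually) (rule ev_at, simp only: Z)
  have an: "0 < a n" using a_pos[OF nin(1)] .
  \<comment> \<open>With \<open>p = a n * \<alpha>\<close> and
    \<open>q = a n * (1 - \<alpha>)\<close>, the bounds \<open>1 / 2 \<le> \<alpha>\<close> and
    \<open>\<alpha> \<le> 1\<close> are \<open>q \<le> p\<close> and
    \<open>0 \<le> q\<close>.\<close>
  have pq: "0 \<le> - (a n * \<alpha>) + a n" "- (a n * \<alpha>) + a n \<le> a n * \<alpha>"
    using mult_left_mono[OF \<alpha>_bounds(1), of "a n"] mult_left_mono[OF \<alpha>_bounds(2), of "a n"] an by auto
  have low: "filterlim (lam i) at_bot (at_left tB)" if "i \<in> {1..J}" for i
  proof -
    have "ev (\<lambda>t. lam i t = lam 1 t)" by (rule ev_at) (rule e_low[OF _ that], simp)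
    then show ?thesis using l_lim by (subst filterlim_cong[OF refl refl])
  qed
  have high: "filterlim (lam i) at_top (at_left tB)" if "i \<in> {J<..n}" for i
  proof -
    have "ev (\<lambda>t. lam i t = lam 1 t + 1 / ((U t)\<^sup>2 * (s t + b i)))"
    proof (rule ev_at)
      fix t assume "0 < t" "t < tB"
      then show "lam i t = lam 1 t + 1 / ((U t)\<^sup>2 * (s t + b i))"
        using e_eq[OF _ that, of t] by (simp add: e_def)
    qed
    then show ?thesis using upper_lim[OF that] by (subst filterlim_cong[OF refl refl])
  qed
  show ?thesis
    unfolding \<omega>_def[symmetric] Z_def[symmetric]
    using nJ lifespan low high \<rho>_lim Z1 Z2 pq by (intro conjI exI[of _ "a n * \<alpha>"] exI[of _ "- (a n * \<alpha>) + a n"]) auto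
qed

end
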